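(* Let $Q$ be a connected wild acyclic quiver with $n$ vertices, let $\rho$ be the spectral radius of its inverse Coxeter matrix $\Phi^{-1}$, and let $\mathbf{v}_n\in\mathbb{R}_{>0}^n$ be the unique vector with positive coordinates and norm $\|\mathbf{v}_n\|=1$ satisfying $\Phi^{-1}\mathbf{v}_n=\rho^{-1}\mathbf{v}_n$. Let $\mathbf{L}(t)=[\ln f_1(t)\ \cdots\ \ln f_n(t)]^T\in\mathbb{R}^n$ for $t\in\mathbb{Z}_{\ge0}$. Then $$\lim_{t\to\infty}\frac{1}{\rho^t}\,\mathbf{L}(t)=\eta\,\mathbf{v}_n$$ for some real number $\eta>0$.
   Context: A quiver is a finite directed graph; acyclic means without oriented cycles. A connected acyclic quiver is wild if its underlying graph is neither a Dynkin diagram of type $\mathbb{A},\mathbb{D},\mathbb{E}$ nor an affine Dynkin diagram of type $\widetilde{\mathbb{A}},\widetilde{\mathbb{D}},\widetilde{\mathbb{E}}$. Label the vertices $1,\dots,n$ so that $i>j$ whenever there is an arrow $i\to j$. Define $f_i(t)$ ($t\in\mathbb{Z}_{\ge 0}$) recursively by $f_i(0)=1$ and $$f_i(t+1)=\frac{1+\prod_{j\to i}f_j(t)\ \prod_{j\leftarrow i}f_j(t+1)}{f_i(t)},$$ the products running over all arrows ending at $i$, respectively starting at $i$, with multiplicity. These are positive integers. The Cartan matrix is $C=(c_{ij})_{1\le i,j\le n}$ with $c_{ij}$ the number of paths from $j$ to $i$ in $Q$ (trivial paths included). The Coxeter matrix is $\Phi=-C^T C^{-1}$, with inverse $\Phi^{-1}=-C(C^{-1})^T$.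 For $Q$ connected wild it is known that $\rho>1$, that $\rho$ and $1/\rho$ are eigenvalues of $\Phi^{-1}$ of multiplicity one, that all other eigenvalues $\mu$ satisfy $1/\rho<|\mu|<\rho$, and that the eigenspaces for $\rho$ and $1/\rho$ are each spanned by a vector with strictly positive coordinates. The norm $\|\cdot\|$ is the Euclidean norm. *)

theory Defs
  imports "HOL-Analysis.Analysis" "Graph_Theory.Graph_Theory"
begin

text \<open>
  A quiver is a finite multi-digraph, that is, a digraph in the sense of \<^locale>\<open>fin_digraph\<close>:
  parallel arcs are distinct elements of the arc set.  To form vectors and matrices indexed by
  the vertices, the vertices are the elements of a finite type.
\<close>

definition acyclic_quiver :: "('v, 'e) pre_digraph \<Rightarrow> bool" where
  "acyclic_quiver G \<longleftrightarrow> \<not> (\<exists>p. pre_digraph.cycle G p)"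

subsection \<open>Dynkin diagrams and wild quivers\<close>

text \<open>Isomorphism of underlying undirected multigraphs: arcs may be reversed.\<close>

definition same_underlying_graph :: "('v, 'e) pre_digraph \<Rightarrow> ('w, 'd) pre_digraph \<Rightarrow> bool" where
  "same_underlying_graph G H \<longleftrightarrow>
     (\<exists>\<phi> \<psi>. bij_betw \<phi> (verts G) (verts H) \<and> bij_betw \<psi> (arcs G) (arcs H) \<and>
        (\<forall>e\<in>arcs G. {tail H (\<psi> e), head H (\<psi> e)} = \<phi> ` {tail G e, head G e}))"

text \<open>
  The graph on the vertices \<open>0, \<dots>, n - 1\<close> with the given list of edges; the orientation of the
  listed pairs is irrelevant for \<^const>\<open>same_underlying_graph\<close>.
\<close>

definition diagram :: "nat \<Rightarrow> (nat \<times> nat) list \<Rightarrow> (nat, nat) pre_digraph" where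
  "diagram n es = \<lparr>verts = {..<n}, arcs = {..<length es},
                   tail = (\<lambda>k. fst (es ! k)), head = (\<lambda>k. snd (es ! k))\<rparr>"

text \<open>The edges of the path \<open>0 - 1 - \<dots> - (m - 1)\<close>.\<close>

definition path_edges :: "nat \<Rightarrow> (nat \<times> nat) list" where
  "path_edges m = map (\<lambda>i. (i, Suc i)) [0..<m - 1]"

inductive dynkin_ADE :: "(nat, nat) pre_digraph \<Rightarrow> bool" where
  A: "n \<ge> 1 \<Longrightarrow> dynkin_ADE (diagram n (path_edges n))"
| D: "n \<ge> 4 \<Longrightarrow> dynkin_ADE (diagram n ((n - 3, n - 1) # path_edges (n - 1)))"
| E: "n \<in> {6, 7, 8} \<Longrightarrow> dynkin_ADE (diagram n ((2, n - 1) # path_edges (n - 1)))"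

text \<open>As usual, the affine diagram with index \<open>n\<close> has \<open>n + 1\<close> vertices; the affine diagram of
  type A with index 1 consists of two vertices joined by a double edge.\<close>

inductive affine_dynkin_ADE :: "(nat, nat) pre_digraph \<Rightarrow> bool" where
  A: "n \<ge> 1 \<Longrightarrow> affine_dynkin_ADE (diagram (n + 1) ((n, 0) # path_edges (n + 1)))"
| D: "n \<ge> 4 \<Longrightarrow>
        affine_dynkin_ADE (diagram (n + 1) ((1, n - 1) # (n - 3, n) # path_edges (n - 1)))"
| E6: "affine_dynkin_ADE (diagram 7 ((2, 5) # (5, 6) # path_edges 5))"
| E7: "affine_dynkin_ADE (diagram 8 ((3, 7) # path_edges 7))"
| E8: "affine_dynkin_ADE (diagram 9 ((2, 8) # path_edges 8))"

definition wild_quiver :: "('v, 'e) pre_digraph \<Rightarrow> bool" where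
  "wild_quiver G \<longleftrightarrow>
     fin_digraph G \<and> Digraph_Component.connected G \<and> acyclic_quiver G \<and>
     \<not> (\<exists>H. (dynkin_ADE H \<or> affine_dynkin_ADE H) \<and> same_underlying_graph G H)"

subsection \<open>Cartan and Coxeter matrices\<close>

definition cartan_matrix :: "('v::finite, 'e) pre_digraph \<Rightarrow> real ^ 'v ^ 'v" where
  "cartan_matrix G = (\<chi> i j. real (card {p. pre_digraph.awalk G j p i}))"

definition coxeter_matrix :: "('v::finite, 'e) pre_digraph \<Rightarrow> real ^ 'v ^ 'v" where
  "coxeter_matrix G = - (transpose (cartan_matrix G) ** matrix_inv (cartan_matrix G))"

definition spectral_radius :: "real ^ 'n ^ 'n::finite \<Rightarrow> real" where
  "spectral_radius M =
     Max (cmod ` {\<mu>. \<exists>x :: complex ^ 'n. x \<noteq> 0 \<and> map_matrix complex_of_real M *v x = \<mu> *s x})"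

subsection \<open>The recursion\<close>

text \<open>
  Products over \<^const>\<open>in_arcs\<close> and \<^const>\<open>out_arcs\<close> run over arcs and hence account for
  multiplicities.
\<close>

definition frieze_recursion :: "('v, 'e) pre_digraph \<Rightarrow> ('v \<Rightarrow> nat \<Rightarrow> real) \<Rightarrow> bool" where
  "frieze_recursion G f \<longleftrightarrow>
     (\<forall>i. f i 0 = 1) \<and>
     (\<forall>i t. f i (Suc t) =
        (1 + (\<Prod>e\<in>in_arcs G i. f (tail G e) t) * (\<Prod>e\<in>out_arcs G i. f (head G e) (Suc t)))
          / f i t)"

text \<open>
  The value at time \<open>t + 1\<close> occurs on both sides, so the recursion determines a function only
  because the quiver is acyclic.
\<close>

lemma acyclic_quiver_wf:
  assumes "fin_digraph G" "acyclic_quiver G"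
  shows "wf ((arcs_ends G)\<inverse>)"
proof -
  interpret fin_digraph G by fact
  have "acyclic (arcs_ends G)"
  proof (rule acyclicI, rule allI, rule notI)
    fix x assume "(x, x) \<in> (arcs_ends G)\<^sup>+"
    then obtain p where p: "awalk x p x" "p \<noteq> []"
      unfolding reachable1_awalk by blast
    then have "closed_w p"
      by (auto simp: closed_w_def)
    then show False
      using closed_w_imp_cycle assms(2) by (auto simp: acyclic_quiver_def)
  qed
  moreover have "finite (arcs_ends G)"
    by (simp add: arcs_ends_def)
  ultimately show ?thesis
    by (simp add: finite_acyclic_wf_converse)
qed

lemma frieze_recursion_ex1:
  assumes "fin_digraph G" "acyclic_quiver G"
  shows "\<exists>!f. frieze_recursion G f"
proof -
  let ?R = "(arcs_ends G)\<inverse>"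
  have wf: "wf ?R"
    using assms by (rule acyclic_quiver_wf)
  have R: "(head G e, i) \<in> ?R" if "e \<in> out_arcs G i" for e i
    using that by (auto simp: arcs_ends_conv)
  define F where "F g h i =
    (1 + (\<Prod>e\<in>in_arcs G i. g (tail G e)) * (\<Prod>e\<in>out_arcs G i. h (head G e))) / g i"
    for g h :: "'a \<Rightarrow> real" and i
  define step where "step g = wfrec ?R (F g)" for g
  have step: "step g i = F g (step g) i" for g i
  proof -
    have "step g i = F g (cut (step g) ?R i) i"
      unfolding step_def by (rule wfrec[OF wf])
    also have "\<dots> = F g (step g) i"
    proof -
      have "(\<Prod>e\<in>out_arcs G i. cut (step g) ?R i (head G e)) = (\<Prod>e\<in>out_arcs G i. step g (head G e))"
        by (rule prod.cong[OF refl], rule cut_apply, rule R)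
      then show ?thesis by (simp add: F_def)
    qed
    finally show ?thesis .
  qed
  define f where "f i t = (step ^^ t) (\<lambda>_. 1) i" for i t
  have "frieze_recursion G f"
    unfolding frieze_recursion_def
  proof (intro conjI allI)
    fix i t
    have "f i (Suc t) = step (\<lambda>j. f j t) i"
      by (simp add: f_def)
    also have "\<dots> = F (\<lambda>j. f j t) (step (\<lambda>j. f j t)) i"
      by (rule step)
    also have "step (\<lambda>j. f j t) = (\<lambda>j. f j (Suc t))"
      by (simp add: f_def)
    finally show "f i (Suc t) =
        (1 + (\<Prod>e\<in>in_arcs G i. f (tail G e) t) * (\<Prod>e\<in>out_arcs G i. f (head G e) (Suc t)))
          / f i t"
      by (simp add: F_def)
  qed (simp add: f_def)
  moreover have "f1 = f2" if "frieze_recursion G f1" "frieze_recursion G f2" for f1 f2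
  proof -
    have "f1 i t = f2 i t" for i t
    proof (induction t arbitrary: i)
      case 0
      then show ?case using that unfolding frieze_recursion_def by metis
    next
      case (Suc t)
      show ?case
      proof (induction i rule: wf_induct_rule[OF wf])
        case (1 i)
        have eq: "f' i (Suc t) =
            (1 + (\<Prod>e\<in>in_arcs G i. f' (tail G e) t) * (\<Prod>e\<in>out_arcs G i. f' (head G e) (Suc t)))
              / f' i t" if "frieze_recursion G f'" for f'
          using that unfolding frieze_recursion_def by blast
        have "(\<Prod>e\<in>out_arcs G i. f1 (head G e) (Suc t)) = (\<Prod>e\<in>out_arcs G i. f2 (head G e) (Suc t))"
          by (rule prod.cong[OF refl], rule 1, rule R)
        then show ?case
          by (simp only: eq[OF that(1)] eq[OF that(2)] Suc)
      qed
    qed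
    then show ?thesis by (intro ext)
  qed
  ultimately show ?thesis by blast
qed

end

theory Submission
  imports Defs
begin

text \<open>
  Write \<open>x\<^sub>i(t) = ln f\<^sub>i(t)\<close>.  Taking logarithms turns the recursion into a linear one with a
  positive source term,
  \<open>x\<^sub>i(t+1) + x\<^sub>i(t) = (\<Sum>j\<rightarrow>i. x\<^sub>j(t)) + (\<Sum>i\<rightarrow>j. x\<^sub>j(t+1)) + e\<^sub>i(t)\<close>, where \<open>e = ln (1 + 1/P)\<close> and \<open>P\<close> is the
  product in the recursion; once all \<open>f\<^sub>i(t) \<ge> 1\<close> are known, \<open>e \<le> ln 2\<close>.  In coordinates the
  hypothesis on \<open>v\<close> says \<open>(1 + \<rho>) v\<^sub>i = (\<Sum>j\<rightarrow>i. v\<^sub>j) + \<rho> (\<Sum>i\<rightarrow>j. v\<^sub>j)\<close>, so \<open>\<rho>\<^sup>t v\<close> solves the equation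
  without source, and \<open>\<rho> \<ge> 1\<close> because the eigenvalue \<open>1/\<rho>\<close> is bounded by the spectral radius \<open>\<rho>\<close>.
  The claim is that a bounded source excites, up to the factor \<open>\<rho>\<^sup>t\<close>, only the mode \<open>v\<close>.

  The equation is of wave type and the term \<open>x\<^sub>i(t)\<close> on its left hand side spoils naive positivity arguments.
  The remedy are test functions: nonnegative functions \<open>U\<close> on time and vertices, of at most linear
  growth, which satisfy the adjoint equation with one unit source at \<open>(0, s)\<close> and otherwise with an
  inequality.  Summation by parts against \<open>U\<close> writes \<open>x\<^sub>s(t)\<close> as a combination of earlier values with
  nonnegative weights plus a nonnegative combination of the sources.  This renewal equation gives
  positivity (hence \<open>f \<ge> 1\<close>, and \<open>x(t+1) \<ge> \<epsilon> \<rho>\<^sup>t v\<close>, which makes \<open>\<eta>\<close> positive), boundedness of all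
  solutions by \<open>\<rho>\<^sup>t\<close>, and a maximum principle for the cluster points of \<open>x(t)/\<rho>\<^sup>t\<close>.

  Test functions come from the shape of the quiver, and this is where wildness enters.  If the
  underlying graph contains a cycle, a signal that runs around the cycle forever is a test function.
  If it contains none, the graph, not being a Dynkin diagram, contains an affine diagram of type D or E
  (\<open>affine_subdiagram\<close>, found along a longest path), and on it a signal can be reflected back and forth
  forever.  A test function of one vertex extends backwards along paths that lead to this vertex
  (\<open>stem\<close>).  The affine subdiagram (of type A, if there is a cycle), with its additive function, excludes \<open>\<rho> = 1\<close>: for \<open>\<rho> = 1\<close> it
  would have to be the whole graph (\<open>subadditive_embeds_iso\<close>).

  It remains to see that some cluster point of \<open>x(t)/\<rho>\<^sup>t\<close> is a multiple of \<open>v\<close>; then the whole sequence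
  converges to it, the normalised evolution having bounded powers.  Cluster points extend to bounded
  orbits for all times.  With a cycle, take a cluster point \<open>z\<close> for which the largest ratio \<open>c\<close> of its
  coordinates to those of \<open>v\<close> is maximal; the maximum principle propagates the zero of \<open>c v - z\<close> to a
  whole past time slice (\<open>zero_spreads\<close>).  Without a cycle the equation can be put into the form
  \<open>y\<^sub>k\<^sub>+\<^sub>1 + y\<^sub>k\<^sub>-\<^sub>1 = A y\<^sub>k\<close> with a symmetric matrix \<open>A\<close>, and a convexity argument for \<open>|y\<^sub>k|\<^sup>2\<close> shows that
  bounded orbits are constant (\<open>graded_orbit_constant\<close>).
\<close>

section \<open>Sums over arrows\<close>

locale vertex_quiver = fin_digraph G for G :: "('v::finite, 'e) pre_digraph" +
  assumes verts_UNIV: "verts G = UNIV"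
    and acyclic: "acyclic_quiver G"
begin

definition inn :: "('v \<Rightarrow> real) \<Rightarrow> 'v \<Rightarrow> real" where
  "inn x i = (\<Sum>e\<in>in_arcs G i. x (tail G e))"

definition out :: "('v \<Rightarrow> real) \<Rightarrow> 'v \<Rightarrow> real" where
  "out x i = (\<Sum>e\<in>out_arcs G i. x (head G e))"

text \<open>
  A rank function for inductions along arrows: acyclicity makes it strictly decreasing.
\<close>

definition depth :: "'v \<Rightarrow> nat" where
  "depth i = card {j. (i, j) \<in> (arcs_ends G)\<^sup>+}"

lemma acyclic_arcs_ends: "(i, i) \<notin> (arcs_ends G)\<^sup>+"
proof
  assume "(i, i) \<in> (arcs_ends G)\<^sup>+"
  then obtain p where p: "awalk i p i" "p \<noteq> []"
    unfolding reachable1_awalk by blast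
  then have "closed_w p"
    by (auto simp: closed_w_def)
  then show False
    using closed_w_imp_cycle acyclic by (auto simp: acyclic_quiver_def)
qed

lemma arc_in_arcs_ends: "e \<in> arcs G \<Longrightarrow> (tail G e, head G e) \<in> arcs_ends G"
  by (auto simp: arcs_ends_conv)

lemma depth_decreases: "e \<in> arcs G \<Longrightarrow> depth (head G e) < depth (tail G e)"
  unfolding depth_def
proof (rule psubset_card_mono)
  assume e: "e \<in> arcs G"
  let ?S = "\<lambda>i. {j. (i, j) \<in> (arcs_ends G)\<^sup>+}"
  have "?S (head G e) \<subseteq> ?S (tail G e)"
    using arc_in_arcs_ends[OF e] by (auto intro: trancl_into_trancl2)
  moreover have "head G e \<in> ?S (tail G e)"
    using arc_in_arcs_ends[OF e] by auto
  moreover have "head G e \<notin> ?S (head G e)"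
    using acyclic_arcs_ends by auto
  ultimately show "?S (head G e) \<subset> ?S (tail G e)" by blast
qed simp

lemma no_loop: "e \<in> arcs G \<Longrightarrow> tail G e \<noteq> head G e"
  using depth_decreases[of e] by auto

lemma out_mono: "(\<And>j. x j \<le> y j) \<Longrightarrow> out x i \<le> out y i"
  unfolding out_def by (rule sum_mono) auto

lemma inn_nonneg: "(\<And>j. 0 \<le> x j) \<Longrightarrow> 0 \<le> inn x i"
  unfolding inn_def by (rule sum_nonneg) auto

lemma out_nonneg: "(\<And>j. 0 \<le> x j) \<Longrightarrow> 0 \<le> out x i"
  unfolding out_def by (rule sum_nonneg) auto

lemma inn_add: "inn (\<lambda>j. x j + y j) i = inn x i + inn y i"
  by (simp add: inn_def sum.distrib)

lemma out_add: "out (\<lambda>j. x j + y j) i = out x i + out y i"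
  by (simp add: out_def sum.distrib)

lemma inn_diff: "inn (\<lambda>j. x j - y j) i = inn x i - inn y i"
  by (simp add: inn_def sum_subtractf)

lemma out_diff: "out (\<lambda>j. x j - y j) i = out x i - out y i"
  by (simp add: out_def sum_subtractf)

lemma inn_scale: "inn (\<lambda>j. c * x j) i = c * inn x i"
  by (simp add: inn_def sum_distrib_left)

lemma out_scale: "out (\<lambda>j. c * x j) i = c * out x i"
  by (simp add: out_def sum_distrib_left)

lemma inn_zero [simp]: "inn (\<lambda>j. 0) i = 0"
  by (simp add: inn_def)

lemma out_zero [simp]: "out (\<lambda>j. 0) i = 0"
  by (simp add: out_def)

lemma inn_ge: "e \<in> arcs G \<Longrightarrow> (\<And>j. 0 \<le> x j) \<Longrightarrow> x (tail G e) \<le> inn x (head G e)"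
  unfolding inn_def
  by (rule member_le_sum[where f = "\<lambda>e. x (tail G e)"]) auto

lemma out_ge: "e \<in> arcs G \<Longrightarrow> (\<And>j. 0 \<le> x j) \<Longrightarrow> x (head G e) \<le> out x (tail G e)"
  unfolding out_def
  by (rule member_le_sum[where f = "\<lambda>e. x (head G e)"]) auto

lemma inn_pos_witness:
  assumes "inn x i > 0"
  shows "\<exists>e\<in>arcs G. head G e = i \<and> x (tail G e) > 0"
proof (rule ccontr)
  assume "\<not> ?thesis"
  then have "inn x i \<le> 0"
    unfolding inn_def by (intro sum_nonpos) (auto simp: not_less)
  with assms show False by simp
qed

lemma out_pos_witness:
  assumes "out x i > 0"
  shows "\<exists>e\<in>arcs G. tail G e = i \<and> x (head G e) > 0"
proof (rule ccontr)
  assume "\<not> ?thesis"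
  then have "out x i \<le> 0"
    unfolding out_def by (intro sum_nonpos) (auto simp: not_less)
  with assms show False by simp
qed

lemma inn_as_arc_sum: "inn x i = (\<Sum>e\<in>arcs G. if head G e = i then x (tail G e) else 0)"
  unfolding inn_def in_arcs_def by (subst sum.inter_filter[symmetric]) auto

lemma out_as_arc_sum: "out x i = (\<Sum>e\<in>arcs G. if tail G e = i then x (head G e) else 0)"
  unfolding out_def out_arcs_def by (subst sum.inter_filter[symmetric]) auto

lemma inn_out_adjoint: "(\<Sum>i\<in>UNIV. a i * inn b i) = (\<Sum>i\<in>UNIV. out a i * b i)"
proof -
  have "(\<Sum>i\<in>UNIV. a i * inn b i)
      = (\<Sum>i\<in>UNIV. \<Sum>e\<in>arcs G. if head G e = i then a i * b (tail G e) else 0)"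
    by (simp add: inn_as_arc_sum sum_distrib_left if_distrib cong: if_cong)
  also have "\<dots> = (\<Sum>e\<in>arcs G. a (head G e) * b (tail G e))"
    by (subst sum.swap) simp
  also have "\<dots> = (\<Sum>i\<in>UNIV. \<Sum>e\<in>arcs G. if tail G e = i then a (head G e) * b i else 0)"
    by (subst sum.swap) simp
  also have "\<dots> = (\<Sum>i\<in>UNIV. out a i * b i)"
    by (simp add: out_as_arc_sum sum_distrib_right if_distrib[of "\<lambda>z. z * b _"] cong: if_cong)
  finally show ?thesis .
qed

lemma connected_closed_UNIV:
  assumes "Digraph_Component.connected G" "i \<in> S"
    and "\<And>e. e \<in> arcs G \<Longrightarrow> tail G e \<in> S \<longleftrightarrow> head G e \<in> S"
  shows "S = UNIV"
proof -
  have "j \<in> S" for j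
  proof -
    have "(i, j) \<in> rtrancl_on (verts G) ((arcs_ends G)\<^sup>s)"
      using assms(1) verts_UNIV by (auto simp: connected_conv)
    then show ?thesis
    proof (induction rule: rtrancl_on_induct)
      case base then show ?case using assms(2) by simp
    next
      case (step j k)
      then have "(j, k) \<in> arcs_ends G \<or> (k, j) \<in> arcs_ends G"
        by (auto simp: symcl_def)
      then show ?case
        using step assms(3) by (auto simp: arcs_ends_conv)
    qed
  qed
  then show ?thesis by auto
qed

section \<open>Test functions\<close>

text \<open>
  The source terms of a sequence \<open>x\<close>: at time 0 the part of the equation that involves time 0 only, so that
  \<open>x\<close> is determined by its gap and the gap of an orbit of the evolution vanishes after time 0.
\<close>

definition gap :: "(nat \<Rightarrow> 'v \<Rightarrow> real) \<Rightarrow> nat \<Rightarrow> 'v \<Rightarrow> real" where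
  "gap x t i = x t i - out (x t) i + (case t of 0 \<Rightarrow> 0 | Suc t' \<Rightarrow> x t' i - inn (x t') i)"

text \<open>
  The adjoint of \<^const>\<open>gap\<close>: arrows are traversed in the opposite direction.
\<close>

definition defect :: "(nat \<Rightarrow> 'v \<Rightarrow> real) \<Rightarrow> nat \<Rightarrow> 'v \<Rightarrow> real" where
  "defect U r j = U r j - inn (U r) j + (case r of 0 \<Rightarrow> 0 | Suc r' \<Rightarrow> U r' j - out (U r') j)"

text \<open>
  What a function with source at \<open>s\<close> falls short of solving the adjoint equation.
\<close>

definition weight :: "'v \<Rightarrow> (nat \<Rightarrow> 'v \<Rightarrow> real) \<Rightarrow> nat \<Rightarrow> 'v \<Rightarrow> real" where
  "weight s U r j = (if r = 0 \<and> j = s then 1 else 0) - defect U r j"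

lemma gap_0: "gap x 0 i = x 0 i - out (x 0) i"
  and gap_Suc: "gap x (Suc t) i = x (Suc t) i - out (x (Suc t)) i + (x t i - inn (x t) i)"
  by (simp_all add: gap_def)

lemma weight_0: "weight s U 0 j = (if j = s then 1 else 0) - U 0 j + inn (U 0) j"
  and weight_Suc: "weight s U (Suc r) j = inn (U (Suc r)) j + out (U r) j - U (Suc r) j - U r j"
  by (simp_all add: weight_def defect_def)

text \<open>
  Summation by parts.  If the weights are nonnegative, this is a renewal equation that expresses \<open>x\<close> at \<open>s\<close>
  through its own past and its gaps; everything about the growth of solutions is drawn from it.
\<close>

lemma test_identity:
  "x t s = (\<Sum>r\<le>t. \<Sum>j\<in>UNIV. weight s U r j * x (t - r) j)
         + (\<Sum>r\<le>t. \<Sum>j\<in>UNIV. U r j * gap x (t - r) j)"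
proof -
  define A where "A r q = (\<Sum>j\<in>UNIV. U r j * (x q j - out (x q) j))" for r q
  define B where "B r q = (\<Sum>j\<in>UNIV. U r j * (x q j - inn (x q) j))" for r q
  have A: "A r q = (\<Sum>j\<in>UNIV. (U r j - inn (U r) j) * x q j)" for r q
    using inn_out_adjoint[of "x q" "U r"]
    by (simp add: A_def algebra_simps sum_subtractf)
  have B: "B r q = (\<Sum>j\<in>UNIV. (U r j - out (U r) j) * x q j)" for r q
    using inn_out_adjoint[of "U r" "x q"]
    by (simp add: B_def algebra_simps sum_subtractf)
  have w: "(\<Sum>j\<in>UNIV. weight s U r j * x q j)
      = (if r = 0 then x q s else 0) - A r q - (case r of 0 \<Rightarrow> 0 | Suc r' \<Rightarrow> B r' q)" for r q
  proof (cases r)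
    case 0
    have "(\<Sum>j\<in>UNIV. weight s U r j * x q j) = (\<Sum>j\<in>UNIV. (if j = s then x q s else 0) - (U r j - inn (U r) j) * x q j)"
      by (rule sum.cong) (auto simp: 0 weight_def defect_def algebra_simps)
    then show ?thesis by (simp add: A 0 sum_subtractf)
  next
    case (Suc r')
    then show ?thesis
      by (simp add: A B weight_def defect_def sum_subtractf[symmetric] sum.distrib[symmetric] algebra_simps sum_negf[symmetric] del: sum_negf)
  qed
  have g: "(\<Sum>j\<in>UNIV. U r j * gap x q j) = A r q + (case q of 0 \<Rightarrow> 0 | Suc q' \<Rightarrow> B r q')" for r q
    by (cases q) (auto simp: A_def B_def gap_def distrib_left sum.distrib)
  have shift: "(\<Sum>r\<le>t. case r of 0 \<Rightarrow> 0 | Suc r' \<Rightarrow> B r' (t - r))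
      = (\<Sum>r\<le>t. case t - r of 0 \<Rightarrow> 0 | Suc q' \<Rightarrow> B r q')"
  proof (cases t)
    case (Suc t')
    have "(\<Sum>r\<le>t. case r of 0 \<Rightarrow> 0 | Suc r' \<Rightarrow> B r' (t - r)) = (\<Sum>r\<le>t'. B r (t' - r))"
      unfolding Suc by (subst sum.atMost_Suc_shift) simp
    also have "\<dots> = (\<Sum>r\<le>t'. case t - r of 0 \<Rightarrow> 0 | Suc q' \<Rightarrow> B r q')"
      by (rule sum.cong) (auto simp: Suc Suc_diff_le)
    also have "\<dots> = (\<Sum>r\<le>t. case t - r of 0 \<Rightarrow> 0 | Suc q' \<Rightarrow> B r q')"
      by (simp add: Suc)
    finally show ?thesis .
  qed simp
  have x0: "(\<Sum>r\<le>t. if r = 0 then x (t - r) s else 0) = x t s"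
  proof -
    have "(\<Sum>r\<le>t. if r = 0 then x (t - r) s else 0) = (\<Sum>r\<le>t. if r = 0 then x t s else 0)"
      by (rule sum.cong) auto
    then show ?thesis by simp
  qed
  show ?thesis
    by (simp add: w g sum_subtractf sum.distrib shift x0)
qed

text \<open>
  Linear growth is what signals along walks produce; it is negligible against \<open>\<rho>\<^sup>r\<close> when \<open>\<rho> > 1\<close>.
\<close>

definition test_function :: "'v \<Rightarrow> (nat \<Rightarrow> 'v \<Rightarrow> real) \<Rightarrow> bool" where
  "test_function s U \<longleftrightarrow> (\<forall>r j. 0 \<le> U r j) \<and> (\<forall>r j. 0 \<le> weight s U r j) \<and> U 0 s = 1
     \<and> (\<exists>K. \<forall>r j. U r j \<le> K * real (Suc r))"

lemma test_function_support:
  assumes "test_function s U" "U 0 j > 0"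
  shows "(s, j) \<in> (arcs_ends G)\<^sup>*"
  using assms(2)
proof (induction "CARD('v) - depth j" arbitrary: j rule: less_induct)
  case less
  have d: "depth k \<le> CARD('v)" for k
    unfolding depth_def by (rule card_mono) auto
  show ?case
  proof (cases "j = s")
    case False
    have "0 \<le> weight s U 0 j"
      using assms(1) by (auto simp: test_function_def)
    then have "inn (U 0) j > 0"
      using less.prems False by (auto simp: weight_0)
    then obtain e where e: "e \<in> arcs G" "head G e = j" "U 0 (tail G e) > 0"
      using inn_pos_witness by blast
    have "(s, tail G e) \<in> (arcs_ends G)\<^sup>*"
      using depth_decreases[OF e(1)] e d[of "tail G e"] by (intro less.hyps) auto
    then show ?thesis
      using arc_in_arcs_ends[OF e(1)] e(2) by auto
  qed auto
qed

lemma weight_0_support: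
  assumes "test_function s U" "weight s U 0 j \<noteq> 0"
  shows "(s, j) \<in> (arcs_ends G)\<^sup>+"
proof -
  have w: "0 \<le> weight s U 0 k" for k
    using assms(1) by (auto simp: test_function_def)
  have U: "0 \<le> U 0 k" "U 0 s = 1" for k
    using assms(1) by (auto simp: test_function_def)
  have step: "(s, k) \<in> (arcs_ends G)\<^sup>+" if pos: "inn (U 0) k > 0" for k
  proof -
    obtain e where e: "e \<in> arcs G" "head G e = k" "U 0 (tail G e) > 0"
      using inn_pos_witness[OF pos] by blast
    then show ?thesis
      using test_function_support[OF assms(1) e(3)] arc_in_arcs_ends[OF e(1)] by auto
  qed
  have "inn (U 0) j > 0"
  proof (cases "j = s")
    case True
    then show ?thesis using assms(2) w[of j] U by (auto simp: weight_0)
  next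
    case False
    then show ?thesis using assms(2) w[of j] U(1)[of j] by (auto simp: weight_0)
  qed
  then show ?thesis by (rule step)
qed

lemma depth_trancl: "(i, j) \<in> (arcs_ends G)\<^sup>+ \<Longrightarrow> depth j < depth i"
proof (induction rule: trancl_induct)
  case (base j)
  then show ?case using depth_decreases by (auto simp: arcs_ends_conv)
next
  case (step j k)
  then have "depth k < depth j" using depth_decreases by (auto simp: arcs_ends_conv)
  with step show ?case by simp
qed

lemma defect_linear:
  "defect (\<lambda>r j. U r j + (\<Sum>k\<in>UNIV. c k * V k r j)) r j = defect U r j + (\<Sum>k\<in>UNIV. c k * defect (V k) r j)"
proof -
  have i: "inn (\<lambda>j. \<Sum>k\<in>UNIV. c k * V k q j) j = (\<Sum>k\<in>UNIV. c k * inn (V k q) j)" for q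
    unfolding inn_def by (subst sum.swap) (simp add: sum_distrib_left)
  have o: "out (\<lambda>j. \<Sum>k\<in>UNIV. c k * V k q j) j = (\<Sum>k\<in>UNIV. c k * out (V k q) j)" for q
    unfolding out_def by (subst sum.swap) (simp add: sum_distrib_left)
  show ?thesis
    by (cases r) (simp_all add: defect_def inn_add out_add i o algebra_simps sum_subtractf sum.distrib)
qed

text \<open>
  In the renewal equation weights at delay 0 refer to values at the same time.  They only point to proper
  successors of \<open>s\<close>, so they can be eliminated by substituting the test functions of those vertices,
  recursively along the acyclic order.
\<close>

lemma strict_test_function:
  assumes "\<And>s. \<exists>U. test_function s U"
  shows "\<exists>U. test_function s U \<and> (\<forall>j. weight s U 0 j = 0)"
proof (induction "depth s" arbitrary: s rule: less_induct)
  case less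
  obtain U where U: "test_function s U" using assms by blast
  define c where "c = weight s U 0"
  have "\<exists>V. c k \<noteq> 0 \<longrightarrow> test_function k V \<and> (\<forall>j. weight k V 0 j = 0)" for k
    using weight_0_support[OF U, of k] depth_trancl less.hyps unfolding c_def by blast
  then obtain V' where V': "c k \<noteq> 0 \<longrightarrow> test_function k (V' k) \<and> (\<forall>j. weight k (V' k) 0 j = 0)" for k
    by metis
  define V where "V k = (if c k = 0 then (\<lambda>_ _. 0) else V' k)" for k
  have c: "0 \<le> c k" for k using U by (auto simp: c_def test_function_def)
  define W where "W r j = U r j + (\<Sum>k\<in>UNIV. c k * V k r j)" for r j
  have V0: "0 \<le> V k r j" for k r j
    using V'[of k] by (auto simp: V_def test_function_def)
  have wt: "weight s W r j = weight s U r j - (if r = 0 then c j else 0) + (\<Sum>k\<in>UNIV. c k * weight k (V k) r j)" for r j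
  proof -
    have "(\<Sum>k\<in>UNIV. c k * weight k (V k) r j)
        = (\<Sum>k\<in>UNIV. (if k = j then (if r = 0 then c j else 0) else 0) - c k * defect (V k) r j)"
      by (rule sum.cong) (auto simp: weight_def algebra_simps)
    also have "\<dots> = (if r = 0 then c j else 0) - (\<Sum>k\<in>UNIV. c k * defect (V k) r j)"
      by (simp add: sum_subtractf)
    finally show ?thesis
      using defect_linear[of U c V r j]
      by (simp add: weight_def W_def[abs_def])
  qed
  have cw: "0 \<le> c k * weight k (V k) r j" for k r j
    using V'[of k] c[of k] by (cases "c k = 0") (auto simp: V_def test_function_def)
  have cw0: "c k * weight k (V k) 0 j = 0" for k j
    using V'[of k] by (cases "c k = 0") (auto simp: V_def)
  have w0: "weight s W 0 j = 0" for j
    unfolding wt cw0 by (simp add: c_def)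
  have wpos: "0 \<le> weight s W r j" for r j
  proof (cases "r = 0")
    case False
    have "0 \<le> weight s U r j" using U by (auto simp: test_function_def)
    then show ?thesis unfolding wt using False cw by (simp add: sum_nonneg)
  qed (simp add: w0)
  have Ws: "W 0 s = 1"
  proof -
    have "c k * V k 0 s = 0" for k
    proof (rule ccontr)
      assume a: "c k * V k 0 s \<noteq> 0"
      then have "test_function k (V k)" "V k 0 s > 0" "(s, k) \<in> (arcs_ends G)\<^sup>+"
        using V'[of k] V0[of k 0 s] weight_0_support[OF U, of k]
        by (auto simp: V_def c_def)
      then show False
        using test_function_support[of k "V k" s] acyclic_arcs_ends[of s]
        by (meson trancl_rtrancl_trancl)
    qed
    then have "(\<Sum>k\<in>UNIV. c k * V k 0 s) = 0" by (intro sum.neutral) blast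
    then show ?thesis using U by (simp add: W_def test_function_def)
  qed
  obtain K where K: "U r j \<le> K * real (Suc r)" for r j
    using U by (auto simp: test_function_def)
  have "\<exists>K. \<forall>r j. V k r j \<le> K * real (Suc r)" for k
    using V'[of k] by (cases "c k = 0") (auto simp: V_def test_function_def intro: exI[of _ 0])
  then obtain KV where KV: "V k r j \<le> KV k * real (Suc r)" for k r j
    by metis
  have "W r j \<le> (K + (\<Sum>k\<in>UNIV. c k * KV k)) * real (Suc r)" for r j
    unfolding W_def distrib_right sum_distrib_right
    by (intro add_mono K sum_mono) (use KV c in \<open>simp add: mult.assoc mult_left_mono\<close>)
  then have "test_function s W"
    using wpos Ws V0 c U unfolding test_function_def
    by (auto simp: W_def intro!: add_nonneg_nonneg sum_nonneg)
  with w0 show ?case by blast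
qed

end

context vertex_quiver begin

section \<open>Extending test functions along stems\<close>

definition incident :: "'e \<Rightarrow> 'v \<Rightarrow> bool" where
  "incident e i \<longleftrightarrow> e \<in> arcs G \<and> (tail G e = i \<or> head G e = i)"

definition other_end :: "'e \<Rightarrow> 'v \<Rightarrow> 'v" where
  "other_end e i = (if tail G e = i then head G e else tail G e)"

lemma other_end_other_end: "incident e i \<Longrightarrow> other_end e (other_end e i) = i"
  and other_end_neq: "incident e i \<Longrightarrow> other_end e i \<noteq> i"
  using no_loop[of e] by (auto simp: incident_def other_end_def)

text \<open>
  The first step along \<open>e\<close> leads to the same time slice if \<open>e\<close> starts at \<open>q\<close> and to the next one if it ends
  there.  Slack means that the value 1 at the source allows the value at the other end of \<open>e\<close> to be raised by 1
  at that moment.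
\<close>

definition slack :: "'v \<Rightarrow> (nat \<Rightarrow> 'v \<Rightarrow> real) \<Rightarrow> 'e \<Rightarrow> bool" where
  "slack q U e \<longleftrightarrow> weight q U (if tail G e = q then 0 else 1) (other_end e q) \<ge> 1"

text \<open>
  A hub can send its signal away from any given arrow.
\<close>

definition hub :: "'v \<Rightarrow> bool" where
  "hub q \<longleftrightarrow> (\<forall>e. incident e q \<longrightarrow> (\<exists>U. test_function q U \<and> slack q U e))"

definition indic :: "'v \<Rightarrow> 'v \<Rightarrow> real" where
  "indic s j = (if j = s then 1 else 0)"

lemma inn_indic_ge_1: "e \<in> arcs G \<Longrightarrow> inn (indic (tail G e)) (head G e) \<ge> 1"
  using inn_ge[of e "indic (tail G e)"] by (simp add: indic_def)

lemma out_indic_ge_1: "e \<in> arcs G \<Longrightarrow> out (indic (head G e)) (tail G e) \<ge> 1"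
  using out_ge[of e "indic (head G e)"] by (simp add: indic_def)

lemma inn_indic_ge_2:
  assumes "e \<in> arcs G" "e' \<in> arcs G" "e \<noteq> e'" "tail G e' = tail G e" "head G e' = head G e"
  shows "inn (indic (tail G e)) (head G e) \<ge> 2"
proof -
  have "(\<Sum>e'\<in>{e, e'}. indic (tail G e) (tail G e')) \<le> inn (indic (tail G e)) (head G e)"
    unfolding inn_def by (rule sum_mono2) (use assms in \<open>auto simp: indic_def\<close>)
  then show ?thesis using assms by (simp add: indic_def)
qed

lemma out_indic_ge_2:
  assumes "e \<in> arcs G" "e' \<in> arcs G" "e \<noteq> e'" "tail G e' = tail G e" "head G e' = head G e"
  shows "out (indic (head G e)) (tail G e) \<ge> 2"
proof -
  have "(\<Sum>e'\<in>{e, e'}. indic (head G e) (head G e')) \<le> out (indic (head G e)) (tail G e)"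
    unfolding out_def by (rule sum_mono2) (use assms in \<open>auto simp: indic_def\<close>)
  then show ?thesis using assms by (simp add: indic_def)
qed

lemma indic_nonneg: "0 \<le> indic s j"
  by (simp add: indic_def)

lemma indic_sums_nonneg: "0 \<le> inn (indic s) j" "0 \<le> out (indic s) j"
  by (simp_all add: inn_nonneg out_nonneg indic_nonneg)

text \<open>
  A unit signal that starts at \<open>s\<close> and reaches \<open>q\<close> along \<open>e\<close> may be continued by any test function of \<open>q\<close>, provided
  the latter has slack along \<open>e\<close>: the value 1 at \<open>s\<close> must be paid for one time step later at \<open>s\<close> itself.  All other
  arrows at \<open>s\<close> then have slack, so the construction can be repeated as long as it does not backtrack.
\<close>

lemma stem:
  assumes U: "test_function q U" and e: "incident e q" and sl: "slack q U e"
  defines "s \<equiv> other_end e q"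
  shows "\<exists>U'. test_function s U' \<and> (\<forall>e'. incident e' s \<and> e' \<noteq> e \<longrightarrow> slack s U' e')
           \<and> (\<forall>r p. p \<noteq> s \<and> weight q U r p > 0 \<longrightarrow> (\<exists>r'. weight s U' r' p > 0))"
proof -
  have arc: "e \<in> arcs G" and sq: "s \<noteq> q"
    using e other_end_neq[OF e] by (auto simp: incident_def s_def)
  have U0: "0 \<le> U r j" "0 \<le> weight q U r j" for r j
    using U by (auto simp: test_function_def)
  obtain K where K: "U r j \<le> K * real (Suc r)" for r j
    using U by (auto simp: test_function_def)
  have K0: "0 \<le> K" using K[of 0 q] U0(1)[of 0 q] by simp
  note iv = indic_sums_nonneg
  show ?thesis
  proof (cases "tail G e = q")
    case False
    then have es: "tail G e = s" "head G e = q"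
      using e by (auto simp: incident_def s_def other_end_def)
    define U' where "U' r j = U r j + (if r = 0 then indic s j else 0)" for r j
    have U'_0: "U' 0 = (\<lambda>j. U 0 j + indic s j)" and U'_Suc: "U' (Suc r) = U (Suc r)" for r
      by (simp_all add: U'_def fun_eq_iff)
    have w: "weight s U' r j = weight q U r j
       + (if r = 0 then inn (indic s) j - indic q j else if r = 1 then out (indic s) j - indic s j else 0)" for r j
    proof (cases r)
      case (Suc r')
      then show ?thesis
        by (cases r') (simp_all add: weight_def defect_def U'_0 U'_Suc inn_add out_add)
    qed (simp add: weight_def defect_def U'_0 inn_add, simp add: indic_def)
    have sl1: "weight q U 1 s \<ge> 1"
      using sl es False by (simp add: slack_def s_def[symmetric])
    have "U 0 s = 0"
    proof (rule ccontr)
      assume "U 0 s \<noteq> 0"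
      then have "(q, s) \<in> (arcs_ends G)\<^sup>*"
        using test_function_support[OF U, of s] U0(1)[of 0 s] by auto
      moreover have "(s, q) \<in> arcs_ends G"
        using arc_in_arcs_ends[OF arc] es by simp
      ultimately show False using acyclic_arcs_ends[of s] by (meson rtrancl_into_trancl2)
    qed
    then have "U' 0 s = 1" by (simp add: U'_def indic_def)
    moreover have "0 \<le> weight s U' r j" for r j
      using U0(2)[of r j] iv[of s j] sl1 inn_indic_ge_1[OF arc] es sq
      unfolding w by (auto simp: indic_def)
    moreover have "U' r j \<le> (K + 1) * real (Suc r)" for r j
      using K[of r j] by (auto simp: U'_def indic_def algebra_simps)
    moreover have "0 \<le> U' r j" for r j
      using U0(1)[of r j] by (auto simp: U'_def indic_def)
    ultimately have "test_function s U'"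
      unfolding test_function_def by blast
    moreover have "slack s U' e'" if e': "incident e' s" "e' \<noteq> e" for e'
    proof (cases "tail G e' = s")
      case True
      have a': "e' \<in> arcs G" using e' by (simp add: incident_def)
      show ?thesis
      proof (cases "head G e' = q")
        case True
        have "inn (indic s) q \<ge> 2"
          using inn_indic_ge_2[OF arc a'] e' es True \<open>tail G e' = s\<close> by simp
        then show ?thesis
          using U0(2)[of 0 q] True \<open>tail G e' = s\<close> by (simp add: slack_def w other_end_def indic_def)
      next
        case False
        then show ?thesis
          using U0(2)[of 0 "head G e'"] inn_indic_ge_1[OF a'] \<open>tail G e' = s\<close>
          by (simp add: slack_def w other_end_def indic_def)
      qed
    next
      case False
      have a': "e' \<in> arcs G" "head G e' = s" using e' False by (auto simp: incident_def)
      then show ?thesis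
        using U0(2)[of 1 "tail G e'"] out_indic_ge_1[OF a'(1)] False
        by (simp add: slack_def w other_end_def indic_def)
    qed
    moreover have "weight s U' r p > 0" if "p \<noteq> s" "weight q U r p > 0" for r p
      using that iv[of s p] inn_indic_ge_1[OF arc] es unfolding w by (auto simp: indic_def)
    ultimately show ?thesis by blast
  next
    case True
    then have es: "tail G e = q" "head G e = s"
      using e by (auto simp: incident_def s_def other_end_def)
    define U' where "U' r j = (case r of 0 \<Rightarrow> indic s j | Suc r' \<Rightarrow> U r' j)" for r j
    have U'_0: "U' 0 = indic s" and U'_Suc: "U' (Suc r) = U r" for r
      by (simp_all add: U'_def fun_eq_iff)
    have w0: "weight s U' 0 j = inn (indic s) j" for j
      by (simp add: weight_def defect_def U'_0) (simp add: indic_def)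
    have w1: "weight s U' (Suc 0) j = weight q U 0 j - indic q j + out (indic s) j - indic s j" for j
      by (simp add: weight_def defect_def U'_0 U'_Suc) (simp add: indic_def)
    have w2: "weight s U' (Suc (Suc r)) j = weight q U (Suc r) j" for r j
      by (simp add: weight_def defect_def U'_Suc)
    have sl1: "weight q U 0 s \<ge> 1"
      using sl es by (simp add: slack_def s_def[symmetric])
    have "U' 0 s = 1" by (simp add: U'_def indic_def)
    moreover have "0 \<le> weight s U' r j" for r j
    proof (cases r)
      case (Suc r')
      then show ?thesis
        using U0(2)[of 0 j] U0(2)[of r' j] iv[of s j] sl1 out_indic_ge_1[OF arc] es sq
        by (cases r') (auto simp: w1 w2 indic_def)
    qed (simp add: w0 iv)
    moreover have "U' r j \<le> (K + 1) * real (Suc r)" for r j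
    proof (cases r)
      case (Suc r')
      have "K * real (Suc r') \<le> (K + 1) * real (Suc r)"
        using K0 by (intro mult_mono) (auto simp: Suc)
      with K[of r' j] show ?thesis by (simp add: U'_def Suc)
    qed (use K0 in \<open>simp add: U'_def indic_def\<close>)
    moreover have "0 \<le> U' r j" for r j
      using U0(1) by (cases r) (auto simp: U'_def indic_def)
    ultimately have "test_function s U'"
      unfolding test_function_def by blast
    moreover have "slack s U' e'" if e': "incident e' s" "e' \<noteq> e" for e'
    proof (cases "tail G e' = s")
      case True
      have a': "e' \<in> arcs G" using e' by (simp add: incident_def)
      then show ?thesis
        using inn_indic_ge_1[OF a'] True by (simp add: slack_def w0 other_end_def)
    next
      case False
      have a': "e' \<in> arcs G" "head G e' = s" using e' False by (auto simp: incident_def)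
      show ?thesis
      proof (cases "tail G e' = q")
        case True
        have "out (indic s) q \<ge> 2"
          using out_indic_ge_2[OF arc a'(1)] e' es True a'(2) by simp
        then show ?thesis
          using U0(2)[of 0 q] True False sq by (simp add: slack_def w1 other_end_def indic_def)
      next
        case neq: False
        then show ?thesis
          using U0(2)[of 0 "tail G e'"] out_indic_ge_1[OF a'(1)] False a'(2)
          by (simp add: slack_def w1 other_end_def indic_def)
      qed
    qed
    moreover have "weight s U' (Suc r) p > 0" if "p \<noteq> s" "weight q U r p > 0" for r p
      using that iv[of s p] out_indic_ge_1[OF arc] es
      by (cases r) (auto simp: w1 w2 indic_def)
    ultimately show ?thesis by blast
  qed
qed

text \<open>
  Pairs of a vertex and the last arrow of a non-backtracking walk that leads to it from \<open>L\<close> and avoids \<open>L\<close>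
  afterwards.
\<close>

inductive reached_through :: "'v set \<Rightarrow> 'v \<Rightarrow> 'e \<Rightarrow> bool" for L where
  start: "q \<in> L \<Longrightarrow> incident e q \<Longrightarrow> other_end e q \<notin> L \<Longrightarrow> reached_through L (other_end e q) e"
| extend: "reached_through L s e \<Longrightarrow> incident e' s \<Longrightarrow> e' \<noteq> e \<Longrightarrow> other_end e' s \<notin> L
     \<Longrightarrow> reached_through L (other_end e' s) e'"

lemma reached_through_all:
  assumes "Digraph_Component.connected G" "L \<noteq> {}" "s \<notin> L"
  shows "\<exists>e. reached_through L s e"
proof -
  let ?R = "L \<union> {s. \<exists>e. reached_through L s e}"
  have nb: "other_end f s \<in> ?R" if "s \<in> ?R" "incident f s" for f s
  proof (cases "s \<in> L")
    case True
    then show ?thesis using start[of s L f] that by auto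
  next
    case False
    with \<open>s \<in> ?R\<close> have "\<exists>e. reached_through L s e" by blast
    then obtain e where e: "reached_through L s e" by blast
    show ?thesis
    proof (cases "f = e")
      case True
      from e show ?thesis
      proof cases
        case (start q)
        then show ?thesis using True other_end_other_end by auto
      next
        case (extend s' e'')
        then show ?thesis using True other_end_other_end by auto
      qed
    next
      case False
      then show ?thesis using extend[OF e that(2)] by auto
    qed
  qed
  obtain q where "q \<in> ?R" using assms(2) by auto
  then have "?R = UNIV"
  proof (rule connected_closed_UNIV[OF assms(1)])
    fix e assume "e \<in> arcs G"
    then have "incident e (tail G e)" "incident e (head G e)" "other_end e (tail G e) = head G e"
      "other_end e (head G e) = tail G e"
      using no_loop[of e] by (auto simp: incident_def other_end_def)
    then show "tail G e \<in> ?R \<longleftrightarrow> head G e \<in> ?R"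
      using nb[of "tail G e" e] nb[of "head G e" e] by metis
  qed
  then show ?thesis using assms(3) by blast
qed

text \<open>
  The property \<open>P\<close> of the weights is carried along the stems; it is used to remember that a weight points into
  \<open>L\<close>.
\<close>

lemma test_function_along_stems:
  assumes "Digraph_Component.connected G" "L \<noteq> {}" "s \<notin> L"
    and base: "\<And>q e. q \<in> L \<Longrightarrow> incident e q \<Longrightarrow> other_end e q \<notin> L \<Longrightarrow>
       \<exists>U. test_function q U \<and> slack q U e \<and> P (\<lambda>r. weight q U r)"
    and step: "\<And>q s w w'. s \<notin> L \<Longrightarrow> P w \<Longrightarrow> (\<forall>r p. p \<noteq> s \<and> w r p > 0 \<longrightarrow> (\<exists>r'. w' r' p > 0)) \<Longrightarrow> P w'"
  shows "\<exists>U. test_function s U \<and> P (\<lambda>r. weight s U r)"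
proof -
  obtain e where "reached_through L s e"
    using reached_through_all[OF assms(1-3)] by blast
  then have "s \<notin> L \<and> (\<exists>U. test_function s U \<and> P (\<lambda>r. weight s U r)
       \<and> (\<forall>e'. incident e' s \<and> e' \<noteq> e \<longrightarrow> slack s U e'))"
  proof induction
    case (start q e)
    then obtain U where U: "test_function q U" "slack q U e" "P (\<lambda>r. weight q U r)"
      using base by blast
    show ?case
      using stem[OF U(1) start(2) U(2)] step[OF start(3) U(3)] start(3) by blast
  next
    case (extend s e e')
    then obtain U where U: "test_function s U" "P (\<lambda>r. weight s U r)" "slack s U e'" by blast
    show ?case
      using stem[OF U(1) extend(2) U(3)] step[OF extend(4) U(2)] extend(4) by blast
  qed
  then show ?thesis by blast
qed

end

context vertex_quiver begin

section \<open>Signals\<close>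

lemma card_pairs: 
  assumes "finite E" "\<And>e. e \<in> E \<Longrightarrow> finite (S e)"
  shows "(\<Sum>e\<in>E. real (card (S e))) = real (card {(e, k). e \<in> E \<and> k \<in> S e})"
proof -
  have "{(e, k). e \<in> E \<and> k \<in> S e} = Sigma E S" by auto
  then show ?thesis using assms by (simp add: card_SigmaI)
qed

text \<open>
  A signal running along an infinite walk without backtracking is a test function.  In the time-vertex picture
  each position of the signal is justified by its predecessor, and has to be paid for by its
  successor; the two arrows involved are different, so each pair of a position and an arrow at it is
  used at most once.  The unused pairs are the slack.
\<close>

lemma walk_test_function:
  fixes X :: "nat \<Rightarrow> 'v" and A :: "nat \<Rightarrow> 'e"
  assumes inc: "\<And>k. incident (A k) (X k)" and X_Suc: "\<And>k. X (Suc k) = other_end (A k) (X k)"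
    and nb: "\<And>k. A (Suc k) \<noteq> A k"
  shows "\<exists>U. test_function (X 0) U \<and> (\<forall>e. incident e (X 0) \<and> e \<noteq> A 0 \<longrightarrow> slack (X 0) U e)"
proof -
  define \<tau> where "\<tau> k = (\<Sum>i<k. if tail G (A i) = X i then 0 else 1 :: nat)" for k
  have \<tau>_0: "\<tau> 0 = 0" and \<tau>_Suc: "\<tau> (Suc k) = \<tau> k + (if tail G (A k) = X k then 0 else 1)" for k
    by (simp_all add: \<tau>_def)
  have arc: "A k \<in> arcs G" for k using inc by (simp add: incident_def)
  have fwd: "X (Suc k) = head G (A k) \<and> \<tau> (Suc k) = \<tau> k" if "tail G (A k) = X k" for k
    using that by (simp add: X_Suc other_end_def \<tau>_Suc)
  have bwd: "X k = head G (A k) \<and> X (Suc k) = tail G (A k) \<and> \<tau> (Suc k) = Suc (\<tau> k)"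
    if "tail G (A k) \<noteq> X k" for k
    using that inc[of k] by (simp add: X_Suc other_end_def \<tau>_Suc incident_def)
  define N where "N = CARD('v)"
  have depth: "depth i \<le> N" for i
    unfolding depth_def N_def by (rule card_mono) auto
  \<comment> \<open>Steps along arrows do not take time, but by acyclicity there are at most \<open>N\<close> of them in a row.\<close>
  have k_le: "k + depth (X k) \<le> N + (N + 1) * \<tau> k" for k
  proof (induction k)
    case (Suc k)
    show ?case
    proof (cases "tail G (A k) = X k")
      case True
      then show ?thesis
        using fwd[OF True] depth_decreases[OF arc[of k]] Suc by simp
    next
      case False
      then show ?thesis
        using bwd[OF False] depth[of "X (Suc k)"] Suc by simp
    qed
  qed (use depth \<tau>_0 in simp)
  define P where "P t j = {k. X k = j \<and> \<tau> k = t}" for t j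
  define P' where "P' t j = {k. X k = j \<and> Suc (\<tau> k) = t}" for t j
  have P_sub: "P t j \<subseteq> {..N + (N + 1) * t}" for t j
  proof
    fix k assume "k \<in> P t j"
    then show "k \<in> {..N + (N + 1) * t}" using k_le[of k] by (simp add: P_def)
  qed
  then have fin: "finite (P t j)" for t j
    using finite_subset by blast
  have P'_0: "P' 0 j = {}" and P'_Suc: "P' (Suc t) j = P t j" for t j
    by (auto simp: P_def P'_def)
  have fin': "finite (P' t j)" for t j
    using fin by (cases t) (auto simp: P'_0 P'_Suc)
  define U where "U t j = real (card (P t j))" for t j
  \<comment> \<open>Pairs of an arrow at \<open>j\<close> and a position of the signal at its other end that contributes at \<open>(t, j)\<close>.\<close>
  define R where "R t j = {(e, k). e \<in> in_arcs G j \<and> k \<in> P t (tail G e)} \<union>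
      {(e, k). e \<in> out_arcs G j \<and> k \<in> P' t (head G e)}" for t j
  have fin1: "finite {(e, k). e \<in> in_arcs G j \<and> k \<in> P t (tail G e)}" for t j
    by (rule finite_subset[of _ "Sigma (in_arcs G j) (\<lambda>e. P t (tail G e))"]) (auto simp: fin in_arcs_def)
  have fin2: "finite {(e, k). e \<in> out_arcs G j \<and> k \<in> P' t (head G e)}" for t j
    by (rule finite_subset[of _ "Sigma (out_arcs G j) (\<lambda>e. P' t (head G e))"]) (auto simp: fin' out_arcs_def)
  have finR: "finite (R t j)" for t j using fin1 fin2 by (simp add: R_def)
  have cardR: "real (card (R t j)) = inn (U t) j + (\<Sum>e\<in>out_arcs G j. real (card (P' t (head G e))))" for t j
  proof -
    have "{(e, k). e \<in> in_arcs G j \<and> k \<in> P t (tail G e)} \<inter>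
      {(e, k). e \<in> out_arcs G j \<and> k \<in> P' t (head G e)} = {}"
      using no_loop by auto
    then have "real (card (R t j)) = real (card {(e, k). e \<in> in_arcs G j \<and> k \<in> P t (tail G e)})
        + real (card {(e, k). e \<in> out_arcs G j \<and> k \<in> P' t (head G e)})"
      unfolding R_def using fin1 fin2 by (simp add: card_Un_disjoint)
    moreover have "(\<Sum>e\<in>in_arcs G j. real (card (P t (tail G e)))) = real (card {(e, k). e \<in> in_arcs G j \<and> k \<in> P t (tail G e)})"
      by (rule card_pairs) (auto simp: fin)
    moreover have "(\<Sum>e\<in>out_arcs G j. real (card (P' t (head G e)))) = real (card {(e, k). e \<in> out_arcs G j \<and> k \<in> P' t (head G e)})"
      by (rule card_pairs) (auto simp: fin')
    ultimately show ?thesis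
      unfolding inn_def U_def by linarith
  qed
  have wt: "weight (X 0) U t j = (if t = 0 \<and> j = X 0 then 1 else 0) + real (card (R t j))
      - real (card (P t j)) - real (card (P' t j))" for t j
    unfolding cardR by (cases t) (simp_all add: weight_def defect_def U_def out_def P'_0 P'_Suc)
  define F1 where "F1 t j = (\<lambda>k. (A k, k)) ` {k. Suc k \<in> P t j}" for t j
  define F2 where "F2 t j = (\<lambda>k. (A k, Suc k)) ` P' t j" for t j
  have F1: "card (P t j) = (if t = 0 \<and> j = X 0 then 1 else 0) + card (F1 t j)" for t j
  proof -
    have "P t j = (if t = 0 \<and> j = X 0 then {0} else {}) \<union> Suc ` {k. Suc k \<in> P t j}"
    proof (rule set_eqI)
      fix k show "k \<in> P t j \<longleftrightarrow> k \<in> (if t = 0 \<and> j = X 0 then {0} else {}) \<union> Suc ` {k. Suc k \<in> P t j}"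
        by (cases k) (auto simp: P_def \<tau>_0)
    qed
    moreover have "finite (Suc ` {k. Suc k \<in> P t j})"
      by (rule finite_subset[OF _ fin[of t j]]) auto
    ultimately have "card (P t j) = card (if t = 0 \<and> j = X 0 then {0::nat} else {}) + card (Suc ` {k. Suc k \<in> P t j})"
      using card_Un_disjoint[of "if t = 0 \<and> j = X 0 then {0::nat} else {}" "Suc ` {k. Suc k \<in> P t j}"]
      by (simp split: if_splits)
    moreover have "card (Suc ` {k. Suc k \<in> P t j}) = card {k. Suc k \<in> P t j}"
      by (simp add: card_image)
    moreover have "card (F1 t j) = card {k. Suc k \<in> P t j}"
      unfolding F1_def by (simp add: card_image inj_on_def)
    ultimately show ?thesis by simp
  qed
  have F2: "card (F2 t j) = card (P' t j)" for t j
    unfolding F2_def by (simp add: card_image inj_on_def)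
  have sub: "F1 t j \<union> F2 t j \<subseteq> R t j" for t j
  proof -
    have "(A k, k) \<in> R t j" if "Suc k \<in> P t j" for k
      using that fwd[of k] bwd[of k] arc[of k]
      by (cases "tail G (A k) = X k") (auto simp: R_def P_def P'_def)
    moreover have "(A k, Suc k) \<in> R t j" if "k \<in> P' t j" for k
      using that fwd[of k] bwd[of k] arc[of k]
      by (cases "tail G (A k) = X k") (auto simp: R_def P_def P'_def)
    ultimately show ?thesis by (auto simp: F1_def F2_def)
  qed
  have disj: "F1 t j \<inter> F2 t j = {}" for t j
    using nb by (auto simp: F1_def F2_def)
  have finF: "finite (F1 t j)" "finite (F2 t j)" for t j
    using sub[of t j] finR[of t j] finite_subset by blast+
  have wt': "weight (X 0) U t j = real (card (R t j)) - real (card (F1 t j \<union> F2 t j))" for t j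
    unfolding wt F1[of t j] F2[of t j, symmetric] by (simp add: card_Un_disjoint finF disj)
  have "0 \<le> weight (X 0) U t j" for t j
    unfolding wt' using card_mono[OF finR sub] by simp
  moreover have "U 0 (X 0) \<ge> 1"
    unfolding U_def F1[of 0 "X 0"] by simp
  moreover have "F1 0 (X 0) = {}"
  proof -
    have "depth (X (Suc k)) < depth (X 0)" if "\<tau> (Suc k) = 0" for k
      using that
    proof (induction k)
      case 0
      have "tail G (A 0) = X 0" using 0 \<tau>_Suc[of 0] by (auto split: if_splits)
      then show ?case using fwd[of 0] depth_decreases[OF arc[of 0]] by simp
    next
      case (Suc k)
      have "tail G (A (Suc k)) = X (Suc k)" "\<tau> (Suc k) = 0"
        using Suc.prems \<tau>_Suc[of "Suc k"] by (auto split: if_splits)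
      then show ?case
        using fwd[of "Suc k"] depth_decreases[OF arc[of "Suc k"]] Suc.IH by simp
    qed
    then show ?thesis unfolding F1_def P_def by force
  qed
  then have "U 0 (X 0) = 1" unfolding U_def F1[of 0 "X 0"] by simp
  moreover have "U t j \<le> real (N + 1) * real (Suc t)" for t j
  proof -
    have "card (P t j) \<le> N + (N + 1) * t + 1"
      using card_mono[OF _ P_sub[of t j]] by simp
    also have "\<dots> = (N + 1) * Suc t" by simp
    finally show ?thesis unfolding U_def of_nat_mult[symmetric] of_nat_le_iff .
  qed
  ultimately have "test_function (X 0) U"
    unfolding test_function_def by (auto simp: U_def)
  moreover have "slack (X 0) U e" if e: "incident e (X 0)" "e \<noteq> A 0" for e
  proof -
    define t j where "t = (if tail G e = X 0 then 0 else 1 :: nat)" and "j = other_end e (X 0)"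
    have "(e, 0) \<in> R t j"
      using e by (auto simp: R_def t_def j_def P_def P'_def \<tau>_0 other_end_def incident_def)
    moreover have "(e, 0) \<notin> F1 t j \<union> F2 t j"
      using e(2) by (auto simp: F1_def F2_def)
    ultimately have "F1 t j \<union> F2 t j \<subset> R t j" using sub by blast
    then have "card (F1 t j \<union> F2 t j) < card (R t j)"
      using finR psubset_card_mono by blast
    then show ?thesis
      by (simp add: slack_def wt' t_def[symmetric] j_def[symmetric])
  qed
  ultimately show ?thesis by blast
qed

text \<open>
  If all closed walks use as many arrows forwards as backwards, time can be replaced by the number \<open>k\<close> of steps:
  the point \<open>(t, j)\<close> is reached after \<open>2 t + H j - H q\<close> steps, whatever the route.  In terms of steps the
  adjoint equation no longer sees the orientation of the arrows.
\<close>

lemma wave_test_function: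
  fixes H :: "'v \<Rightarrow> int" and w :: "int \<Rightarrow> 'v \<Rightarrow> real"
  assumes H: "\<And>e. e \<in> arcs G \<Longrightarrow> H (head G e) = H (tail G e) + 1"
    and nonneg: "\<And>k j. 0 \<le> w k j" and neg: "\<And>k j. k < 0 \<Longrightarrow> w k j = 0"
    and init: "w 0 = indic q" and bound: "\<And>k j. w k j \<le> K"
    and sub: "\<And>k j. k \<ge> 0 \<Longrightarrow> w (k + 1) j + w (k - 1) j \<le> inn (w k) j + out (w k) j"
  shows "\<exists>U. test_function q U \<and> (\<forall>e. incident e q \<and> w 1 (other_end e q) = 0 \<longrightarrow> slack q U e)"
proof -
  \<comment> \<open>In \<open>k\<close> steps \<open>H\<close> changes by at most \<open>k\<close>; so the wave never appears at negative times \<open>t\<close>.\<close>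
  have causal_nat: "H j - H q \<le> int k" if "w (int k) j \<noteq> 0" for k j
    using that
  proof (induction k arbitrary: j)
    case 0
    then show ?case using init by (auto simp: indic_def split: if_splits)
  next
    case (Suc k)
    have "w (int k + 1) j > 0" using Suc.prems nonneg[of "int k + 1" j] by (simp add: add.commute)
    then have "inn (w (int k)) j > 0 \<or> out (w (int k)) j > 0"
      using sub[of "int k" j] nonneg[of "int k - 1" j] by simp linarith
    then obtain e where e: "e \<in> arcs G" "head G e = j \<and> w (int k) (tail G e) > 0 \<or>
        tail G e = j \<and> w (int k) (head G e) > 0"
      using inn_pos_witness out_pos_witness by metis
    from e(2) show ?case
    proof
      assume a: "head G e = j \<and> w (int k) (tail G e) > 0"
      then show ?thesis using Suc.IH[of "tail G e"] H[OF e(1)] by simp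
    next
      assume a: "tail G e = j \<and> w (int k) (head G e) > 0"
      then show ?thesis using Suc.IH[of "head G e"] H[OF e(1)] by simp
    qed
  qed
  have causal: "w k j = 0" if "k < H j - H q" for k j
  proof (cases "k < 0")
    case False
    then show ?thesis using causal_nat[of "nat k" j] that by force
  qed (rule neg)
  define U where "U t j = w (2 * int t + (H j - H q)) j" for t j
  have in_U: "inn (U t) j = inn (w (2 * int t + (H j - H q) - 1)) j" for t j
    unfolding inn_def U_def using H by (intro sum.cong) (auto simp: algebra_simps)
  have out_U: "out (U t) j = out (w (2 * int t + (H j - H q) + 1)) j" for t j
    unfolding out_def U_def using H by (intro sum.cong) (auto simp: algebra_simps)
  have iv: "0 \<le> inn (w k) j" "0 \<le> out (w k) j" for k j
    by (simp_all add: inn_nonneg out_nonneg nonneg)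
  have w0: "weight q U 0 j = indic q j - w (H j - H q) j + inn (w (H j - H q - 1)) j" for j
    unfolding weight_0 in_U by (simp add: U_def indic_def)
  have w1: "weight q U (Suc t) j = inn (w (k - 1)) j + out (w (k - 1)) j - w k j - w (k - 2) j"
    if "k = 2 * int (Suc t) + (H j - H q)" for t j k
    unfolding weight_Suc in_U out_U by (simp add: that U_def algebra_simps)
  have "0 \<le> weight q U t j" for t j
  proof (cases t)
    case 0
    define h where "h = H j - H q"
    have o: "out (w (h - 1)) j = 0"
      unfolding out_def using H by (intro sum.neutral) (auto intro!: causal simp: h_def)
    consider "h < 0" | "h = 0" | "h > 0" by linarith
    then show ?thesis
    proof cases
      case 1
      then show ?thesis using neg[OF 1] iv indic_nonneg by (simp add: 0 w0 h_def[symmetric])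
    next
      case 2
      then show ?thesis using iv init by (simp add: 0 w0 h_def[symmetric])
    next
      case 3
      then show ?thesis
        using sub[of "h - 1" j] o nonneg[of "h - 2" j] indic_nonneg[of q j]
        by (simp add: 0 w0 h_def[symmetric])
    qed
  next
    case (Suc t')
    define k where "k = 2 * int (Suc t') + (H j - H q)"
    consider "k < 0" | "k = 0" | "k > 0" by linarith
    then show ?thesis
    proof cases
      case 1
      then show ?thesis using iv neg[of k j] neg[of "k - 2" j] by (simp add: Suc w1[OF k_def])
    next
      case 2
      then have "w k j = 0" using init by (auto simp: indic_def k_def)
      then show ?thesis using iv neg[of "k - 2" j] 2 by (simp add: Suc w1[OF k_def])
    next
      case 3
      then show ?thesis using sub[of "k - 1" j] by (simp add: Suc w1[OF k_def])
    qed
  qed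
  moreover have "U 0 q = 1" by (simp add: U_def init indic_def)
  moreover have "U t j \<le> max K 0 * real (Suc t)" for t j
  proof -
    have "U t j \<le> max K 0 * 1" using bound[of "2 * int t + (H j - H q)" j] by (simp add: U_def)
    also have "\<dots> \<le> max K 0 * real (Suc t)" by (intro mult_left_mono) auto
    finally show ?thesis .
  qed
  ultimately have "test_function q U"
    unfolding test_function_def by (auto simp: U_def nonneg)
  moreover have "slack q U e" if e: "incident e q" "w 1 (other_end e q) = 0" for e
  proof (cases "tail G e = q")
    case True
    have "e \<in> arcs G" using e by (simp add: incident_def)
    then show ?thesis
      using True e(2) inn_indic_ge_1[of e] H[of e] indic_nonneg[of q "head G e"]
      by (simp add: slack_def w0 other_end_def init)
  next
    case False
    have a: "e \<in> arcs G" "head G e = q" using e False by (auto simp: incident_def)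
    have "1 = 2 * int (Suc 0) + (H (tail G e) - H q)" using H[OF a(1)] a by simp
    from w1[OF this] show ?thesis
      using False e(2) out_indic_ge_1[OF a(1)] a neg[of "-1" "tail G e"] iv[of 0 "tail G e"]
      by (simp add: slack_def other_end_def init)
  qed
  ultimately show ?thesis by blast
qed

end

context vertex_quiver begin

section \<open>Positivity and growth\<close>

lemma nonneg_if_gap_nonneg:
  assumes tests: "\<And>s. \<exists>U. test_function s U \<and> (\<forall>j. weight s U 0 j = 0)"
    and gap: "\<And>t i. 0 \<le> gap x t i"
  shows "0 \<le> x t s"
proof (induction t arbitrary: s rule: less_induct)
  case (less t)
  obtain U where U: "test_function s U" "\<And>j. weight s U 0 j = 0"
    using tests by blast
  have "0 \<le> weight s U r j * x (t - r) j" if "r \<le> t" for r j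
    using U less[of "t - r" j] that by (cases "r = 0") (auto simp: test_function_def)
  then have "0 \<le> (\<Sum>r\<le>t. \<Sum>j\<in>UNIV. weight s U r j * x (t - r) j)"
    by (intro sum_nonneg) auto
  moreover have "0 \<le> (\<Sum>r\<le>t. \<Sum>j\<in>UNIV. U r j * gap x (t - r) j)"
    using U(1) gap by (intro sum_nonneg mult_nonneg_nonneg) (auto simp: test_function_def)
  ultimately show ?case by (simp add: test_identity[of x t s U])
qed

lemma summable_Suc_powers:
  fixes \<rho> :: real
  assumes "\<rho> > 1"
  shows "summable (\<lambda>r. real (Suc r) * (1 / \<rho>) ^ r)" "summable (\<lambda>r. (real (Suc r))\<^sup>2 * (1 / \<rho>) ^ r)"
    "(\<lambda>r. real (Suc r) * (1 / \<rho>) ^ r) \<longlonglongrightarrow> 0"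
proof -
  have lt: "norm (1 / \<rho>) < 1" using assms by simp
  have d0: "summable (\<lambda>n. 1 * x ^ n)" if "norm x < 1" for x :: real
    using that by (simp add: summable_geometric)
  have d1: "summable (\<lambda>n. diffs (\<lambda>_. 1) n * x ^ n)" if "norm x < 1" for x :: real
    by (rule termdiff_converges[OF that d0])
  have d2: "summable (\<lambda>n. diffs (diffs (\<lambda>_. 1)) n * (1 / \<rho>) ^ n)"
    by (rule termdiff_converges[OF lt d1])
  show *: "summable (\<lambda>r. (real (Suc r))\<^sup>2 * (1 / \<rho>) ^ r)"
  proof (rule summable_comparison_test'[OF d2])
    fix r :: nat
    have "(real (Suc r))\<^sup>2 \<le> diffs (diffs (\<lambda>_. 1)) r"
      by (simp add: diffs_def power2_eq_square)
    then show "norm ((real (Suc r))\<^sup>2 * (1 / \<rho>) ^ r) \<le> diffs (diffs (\<lambda>_. 1)) r * (1 / \<rho>) ^ r"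
      using assms by (simp add: abs_mult mult_right_mono del: of_nat_Suc)
  qed
  show "summable (\<lambda>r. real (Suc r) * (1 / \<rho>) ^ r)"
  proof (rule summable_comparison_test'[OF *])
    fix r :: nat
    have "real (Suc r) \<le> (real (Suc r))\<^sup>2" by (rule self_le_power) auto
    then show "norm (real (Suc r) * (1 / \<rho>) ^ r) \<le> (real (Suc r))\<^sup>2 * (1 / \<rho>) ^ r"
      using assms by (simp add: abs_mult mult_right_mono del: of_nat_Suc)
  qed
  then show "(\<lambda>r. real (Suc r) * (1 / \<rho>) ^ r) \<longlonglongrightarrow> 0"
    by (rule summable_LIMSEQ_zero)
qed

end

text \<open>
  The equation for \<open>v\<close> says that \<open>\<rho>\<^sup>t v\<close> has vanishing gap at all positive times.
\<close>

locale growth_quiver = vertex_quiver +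
  fixes \<rho> :: real and v :: "'a \<Rightarrow> real"
  assumes \<rho>_gt_1: "\<rho> > 1" and v_pos: "v i > 0"
    and eigen: "(1 + \<rho>) * v i = inn v i + \<rho> * out v i"
begin

lemma gap_eigen: "gap (\<lambda>t i. \<rho> ^ t * v i) (Suc t) i = 0"
proof -
  have "gap (\<lambda>t i. \<rho> ^ t * v i) (Suc t) i = \<rho> ^ t * ((1 + \<rho>) * v i - inn v i - \<rho> * out v i)"
    unfolding gap_Suc inn_scale out_scale by (simp add: algebra_simps)
  then show ?thesis by (simp add: eigen)
qed

lemma test_tail_to_0:
  assumes U: "test_function s U" and b: "\<And>T j. \<bar>b T j\<bar> \<le> B"
  shows "(\<lambda>T. (\<Sum>j\<in>UNIV. U T j * b T j) / \<rho> ^ T) \<longlonglongrightarrow> 0"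
proof -
  obtain K where K: "U r j \<le> K * real (Suc r)" for r j
    using U by (auto simp: test_function_def)
  have U0: "0 \<le> U r j" for r j using U by (auto simp: test_function_def)
  have B0: "0 \<le> B" using b[of 0 undefined] by linarith
  have "\<bar>(\<Sum>j\<in>UNIV. U T j * b T j) / \<rho> ^ T\<bar> \<le> (real CARD('a) * K * B) * (real (Suc T) * (1 / \<rho>) ^ T)" for T
  proof -
    have "\<bar>\<Sum>j\<in>UNIV. U T j * b T j\<bar> \<le> (\<Sum>j\<in>UNIV. \<bar>U T j * b T j\<bar>)"
      by (rule sum_abs)
    also have "\<dots> \<le> (\<Sum>j\<in>(UNIV :: 'a set). K * real (Suc T) * B)"
    proof (rule sum_mono)
      fix j
      have "0 \<le> K * real (Suc T)" using K[of T j] U0[of T j] by linarith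
      then show "\<bar>U T j * b T j\<bar> \<le> K * real (Suc T) * B"
        unfolding abs_mult using K[of T j] U0[of T j] b[of T j] by (intro mult_mono) auto
    qed
    also have "\<dots> = real CARD('a) * K * B * real (Suc T)"
      by (simp only: sum_constant mult.assoc mult.left_commute mult.commute)
    finally have "\<bar>\<Sum>j\<in>UNIV. U T j * b T j\<bar> / \<rho> ^ T \<le> real CARD('a) * K * B * real (Suc T) / \<rho> ^ T"
      using \<rho>_gt_1 by (intro divide_right_mono) auto
    then show ?thesis
      using \<rho>_gt_1 by (simp add: abs_divide power_divide del: of_nat_Suc)
  qed
  then have "\<forall>\<^sub>F T in sequentially. norm ((\<Sum>j\<in>UNIV. U T j * b T j) / \<rho> ^ T)
      \<le> (real CARD('a) * K * B) * (real (Suc T) * (1 / \<rho>) ^ T)"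
    by (intro always_eventually allI) (simp only: real_norm_def)
  moreover have "(\<lambda>T. (real CARD('a) * K * B) * (real (Suc T) * (1 / \<rho>) ^ T)) \<longlonglongrightarrow> 0"
    by (rule tendsto_mult_right_zero) (rule summable_Suc_powers(3)[OF \<rho>_gt_1])
  ultimately show ?thesis by (rule Lim_null_comparison)
qed

text \<open>
  The partial sums are those of the renewal equation for \<open>\<rho>\<^sup>t v\<close>; they increase, and converge to \<open>v s\<close> since test
  functions grow more slowly than \<open>\<rho>\<^sup>t\<close>.
\<close>

lemma weighted_eigen_le:
  assumes U: "test_function s U"
  shows "(\<Sum>r\<le>T. \<Sum>j\<in>UNIV. weight s U r j * (v j / \<rho> ^ r)) \<le> v s"
proof -
  define S where "S T = (\<Sum>r\<le>T. \<Sum>j\<in>UNIV. weight s U r j * (v j / \<rho> ^ r))" for T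
  have "S T = v s - (\<Sum>j\<in>UNIV. U T j * (v j - out v j)) / \<rho> ^ T" for T
  proof -
    have g: "gap (\<lambda>t i. \<rho> ^ t * v i) q j = (if q = 0 then v j - out v j else 0)" for q j
      by (cases q) (simp_all add: gap_eigen gap_0 out_scale)
    have "\<rho> ^ T * v s = (\<Sum>r\<le>T. \<Sum>j\<in>UNIV. weight s U r j * (\<rho> ^ (T - r) * v j))
         + (\<Sum>r\<le>T. \<Sum>j\<in>UNIV. U r j * gap (\<lambda>t i. \<rho> ^ t * v i) (T - r) j)"
      by (rule test_identity)
    also have "(\<Sum>r\<le>T. \<Sum>j\<in>UNIV. U r j * gap (\<lambda>t i. \<rho> ^ t * v i) (T - r) j)
        = (\<Sum>r\<le>T. if r = T then \<Sum>j\<in>UNIV. U T j * (v j - out v j) else 0)"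
      by (rule sum.cong) (auto simp: g)
    also have "(\<Sum>r\<le>T. \<Sum>j\<in>UNIV. weight s U r j * (\<rho> ^ (T - r) * v j)) = \<rho> ^ T * S T"
      unfolding S_def sum_distrib_left
      using \<rho>_gt_1 by (intro sum.cong refl) (simp add: power_diff)
    finally show ?thesis using \<rho>_gt_1 by (simp add: field_simps)
  qed
  then have "S = (\<lambda>T. v s - (\<Sum>j\<in>UNIV. U T j * (v j - out v j)) / \<rho> ^ T)" by blast
  moreover have "\<exists>B. \<forall>j. \<bar>v j - out v j\<bar> \<le> B"
    using finite_UNIV by (intro exI[of _ "\<Sum>j\<in>UNIV. \<bar>v j - out v j\<bar>"] allI member_le_sum) auto
  then obtain B where "\<bar>v j - out v j\<bar> \<le> B" for j by blast
  ultimately have "S \<longlonglongrightarrow> v s - 0"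
    using tendsto_diff[OF tendsto_const test_tail_to_0[OF U, of "\<lambda>_ j. v j - out v j" B]] by auto
  moreover have "incseq S"
  proof (rule incseq_SucI)
    fix T
    have "0 \<le> (\<Sum>j\<in>UNIV. weight s U (Suc T) j * (v j / \<rho> ^ Suc T))"
      using U \<rho>_gt_1 v_pos
      by (intro sum_nonneg mult_nonneg_nonneg divide_nonneg_nonneg) (auto simp: test_function_def less_imp_le)
    then show "S T \<le> S (Suc T)" by (simp add: S_def)
  qed
  ultimately show ?thesis using incseq_le[of S "v s" T] by (simp add: S_def)
qed

text \<open>
  By induction on \<open>t\<close> the renewal equation reproduces a bound \<open>b(t-1) \<rho>\<^sup>t v\<close>, because the weights applied to \<open>\<rho>\<^sup>t v\<close>
  sum to at most \<open>\<rho>\<^sup>t v\<close>; the sources add \<open>O((t+1)\<^sup>2)\<close>, and \<open>(t+1)\<^sup>2 / \<rho>\<^sup>t\<close> is summable.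
\<close>

lemma growth_bound:
  assumes tests: "\<And>s. \<exists>U. test_function s U \<and> (\<forall>j. weight s U 0 j = 0)"
  shows "\<exists>C\<ge>0. \<forall>x g. (\<forall>t i. \<bar>gap x t i\<bar> \<le> g) \<longrightarrow> (\<forall>t i. \<bar>x t i\<bar> \<le> C * g * \<rho> ^ t)"
proof -
  obtain W where W: "test_function s (W s)" "weight s (W s) 0 j = 0" for s j
    using tests by metis
  obtain K' where K': "W s r j \<le> K' s * real (Suc r)" for s r j
    using W(1) unfolding test_function_def by metis
  define K where "K = (\<Sum>s\<in>UNIV. \<bar>K' s\<bar>)"
  have K: "W s r j \<le> K * real (Suc r)" for s r j
  proof -
    have "K' s \<le> \<bar>K' s\<bar>" by simp
    also have "\<dots> \<le> K" unfolding K_def by (rule member_le_sum) auto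
    finally show ?thesis using K'[of s r j] by (meson mult_right_mono of_nat_0_le_iff order_trans)
  qed
  have K0: "0 \<le> K" by (simp add: K_def sum_nonneg)
  define m where "m = Min (range v)"
  have m: "0 < m" and m_le: "m \<le> v s" for s
    using v_pos by (auto simp: m_def)
  define c where "c = real CARD('a) * K / m"
  have c0: "0 \<le> c" using K0 m by (simp add: c_def)
  define b where "b t = c * (\<Sum>r\<le>t. (real (Suc r))\<^sup>2 * (1 / \<rho>) ^ r)" for t
  have b_mono: "b t \<le> b t'" if "t \<le> t'" for t t'
    unfolding b_def using that \<rho>_gt_1 c0
    by (intro mult_left_mono sum_mono2) auto
  have b0: "0 \<le> b t" for t
    unfolding b_def using c0 \<rho>_gt_1 by (intro mult_nonneg_nonneg sum_nonneg) auto
  have main: "\<bar>x t s\<bar> \<le> g * b t * (\<rho> ^ t * v s)" if gx: "\<And>t i. \<bar>gap x t i\<bar> \<le> g" for x g t s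
  proof (induction t arbitrary: s rule: less_induct)
    case (less t)
    have g0: "0 \<le> g" using gx[of 0 undefined] by linarith
    define b' where "b' = (if t = 0 then 0 else b (t - 1))"
    have b': "0 \<le> b'" using b0 by (simp add: b'_def)
    have bt: "b t = b' + c * ((real (Suc t))\<^sup>2 * (1 / \<rho>) ^ t)"
      by (cases t) (simp_all add: b_def b'_def distrib_left)
    have U0: "0 \<le> W s r j" "0 \<le> weight s (W s) r j" for r j
      using W(1)[of s] by (auto simp: test_function_def)
    have "\<bar>\<Sum>r\<le>t. \<Sum>j\<in>UNIV. weight s (W s) r j * x (t - r) j\<bar>
        \<le> (\<Sum>r\<le>t. \<Sum>j\<in>UNIV. g * b' * \<rho> ^ t * (weight s (W s) r j * (v j / \<rho> ^ r)))"
    proof (rule order_trans[OF sum_abs], rule sum_mono, rule order_trans[OF sum_abs], rule sum_mono)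
      fix r j assume "r \<in> {..t}"
      then have r: "r \<le> t" by simp
      show "\<bar>weight s (W s) r j * x (t - r) j\<bar> \<le> g * b' * \<rho> ^ t * (weight s (W s) r j * (v j / \<rho> ^ r))"
      proof (cases "r = 0")
        case False
        have "\<bar>x (t - r) j\<bar> \<le> g * b (t - r) * (\<rho> ^ (t - r) * v j)"
          using less[of "t - r" j] r False by simp
        also have "\<dots> \<le> g * b' * (\<rho> ^ (t - r) * v j)"
          using g0 b_mono[of "t - r" "t - 1"] r False \<rho>_gt_1 v_pos[of j]
          by (intro mult_right_mono mult_left_mono) (auto simp: b'_def)
        also have "\<dots> = g * b' * \<rho> ^ t * (v j / \<rho> ^ r)"
          using r \<rho>_gt_1 by (simp add: power_diff)
        finally have "weight s (W s) r j * \<bar>x (t - r) j\<bar> \<le> weight s (W s) r j * (g * b' * \<rho> ^ t * (v j / \<rho> ^ r))"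
          using U0 by (intro mult_left_mono)
        then show ?thesis using U0 by (simp add: abs_mult algebra_simps)
      qed (simp add: W)
    qed
    also have "\<dots> = g * b' * \<rho> ^ t * (\<Sum>r\<le>t. \<Sum>j\<in>UNIV. weight s (W s) r j * (v j / \<rho> ^ r))"
      by (simp add: sum_distrib_left)
    also have "\<dots> \<le> g * b' * \<rho> ^ t * v s"
      using weighted_eigen_le[OF W(1)[of s]] g0 b' \<rho>_gt_1 by (intro mult_left_mono) auto
    finally have 1: "\<bar>\<Sum>r\<le>t. \<Sum>j\<in>UNIV. weight s (W s) r j * x (t - r) j\<bar> \<le> g * b' * \<rho> ^ t * v s" .
    have "\<bar>\<Sum>r\<le>t. \<Sum>j\<in>UNIV. W s r j * gap x (t - r) j\<bar> \<le> (\<Sum>r\<le>t. \<Sum>j\<in>(UNIV :: 'a set). K * real (Suc t) * g)"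
    proof (rule order_trans[OF sum_abs], rule sum_mono, rule order_trans[OF sum_abs], rule sum_mono)
      fix r j assume "r \<in> {..t}"
      have "W s r j \<le> K * real (Suc r)" by (rule K)
      also have "\<dots> \<le> K * real (Suc t)" using \<open>r \<in> {..t}\<close> K0 by (intro mult_left_mono) auto
      finally show "\<bar>W s r j * gap x (t - r) j\<bar> \<le> K * real (Suc t) * g"
        unfolding abs_mult using U0(1)[of r j] K0 gx by (intro mult_mono) auto
    qed
    also have "\<dots> = g * (m * (c * (real (Suc t))\<^sup>2))"
      using m by (simp add: c_def power2_eq_square)
    also have "\<dots> \<le> g * (v s * (c * (real (Suc t))\<^sup>2))"
      using m_le c0 g0 by (intro mult_left_mono mult_right_mono) auto
    finally have 2: "\<bar>\<Sum>r\<le>t. \<Sum>j\<in>UNIV. W s r j * gap x (t - r) j\<bar> \<le> g * (v s * (c * (real (Suc t))\<^sup>2))" .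
    have "\<bar>x t s\<bar> \<le> g * b' * \<rho> ^ t * v s + g * (v s * (c * (real (Suc t))\<^sup>2))"
      using 1 2 by (simp add: test_identity[of x t s "W s"])
    also have "\<dots> = g * b t * (\<rho> ^ t * v s)"
      unfolding bt using \<rho>_gt_1 by (simp add: field_simps power_divide)
    finally show ?case .
  qed
  define C where "C = c * (\<Sum>r. (real (Suc r))\<^sup>2 * (1 / \<rho>) ^ r) * Max (range v)"
  have bC: "b t \<le> c * (\<Sum>r. (real (Suc r))\<^sup>2 * (1 / \<rho>) ^ r)" for t
    unfolding b_def using \<rho>_gt_1 c0
    by (intro mult_left_mono sum_le_suminf[OF summable_Suc_powers(2)]) auto
  have M: "v s \<le> Max (range v)" for s
    by simp
  have M0: "0 \<le> Max (range v)"
    using M v_pos by (meson less_imp_le order_trans)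
  have "\<bar>x t s\<bar> \<le> C * g * \<rho> ^ t" if gx: "\<And>t i. \<bar>gap x t i\<bar> \<le> g" for x g t s
  proof -
    have g0: "0 \<le> g" using gx[of 0 undefined] by linarith
    have "b t * v s \<le> C"
      unfolding C_def using bC[of t] M[of s] M0 b0[of t] v_pos[of s] order_trans[OF b0 bC]
      by (intro mult_mono) (auto simp: less_imp_le)
    then have "g * \<rho> ^ t * (b t * v s) \<le> g * \<rho> ^ t * C"
      using g0 \<rho>_gt_1 by (intro mult_left_mono) auto
    with main[OF gx, of t s] show ?thesis by (simp add: algebra_simps)
  qed
  moreover have "0 \<le> C"
    unfolding C_def using M0 order_trans[OF b0 bC] by simp
  ultimately show ?thesis by blast
qed

end

section \<open>Cluster points of almost invariant sequences\<close>

definition cluster_point :: "(nat \<Rightarrow> 'b::metric_space) \<Rightarrow> 'b \<Rightarrow> bool" where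
  "cluster_point X z \<longleftrightarrow> (\<forall>\<epsilon>>0. \<forall>T. \<exists>t\<ge>T. dist (X t) z < \<epsilon>)"

lemma cluster_pointD: "cluster_point X z \<Longrightarrow> \<epsilon> > 0 \<Longrightarrow> \<exists>t\<ge>T. dist (X t) z < \<epsilon>"
  by (simp add: cluster_point_def)

lemma closed_cluster_points: "closed {z. cluster_point X z}"
proof -
  have "cluster_point X z" if "z \<in> closure {z. cluster_point X z}" for z
    unfolding cluster_point_def
  proof (intro allI impI)
    fix \<epsilon> :: real and T :: nat assume e: "0 < \<epsilon>"
    then obtain y where y: "cluster_point X y" "dist y z < \<epsilon> / 2"
      using \<open>z \<in> closure _\<close> unfolding closure_approachable by (metis half_gt_zero mem_Collect_eq)
    obtain t where t: "t \<ge> T" "dist (X t) y < \<epsilon> / 2"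
      using cluster_pointD[OF y(1), of "\<epsilon> / 2"] e by auto
    have "dist (X t) z < \<epsilon>"
      using t(2) y(2) dist_triangle[of "X t" z y] by linarith
    then show "\<exists>t\<ge>T. dist (X t) z < \<epsilon>" using t(1) by blast
  qed
  then show ?thesis unfolding closure_subset_eq[symmetric] by blast
qed

lemma cluster_point_exists:
  fixes X :: "nat \<Rightarrow> 'b::heine_borel"
  assumes "bounded (range X)"
  shows "\<exists>z. cluster_point X z"
proof -
  obtain z r where r: "strict_mono (r :: nat \<Rightarrow> nat)" "(X \<circ> r) \<longlonglongrightarrow> z"
    using bounded_imp_convergent_subsequence[OF assms] by auto
  have "\<exists>t\<ge>T. dist (X t) z < \<epsilon>" if "\<epsilon> > 0" for \<epsilon> T
  proof -
    have "\<exists>N. \<forall>n\<ge>N. dist ((X \<circ> r) n) z < \<epsilon>"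
      using r(2) that unfolding lim_sequentially by blast
    then obtain N where "\<And>n. n \<ge> N \<Longrightarrow> dist (X (r n)) z < \<epsilon>" by auto
    moreover have "r (max N T) \<ge> T"
      using seq_suble[OF r(1), of "max N T"] by simp
    ultimately show ?thesis by (meson max.cobounded1)
  qed
  then show ?thesis unfolding cluster_point_def by blast
qed

lemma cluster_point_norm_le:
  fixes X :: "nat \<Rightarrow> 'b::real_normed_vector"
  assumes "cluster_point X z" "\<And>t. norm (X t) \<le> B"
  shows "norm z \<le> B"
proof (rule field_le_epsilon)
  fix e :: real assume "0 < e"
  then obtain t where "dist (X t) z < e"
    using cluster_pointD[OF assms(1)] by blast
  then show "norm z \<le> B + e"
    using assms(2)[of t] norm_triangle_ineq3[of "X t" z] by (simp add: dist_norm)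
qed

lemma cluster_point_forward:
  fixes X :: "nat \<Rightarrow> 'b::real_normed_vector"
  assumes A: "bounded_linear A" and lim: "(\<lambda>t. X (Suc t) - A (X t)) \<longlonglongrightarrow> 0"
    and z: "cluster_point X z"
  shows "cluster_point X (A z)"
  unfolding cluster_point_def
proof (intro allI impI)
  fix \<epsilon> :: real and T assume e: "\<epsilon> > 0"
  obtain K where K: "K > 0" "\<And>x. norm (A x) \<le> norm x * K"
    using bounded_linear.pos_bounded[OF A] by auto
  obtain N where N: "\<And>t. t \<ge> N \<Longrightarrow> norm (X (Suc t) - A (X t)) < \<epsilon> / 2"
    using LIMSEQ_D[OF lim, of "\<epsilon> / 2"] e by auto
  obtain t where t: "t \<ge> max N T" "dist (X t) z < \<epsilon> / 2 / K"
    using cluster_pointD[OF z, of "\<epsilon> / 2 / K" "max N T"] e K by auto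
  have "norm (A (X t - z)) \<le> norm (X t - z) * K" by (rule K)
  also have "\<dots> < \<epsilon> / 2" using t(2) K(1) by (simp add: dist_norm field_simps)
  finally have "norm (X (Suc t) - A z) < \<epsilon>"
    using N[of t] t(1) norm_triangle_ineq[of "X (Suc t) - A (X t)" "A (X t - z)"]
    by (simp add: linear_diff[OF bounded_linear.linear[OF A]])
  then show "\<exists>t\<ge>T. dist (X t) (A z) < \<epsilon>"
    using t(1) by (intro exI[of _ "Suc t"]) (auto simp: dist_norm)
qed

lemma cluster_point_backward:
  fixes X :: "nat \<Rightarrow> 'b::real_normed_vector"
  assumes A: "bounded_linear A'" "\<And>x. A' (A x) = x" and lim: "(\<lambda>t. X (Suc t) - A (X t)) \<longlonglongrightarrow> 0"
    and z: "cluster_point X z"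
  shows "cluster_point X (A' z)"
  unfolding cluster_point_def
proof (intro allI impI)
  fix \<epsilon> :: real and T assume e: "\<epsilon> > 0"
  obtain K where K: "K > 0" "\<And>x. norm (A' x) \<le> norm x * K"
    using bounded_linear.pos_bounded[OF A(1)] by auto
  obtain N where N: "\<And>t. t \<ge> N \<Longrightarrow> norm (X (Suc t) - A (X t)) < \<epsilon> / 2 / K"
    using LIMSEQ_D[OF lim, of "\<epsilon> / 2 / K"] e K by auto
  obtain t' where t': "t' \<ge> Suc (max N T)" "dist (X t') z < \<epsilon> / 2 / K"
    using cluster_pointD[OF z, of "\<epsilon> / 2 / K" "Suc (max N T)"] e K by auto
  then obtain t where t: "t' = Suc t" "t \<ge> max N T" by (cases t') auto
  have "norm (A (X t) - z) < \<epsilon> / K"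
    using N[of t] t t'(2) norm_triangle_ineq[of "A (X t) - X (Suc t)" "X (Suc t) - z"]
    by (simp add: dist_norm norm_minus_commute)
  have "norm (X t - A' z) = norm (A' (A (X t) - z))"
    by (simp add: linear_diff[OF bounded_linear.linear[OF A(1)]] A(2))
  also have "\<dots> \<le> norm (A (X t) - z) * K" by (rule K)
  also have "\<dots> < \<epsilon>" using \<open>norm (A (X t) - z) < \<epsilon> / K\<close> K(1) by (simp add: field_simps)
  finally show "\<exists>t\<ge>T. dist (X t) (A' z) < \<epsilon>"
    using t(2) by (intro exI[of _ t]) (auto simp: dist_norm)
qed

text \<open>
  Once close to a fixed point of the evolutions \<open>P m\<close>, the sequence stays close, with the same constant for all \<open>m\<close>.
\<close>

lemma tendsto_stable_cluster_point:
  fixes X :: "nat \<Rightarrow> 'b::real_normed_vector"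
  assumes z: "cluster_point X z" and P: "\<And>m x. norm (P m x - z) \<le> K * norm (x - z)"
    and d: "\<And>t m. norm (X (t + m) - P m (X t)) \<le> \<delta> t" "\<delta> \<longlonglongrightarrow> 0"
  shows "X \<longlonglongrightarrow> z"
proof (rule LIMSEQ_I)
  fix \<epsilon> :: real assume e: "0 < \<epsilon>"
  define K' where "K' = max K 1"
  have K': "K' > 0" "K \<le> K'" by (auto simp: K'_def)
  obtain N where N: "\<And>t. t \<ge> N \<Longrightarrow> norm (\<delta> t) < \<epsilon> / 2"
    using LIMSEQ_D[OF d(2), of "\<epsilon> / 2"] e by auto
  obtain t where t: "t \<ge> N" "dist (X t) z < \<epsilon> / 2 / K'"
    using cluster_pointD[OF z, of "\<epsilon> / 2 / K'" N] e K' by auto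
  have "norm (X n - z) < \<epsilon>" if n: "n \<ge> t" for n
  proof -
    obtain m where m: "n = t + m" using le_Suc_ex[OF n] by blast
    have "norm (P m (X t) - z) \<le> K * norm (X t - z)" by (rule P)
    also have "\<dots> \<le> K' * norm (X t - z)"
      using K'(2) by (rule mult_right_mono) simp
    also have "\<dots> < \<epsilon> / 2" using t(2) K'(1) by (simp add: dist_norm field_simps)
    finally show ?thesis
      using d(1)[of t m] N[OF t(1)] norm_triangle_ineq[of "X n - P m (X t)" "P m (X t) - z"]
      by (simp add: m)
  qed
  then show "\<exists>no. \<forall>n\<ge>no. norm (X n - z) < \<epsilon>" by blast
qed

lemma convex_bounded_int_const:
  fixes f :: "int \<Rightarrow> real"
  assumes conv: "\<And>k. 2 * f k \<le> f (k + 1) + f (k - 1)" and bd: "\<And>k. \<bar>f k\<bar> \<le> B"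
  shows "f (k + 1) = f k"
proof -
  have up: "f (k + 1) - f k \<le> f (k + int n + 1) - f (k + int n)" for k n
  proof (induction n)
    case (Suc n)
    then show ?case using conv[of "k + int n + 1"] by (simp add: algebra_simps)
  qed simp
  have far_up: "f k + real n * (f (k + 1) - f k) \<le> f (k + int n)" for k n
  proof (induction n)
    case (Suc n)
    then show ?case using up[of k n] by (simp add: algebra_simps)
  qed simp
  have far_down: "f k - real n * (f (k + 1) - f k) \<le> f (k - int n)" for k n
  proof (induction n)
    case (Suc n)
    have "f (k - int n) - f (k - int n - 1) \<le> f (k + 1) - f k"
      using up[of "k - int n - 1" "Suc n"] by (simp add: algebra_simps)
    with Suc show ?case by (simp add: algebra_simps)
  qed simp
  have bounded_slope: "x = 0" if "\<And>n. real n * x \<le> 2 * B" "\<And>n. - (real n * x) \<le> 2 * B" for x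
  proof (rule ccontr)
    assume "x \<noteq> 0"
    then obtain n where "real n * \<bar>x\<bar> > 2 * B"
      using ex_less_of_nat_mult[of "\<bar>x\<bar>" "2 * B"] by auto
    then show False using that[of n] by (auto simp: abs_if split: if_splits)
  qed
  have "f (k + 1) - f k = 0"
  proof (rule bounded_slope)
    fix n
    show "real n * (f (k + 1) - f k) \<le> 2 * B"
      using far_up[of k n] bd[of k] bd[of "k + int n"] by linarith
    show "- (real n * (f (k + 1) - f k)) \<le> 2 * B"
      using far_down[of k n] bd[of k] bd[of "k - int n"] by linarith
  qed
  then show ?thesis by simp
qed

context growth_quiver begin

section \<open>Rigidity of bounded orbits\<close>

text \<open>
  The strong maximum principle: \<open>Y m\<close> is the state of a nonnegative orbit \<open>m\<close> time steps in the past, divided by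
  the growth factor.  In the renewal equation for a zero at \<open>s\<close> all terms are nonnegative and the boundary term
  tends to 0, so the values that carry positive weight vanish too.
\<close>

lemma zero_propagates:
  assumes Y: "\<And>m j. 0 \<le> Y m j" "\<And>m j. Y m j \<le> B"
    and rec: "\<And>m i. \<rho> * Y m i + Y (Suc m) i = inn (Y (Suc m)) i + \<rho> * out (Y m) i"
    and U: "test_function s U" and zero: "Y m s = 0" and w: "weight s U r p > 0"
  shows "Y (m + r) p = 0"
proof -
  have U0: "0 \<le> U r j" "0 \<le> weight s U r j" for r j
    using U by (auto simp: test_function_def)
  have main: "weight s U r p * (Y (m + r) p / \<rho> ^ r)
      \<le> - ((\<Sum>j\<in>UNIV. U T j * (Y (m + T) j - out (Y (m + T)) j)) / \<rho> ^ T)" if T: "r \<le> T" for T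
  proof -
    define x where "x t j = \<rho> ^ t * Y (m + (T - t)) j" for t j
    have g: "gap x q j = (if q = 0 then Y (m + T) j - out (Y (m + T)) j else 0)" if q: "q \<le> T" for q j
    proof (cases q)
      case 0
      have "x 0 = Y (m + T)" by (simp add: x_def fun_eq_iff)
      then show ?thesis by (simp add: 0 gap_0)
    next
      case (Suc q')
      define n where "n = m + (T - q)"
      have x1: "x q = (\<lambda>j. \<rho> ^ q * Y n j)" by (simp add: x_def n_def fun_eq_iff)
      have x2: "x q' = (\<lambda>j. \<rho> ^ q' * Y (Suc n) j)"
        using q by (simp add: x_def n_def fun_eq_iff Suc Suc_diff_Suc)
      have "gap x q j = \<rho> ^ q' * (\<rho> * Y n j + Y (Suc n) j - inn (Y (Suc n)) j - \<rho> * out (Y n) j)"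
        unfolding Suc gap_Suc unfolding x2 unfolding Suc[symmetric] x1
        by (simp add: inn_scale out_scale Suc algebra_simps)
      then show ?thesis by (simp add: rec Suc)
    qed
    have x0: "0 \<le> x t j" for t j using Y \<rho>_gt_1 by (simp add: x_def)
    have "weight s U r p * x (T - r) p \<le> (\<Sum>j\<in>UNIV. weight s U r j * x (T - r) j)"
      by (rule member_le_sum[where f = "\<lambda>j. weight s U r j * x (T - r) j"]) (auto simp: U0 x0)
    also have "\<dots> \<le> (\<Sum>r\<le>T. \<Sum>j\<in>UNIV. weight s U r j * x (T - r) j)"
      by (rule member_le_sum[where f = "\<lambda>r. \<Sum>j\<in>UNIV. weight s U r j * x (T - r) j"])
        (use T in \<open>auto simp: U0 x0 intro!: sum_nonneg\<close>)
    also have "\<dots> = - (\<Sum>r\<le>T. \<Sum>j\<in>UNIV. U r j * gap x (T - r) j)"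
      using test_identity[of x T s U] zero by (simp add: x_def)
    also have "(\<Sum>r\<le>T. \<Sum>j\<in>UNIV. U r j * gap x (T - r) j)
        = (\<Sum>r\<le>T. if r = T then \<Sum>j\<in>UNIV. U T j * (Y (m + T) j - out (Y (m + T)) j) else 0)"
      by (rule sum.cong) (auto simp: g)
    finally have "weight s U r p * (\<rho> ^ (T - r) * Y (m + r) p)
        \<le> - (\<Sum>j\<in>UNIV. U T j * (Y (m + T) j - out (Y (m + T)) j))"
      using T by (simp add: x_def)
    then have "weight s U r p * (\<rho> ^ (T - r) * Y (m + r) p) / \<rho> ^ T
        \<le> - (\<Sum>j\<in>UNIV. U T j * (Y (m + T) j - out (Y (m + T)) j)) / \<rho> ^ T"
      using \<rho>_gt_1 by (intro divide_right_mono) auto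
    then show ?thesis
      using \<rho>_gt_1 T by (simp add: power_diff)
  qed
  define D where "D = (\<Sum>i\<in>UNIV. out (\<lambda>_. B) i)"
  have B0: "0 \<le> B" using Y by (meson order_trans)
  have oB: "0 \<le> out (\<lambda>_. B) j" for j by (rule out_nonneg) (rule B0)
  have "\<bar>Y (m + T) j - out (Y (m + T)) j\<bar> \<le> B + D" for T j
  proof -
    have "0 \<le> out (Y (m + T)) j" by (rule out_nonneg) (rule Y)
    moreover have "out (Y (m + T)) j \<le> out (\<lambda>_. B) j" by (rule out_mono) (rule Y)
    moreover have "out (\<lambda>_. B) j \<le> D"
      unfolding D_def by (rule member_le_sum[where f = "out (\<lambda>_. B)"]) (auto simp: oB)
    ultimately show ?thesis using Y(1)[of "m + T" j] Y(2)[of "m + T" j] by linarith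
  qed
  from test_tail_to_0[OF U, of "\<lambda>T j. Y (m + T) j - out (Y (m + T)) j", OF this]
  have "(\<lambda>T. - ((\<Sum>j\<in>UNIV. U T j * (Y (m + T) j - out (Y (m + T)) j)) / \<rho> ^ T)) \<longlonglongrightarrow> - 0"
    by (rule tendsto_minus)
  then have "weight s U r p * (Y (m + r) p / \<rho> ^ r) \<le> - 0"
    by (rule LIMSEQ_le_const) (use main in blast)
  moreover have "0 \<le> Y (m + r) p / \<rho> ^ r" using Y \<rho>_gt_1 by simp
  ultimately have "Y (m + r) p / \<rho> ^ r = 0"
    using w mult_pos_pos[of "weight s U r p" "Y (m + r) p / \<rho> ^ r"] by fastforce
  then show ?thesis using \<rho>_gt_1 by simp
qed

text \<open>
  At a hub every neighbour carries positive weight for a suitable test function.  Hence a zero at the hub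
  makes all its neighbours vanish, and then the equation at the hub gives a zero one time step earlier.  A
  vertex that vanishes at all sufficiently early times forces the same on its neighbours.
\<close>

lemma zero_spreads:
  assumes conn: "Digraph_Component.connected G"
    and Y: "\<And>m j. 0 \<le> Y m j" "\<And>m j. Y m j \<le> B"
    and rec: "\<And>m i. \<rho> * Y m i + Y (Suc m) i = inn (Y (Suc m)) i + \<rho> * out (Y m) i"
    and zero: "Y 0 s = 0"
    and to_hub: "hub s \<or> (\<exists>U. test_function s U \<and> (\<exists>r p. hub p \<and> weight s U r p > 0))"
  shows "\<exists>M. \<forall>j. Y M j = 0"
proof -
  note vanish = zero_propagates[of Y B, OF Y rec]
  have "\<exists>m q. hub q \<and> Y m q = 0"
  proof (cases "hub s")
    case True
    then show ?thesis using zero by blast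
  next
    case False
    then obtain U r p where "test_function s U" "hub p" "weight s U r p > 0" using to_hub by blast
    then show ?thesis using vanish[OF _ zero] by blast
  qed
  then obtain m q where q: "hub q" "Y m q = 0" by blast
  have "Y (m + n) q = 0" for n
  proof (induction n)
    case (Suc n)
    define k where "k = m + n"
    have z: "Y (k + (if tail G e = q then 0 else 1)) (other_end e q) = 0" if "incident e q" for e
    proof -
      obtain U where U: "test_function q U" "slack q U e"
        using q(1) \<open>incident e q\<close> unfolding hub_def by blast
      have "weight q U (if tail G e = q then 0 else 1) (other_end e q) > 0"
        using U(2) unfolding slack_def by linarith
      then show ?thesis
        unfolding k_def by (rule vanish[OF U(1) Suc])
    qed
    have "inn (Y (Suc k)) q = 0"
      unfolding inn_def
    proof (rule sum.neutral, rule ballI)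
      fix e assume "e \<in> in_arcs G q"
      then show "Y (Suc k) (tail G e) = 0"
        using z[of e] no_loop[of e] by (auto simp: incident_def other_end_def)
    qed
    moreover have "out (Y k) q = 0"
      unfolding out_def
    proof (rule sum.neutral, rule ballI)
      fix e assume "e \<in> out_arcs G q"
      then show "Y k (head G e) = 0"
        using z[of e] by (auto simp: incident_def other_end_def)
    qed
    ultimately show ?case
      using rec[of k q] Suc by (simp add: k_def)
  qed (simp add: q)
  then have q0: "\<forall>n\<ge>m. Y n q = 0" using le_Suc_ex by blast
  let ?S = "{i. \<exists>M. \<forall>n\<ge>M. Y n i = 0}"
  have nb: "(\<forall>e\<in>in_arcs G i. tail G e \<in> ?S) \<and> (\<forall>e\<in>out_arcs G i. head G e \<in> ?S)" if i: "i \<in> ?S" for i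
  proof -
    obtain M where M: "\<And>n. n \<ge> M \<Longrightarrow> Y n i = 0" using i by blast
    have 0: "inn (Y (Suc n)) i = 0 \<and> out (Y n) i = 0" if "n \<ge> M" for n
    proof -
      have nn: "0 \<le> inn (Y (Suc n)) i" "0 \<le> \<rho> * out (Y n) i"
        using \<rho>_gt_1 by (simp_all add: inn_nonneg out_nonneg Y)
      have "inn (Y (Suc n)) i + \<rho> * out (Y n) i = 0"
        using rec[of n i] M[of n] M[of "Suc n"] that by simp
      with nn have "inn (Y (Suc n)) i = 0" "\<rho> * out (Y n) i = 0" by linarith+
      then show ?thesis using \<rho>_gt_1 by simp
    qed
    have "Y n (tail G e) = 0" if "e \<in> in_arcs G i" "n \<ge> Suc M" for e n
    proof -
      obtain n' where n': "n = Suc n'" "n' \<ge> M" using \<open>n \<ge> Suc M\<close> by (cases n) auto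
      have "Y n (tail G e) \<le> inn (Y n) (head G e)"
        by (rule inn_ge) (use that Y in auto)
      then have "Y n (tail G e) \<le> 0"
        using 0[OF n'(2)] n' \<open>e \<in> in_arcs G i\<close> by simp
      then show ?thesis using Y(1)[of n "tail G e"] by linarith
    qed
    moreover have "Y n (head G e) = 0" if "e \<in> out_arcs G i" "n \<ge> M" for e n
    proof -
      have "Y n (head G e) \<le> out (Y n) (tail G e)"
        by (rule out_ge) (use that Y in auto)
      then have "Y n (head G e) \<le> 0"
        using 0[OF \<open>n \<ge> M\<close>] \<open>e \<in> out_arcs G i\<close> by simp
      then show ?thesis using Y(1)[of n "head G e"] by linarith
    qed
    ultimately show ?thesis by blast
  qed
  have "?S = UNIV"
  proof (rule connected_closed_UNIV[OF conn])
    show "q \<in> ?S" using q0 by blast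
    fix e assume "e \<in> arcs G"
    then show "tail G e \<in> ?S \<longleftrightarrow> head G e \<in> ?S"
      using nb[of "tail G e"] nb[of "head G e"] in_in_arcs_conv[of e G "head G e"] in_out_arcs_conv[of e G "tail G e"]
      by blast
  qed
  then have "\<forall>i. \<exists>M. \<forall>n\<ge>M. Y n i = 0" by blast
  then obtain M where M: "\<And>i n. n \<ge> M i \<Longrightarrow> Y n i = 0" by metis
  have "\<forall>j. Y (Max (range M)) j = 0" by (intro allI M) simp
  then show ?thesis by blast
qed

lemma eigenvector_unique:
  assumes conn: "Digraph_Component.connected G"
    and z: "\<And>i. (1 + \<rho>) * z i = inn z i + \<rho> * out z i"
  shows "\<exists>c. \<forall>i. z i = c * v i"
proof -
  define c where "c = Max (range (\<lambda>i. z i / v i))"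
  have "c \<in> range (\<lambda>i. z i / v i)" unfolding c_def by (rule Max_in) auto
  then obtain i0 where i0: "c = z i0 / v i0" by blast
  define y where "y i = c * v i - z i" for i
  have y0: "0 \<le> y i" for i
  proof -
    have "z i / v i \<le> c" unfolding c_def by (rule Max_ge) auto
    then show ?thesis using v_pos[of i] by (simp add: y_def field_simps)
  qed
  have y: "(1 + \<rho>) * y i = inn y i + \<rho> * out y i" for i
    using eigen[of i] z[of i] unfolding y_def
    by (simp add: inn_diff out_diff inn_scale out_scale algebra_simps flip: distrib_left)
  have nb: "(\<forall>e\<in>in_arcs G i. y (tail G e) = 0) \<and> (\<forall>e\<in>out_arcs G i. y (head G e) = 0)" if i: "y i = 0" for i
  proof -
    have nn: "0 \<le> inn y i" "0 \<le> \<rho> * out y i"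
      using \<rho>_gt_1 by (simp_all add: inn_nonneg out_nonneg y0)
    have "inn y i + \<rho> * out y i = 0" using y[of i] i by simp
    with nn have "inn y i = 0" "\<rho> * out y i = 0" by linarith+
    then have z: "inn y i = 0" "out y i = 0" using \<rho>_gt_1 by simp_all
    have "y (tail G e) = 0" if "e \<in> in_arcs G i" for e
      using inn_ge[of e y, OF _ y0] that z(1) y0[of "tail G e"] by force
    moreover have "y (head G e) = 0" if "e \<in> out_arcs G i" for e
      using out_ge[of e y, OF _ y0] that z(2) y0[of "head G e"] by force
    ultimately show ?thesis by blast
  qed
  have "{i. y i = 0} = UNIV"
  proof (rule connected_closed_UNIV[OF conn])
    show "i0 \<in> {i. y i = 0}" using v_pos[of i0] by (simp add: y_def i0)
    fix e assume "e \<in> arcs G"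
    then show "tail G e \<in> {i. y i = 0} \<longleftrightarrow> head G e \<in> {i. y i = 0}"
      using nb[of "tail G e"] nb[of "head G e"] in_in_arcs_conv[of e G "head G e"] in_out_arcs_conv[of e G "tail G e"]
      by blast
  qed
  then have "y i = 0" for i by blast
  then have "\<forall>i. z i = c * v i" by (simp add: y_def)
  then show ?thesis by blast
qed

text \<open>
  Reindexed by the number of steps, \<open>\<rho>\<^sup>t x(t)\<close> becomes a sequence with \<open>y\<^sub>k\<^sub>+\<^sub>1 + y\<^sub>k\<^sub>-\<^sub>1 = A y\<^sub>k\<close> for the symmetric adjacency
  matrix \<open>A\<close>.  Symmetry makes \<open>\<beta> k l = y\<^sub>k \<bullet> y\<^sub>l\<close> a solution of the discrete wave equation, and since it decays
  towards the past it depends on \<open>k + l\<close> only.  Then the second difference of the bounded function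
  \<open>\<rho>\<^sup>-\<^sup>k |y\<^sub>k|\<^sup>2\<close> is the nonnegative quantity \<open>\<rho>\<^sup>-\<^sup>k\<^sup>-\<^sup>1 |y\<^sub>k\<^sub>+\<^sub>1 - \<rho> y\<^sub>k\<^sub>-\<^sub>1|\<^sup>2\<close>, which therefore vanishes.
\<close>

lemma graded_orbit_constant:
  fixes H :: "'a \<Rightarrow> int" and x :: "int \<Rightarrow> 'a \<Rightarrow> real"
  assumes H: "\<And>e. e \<in> arcs G \<Longrightarrow> H (head G e) = H (tail G e) + 1"
    and bd: "\<And>t i. \<bar>x t i\<bar> \<le> B"
    and rec: "\<And>t i. \<rho> * x (t + 1) i + x t i = inn (x t) i + \<rho> * out (x (t + 1)) i"
  shows "x (t + 1) i = x t i"
proof -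
  define y where "y k i = (if even (k + H i) then \<rho> powi ((k + H i) div 2) * x ((k + H i) div 2) i else 0)"
    for k i
  have \<rho>0: "\<rho> > 0" using \<rho>_gt_1 by simp
  have wave: "y (k + 1) i + y (k - 1) i = inn (y k) i + out (y k) i" for k i
  proof (cases "even (k + 1 + H i)")
    case True
    then obtain t where t: "k + 1 + H i = 2 * (t + 1)"
      by (metis add.commute diff_add_cancel evenE)
    have "inn (y k) i = \<rho> powi t * inn (x t) i"
      unfolding inn_def sum_distrib_left
    proof (rule sum.cong)
      fix e assume "e \<in> in_arcs G i"
      then have "k + H (tail G e) = 2 * t" using H[of e] t by auto
      then show "y k (tail G e) = \<rho> powi t * x t (tail G e)" by (simp add: y_def)
    qed simp
    moreover have "out (y k) i = \<rho> powi (t + 1) * out (x (t + 1)) i"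
      unfolding out_def sum_distrib_left
    proof (rule sum.cong)
      fix e assume "e \<in> out_arcs G i"
      then have "k + H (head G e) = 2 * (t + 1)" using H[of e] t by auto
      then show "y k (head G e) = \<rho> powi (t + 1) * x (t + 1) (head G e)" by (simp add: y_def)
    qed simp
    moreover have "y (k + 1) i = \<rho> powi (t + 1) * x (t + 1) i" unfolding y_def t by simp
    moreover have "y (k - 1) i = \<rho> powi t * x t i"
    proof -
      have e: "k - 1 + H i = 2 * t" using t by simp
      show ?thesis unfolding y_def e by simp
    qed
    moreover have "\<rho> powi (t + 1) = \<rho> powi t * \<rho>" using \<rho>0 by (simp add: power_int_add)
    ultimately have "y (k + 1) i + y (k - 1) i - inn (y k) i - out (y k) i
        = \<rho> powi t * (\<rho> * x (t + 1) i + x t i - inn (x t) i - \<rho> * out (x (t + 1)) i)"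
      by (simp add: algebra_simps)
    then show ?thesis by (simp add: rec)
  next
    case False
    have "inn (y k) i = 0"
      unfolding inn_def
    proof (rule sum.neutral, rule ballI)
      fix e assume "e \<in> in_arcs G i"
      then have "k + H (tail G e) = k + 1 + H i - 2" using H[of e] by auto
      then show "y k (tail G e) = 0" using False by (simp add: y_def)
    qed
    moreover have "out (y k) i = 0"
      unfolding out_def
    proof (rule sum.neutral, rule ballI)
      fix e assume "e \<in> out_arcs G i"
      then have "k + H (head G e) = k + 1 + H i" using H[of e] by auto
      then show "y k (head G e) = 0" using False by (simp add: y_def)
    qed
    moreover have "odd (k - 1 + H i)" using False by simp
    ultimately show ?thesis using False by (simp add: y_def)
  qed
  define \<beta> where "\<beta> k l = (\<Sum>i\<in>UNIV. y k i * y l i)" for k l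
  have sym: "\<beta> k l = \<beta> l k" for k l by (simp add: \<beta>_def mult.commute)
  have pt: "y (k + 1) i * z + y (k - 1) i * z = z * inn (y k) i + out (y k) i * z" for k i z
    using arg_cong[OF wave[of k i], of "\<lambda>x. x * z"] by (simp only: distrib_right mult.commute[of z])
  have wave2: "\<beta> (k + 1) l + \<beta> (k - 1) l = \<beta> k (l + 1) + \<beta> k (l - 1)" for k l
  proof -
    have "\<beta> (k + 1) l + \<beta> (k - 1) l = (\<Sum>i\<in>UNIV. y l i * inn (y k) i) + (\<Sum>i\<in>UNIV. out (y k) i * y l i)"
      unfolding \<beta>_def sum.distrib[symmetric] by (simp only: pt)
    also have "\<dots> = (\<Sum>i\<in>UNIV. out (y l) i * y k i) + (\<Sum>i\<in>UNIV. y k i * inn (y l) i)"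
      by (simp add: inn_out_adjoint)
    also have "\<dots> = \<beta> k (l + 1) + \<beta> k (l - 1)"
      unfolding \<beta>_def sum.distrib[symmetric]
    proof (rule sum.cong)
      fix i
      show "out (y l) i * y k i + y k i * inn (y l) i = y k i * y (l + 1) i + y k i * y (l - 1) i"
        using pt[of l i "y k i"] by (simp only: mult.commute[of "y k i"] add.commute)
    qed simp
    finally show ?thesis .
  qed
  define D where "D = (\<Sum>i\<in>UNIV. \<rho> powi H i * B\<^sup>2)"
  have norm_le: "0 \<le> \<beta> k k" "\<beta> k k \<le> D * \<rho> powi k" for k
  proof -
    show "0 \<le> \<beta> k k" by (simp add: \<beta>_def sum_nonneg)
    have "y k i * y k i \<le> \<rho> powi H i * B\<^sup>2 * \<rho> powi k" for i
    proof (cases "even (k + H i)")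
      case True
      then obtain q where q: "k + H i = 2 * q" by blast
      have "y k i * y k i = \<rho> powi (q + q) * (x q i)\<^sup>2"
      proof -
        have "y k i = \<rho> powi q * x q i" unfolding y_def q by simp
        moreover have "\<rho> powi (q + q) = \<rho> powi q * \<rho> powi q"
          using \<rho>0 by (intro power_int_add) auto
        ultimately show ?thesis by (simp only: power2_eq_square mult.assoc mult.left_commute)
      qed
      also have "\<dots> \<le> \<rho> powi (q + q) * B\<^sup>2"
        using bd[of q i] \<rho>0 by (intro mult_left_mono) (auto simp: abs_le_square_iff[symmetric])
      also have "\<rho> powi (q + q) = \<rho> powi H i * \<rho> powi k"
      proof -
        have "q + q = H i + k" using q by simp
        then show ?thesis using \<rho>0 by (simp only:) (intro power_int_add, auto)
      qed
      finally show ?thesis by (simp add: algebra_simps)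
    qed (use \<rho>0 in \<open>simp add: y_def\<close>)
    then show "\<beta> k k \<le> D * \<rho> powi k"
      unfolding \<beta>_def D_def sum_distrib_right by (rule sum_mono)
  qed
  have D0: "0 \<le> D" using \<rho>0 by (simp add: D_def sum_nonneg)
  have \<beta>_le: "\<bar>\<beta> k l\<bar> \<le> D * \<rho> powi k + D * \<rho> powi l" for k l
  proof -
    have "\<bar>\<beta> k l\<bar> \<le> (\<Sum>i\<in>UNIV. y k i * y k i + y l i * y l i)"
      unfolding \<beta>_def
    proof (rule order_trans[OF sum_abs], rule sum_mono)
      fix i
      have "2 * \<bar>y k i * y l i\<bar> \<le> y k i * y k i + y l i * y l i"
        using sum_squares_bound[of "\<bar>y k i\<bar>" "\<bar>y l i\<bar>"] by (simp add: abs_mult power2_eq_square)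
      then show "\<bar>y k i * y l i\<bar> \<le> y k i * y k i + y l i * y l i" by linarith
    qed
    also have "\<dots> = \<beta> k k + \<beta> l l" by (simp add: \<beta>_def sum.distrib)
    finally show ?thesis using norm_le(2)[of k] norm_le(2)[of l] by linarith
  qed
  define \<Delta> where "\<Delta> k l = \<beta> (k + 1) l - \<beta> k (l + 1)" for k l
  have \<Delta>_shift: "\<Delta> k l = \<Delta> (k - int n) (l - int n)" for k l n
  proof (induction n)
    case (Suc n)
    show ?case
      unfolding Suc using wave2[of "k - int n" "l - int n"] by (simp add: \<Delta>_def algebra_simps)
  qed simp
  have \<Delta>_0: "\<Delta> k l = 0" for k l
  proof -
    define E where "E = D * (\<rho> powi (k + 1) + \<rho> powi l + \<rho> powi k + \<rho> powi (l + 1))"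
    have "\<bar>\<Delta> k l\<bar> \<le> E * (1 / \<rho>) ^ n" for n
    proof -
      have p: "\<rho> powi (j - int n) = \<rho> powi j * (1 / \<rho>) ^ n" for j
        using \<rho>0 by (simp add: power_int_diff power_divide)
      have "\<bar>\<Delta> k l\<bar> \<le> \<bar>\<beta> (k + 1 - int n) (l - int n)\<bar> + \<bar>\<beta> (k - int n) (l + 1 - int n)\<bar>"
        unfolding \<Delta>_shift[of k l n] unfolding \<Delta>_def by (simp add: algebra_simps)
      also have "\<dots> \<le> E * (1 / \<rho>) ^ n"
        using \<beta>_le[of "k + 1 - int n" "l - int n"] \<beta>_le[of "k - int n" "l + 1 - int n"]
        unfolding p E_def by (simp add: algebra_simps)
      finally show ?thesis .
    qed
    moreover have "(\<lambda>n. E * (1 / \<rho>) ^ n) \<longlonglongrightarrow> 0"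
      using \<rho>_gt_1 by (intro tendsto_mult_right_zero LIMSEQ_power_zero) auto
    ultimately have "\<bar>\<Delta> k l\<bar> \<le> 0"
      by (intro LIMSEQ_le_const) auto
    then show ?thesis by simp
  qed
  define m where "m k = \<beta> k k / \<rho> powi k" for k
  have second_diff: "m (k + 1) + m (k - 1) - 2 * m k = (\<Sum>i\<in>UNIV. (y (k + 1) i - \<rho> * y (k - 1) i)\<^sup>2) / \<rho> powi (k + 1)" for k
  proof -
    have "\<beta> (k + 1) (k - 1) = \<beta> k k"
      using \<Delta>_0[of k "k - 1"] by (simp add: \<Delta>_def)
    moreover have "(\<Sum>i\<in>UNIV. (y (k + 1) i - \<rho> * y (k - 1) i)\<^sup>2)
        = (\<Sum>i\<in>UNIV. y (k + 1) i * y (k + 1) i + \<rho>\<^sup>2 * (y (k - 1) i * y (k - 1) i) - 2 * \<rho> * (y (k + 1) i * y (k - 1) i))"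
      by (rule sum.cong) (simp_all add: power2_eq_square algebra_simps)
    moreover have "\<dots> = \<beta> (k + 1) (k + 1) + \<rho>\<^sup>2 * \<beta> (k - 1) (k - 1) - 2 * \<rho> * \<beta> (k + 1) (k - 1)"
      unfolding \<beta>_def sum_distrib_left by (simp only: sum.distrib sum_subtractf)
    ultimately have e: "(\<Sum>i\<in>UNIV. (y (k + 1) i - \<rho> * y (k - 1) i)\<^sup>2)
        = \<beta> (k + 1) (k + 1) + \<rho>\<^sup>2 * \<beta> (k - 1) (k - 1) - 2 * \<rho> * \<beta> k k"
      by simp
    have p: "\<rho> powi (k + 1) = \<rho> powi k * \<rho>" "\<rho> powi (k - 1) = \<rho> powi k / \<rho>" "\<rho> powi k > 0"
      using \<rho>0 by (simp_all add: power_int_add power_int_diff)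
    show ?thesis
      unfolding e m_def p(1,2) using p(3) \<rho>0 by (simp add: field_simps power2_eq_square)
  qed
  have m_const: "m (k + 1) = m k" for k
  proof (rule convex_bounded_int_const)
    fix k
    have "0 \<le> m (k + 1) + m (k - 1) - 2 * m k"
      unfolding second_diff using \<rho>0 by (intro divide_nonneg_nonneg sum_nonneg) auto
    then show "2 * m k \<le> m (k + 1) + m (k - 1)" by simp
    show "\<bar>m k\<bar> \<le> D"
      using norm_le[of k] \<rho>0 by (simp add: m_def field_simps)
  qed
  define k where "k = 2 * t + 1 - H i"
  have "m (k + 1) + m (k - 1) - 2 * m k = 0"
    using m_const[of k] m_const[of "k - 1"] by simp
  then have "(\<Sum>i\<in>UNIV. (y (k + 1) i - \<rho> * y (k - 1) i)\<^sup>2) = 0"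
    unfolding second_diff using \<rho>0 by simp
  then have "(y (k + 1) i - \<rho> * y (k - 1) i)\<^sup>2 = 0"
    by (subst (asm) sum_nonneg_eq_0_iff) auto
  then have "y (k + 1) i = \<rho> * y (k - 1) i" by simp
  moreover have "y (k + 1) i = \<rho> powi (t + 1) * x (t + 1) i"
  proof -
    have e: "k + 1 + H i = 2 * (t + 1)" by (simp add: k_def)
    show ?thesis unfolding y_def e by simp
  qed
  moreover have "y (k - 1) i = \<rho> powi t * x t i" by (simp add: y_def k_def)
  ultimately show ?thesis using \<rho>0 by (simp add: power_int_add)
qed

end

context vertex_quiver begin

section \<open>The limit theorem\<close>

lemma sum_upward_closed_zero:
  "(\<And>i. x i = out x i) \<Longrightarrow> x i = 0"
proof (induction "depth i" arbitrary: i rule: less_induct)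
  case less
  have "out x i = 0"
    unfolding out_def using less depth_decreases by (intro sum.neutral) auto
  then show ?case using less.prems[of i] by simp
qed

lemma sum_downward_closed_zero:
  "(\<And>i. x i = inn x i) \<Longrightarrow> x i = 0"
proof (induction "CARD('v) - depth i" arbitrary: i rule: less_induct)
  case less
  have d: "depth k \<le> CARD('v)" for k
    unfolding depth_def by (rule card_mono) auto
  have "inn x i = 0"
    unfolding inn_def
  proof (rule sum.neutral, rule ballI)
    fix e assume "e \<in> in_arcs G i"
    then have "depth i < depth (tail G e)" using depth_decreases[of e] by auto
    then show "x (tail G e) = 0" using d[of "tail G e"] by (intro less.hyps less.prems) auto
  qed
  then show ?case using less.prems[of i] by simp
qed

definition out_map :: "real ^ 'v \<Rightarrow> real ^ 'v" where
  "out_map x = (\<chi> i. x $ i - out (($) x) i)"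

definition in_map :: "real ^ 'v \<Rightarrow> real ^ 'v" where
  "in_map x = (\<chi> i. inn (($) x) i - x $ i)"

lemma linear_out_map: "linear out_map"
  by (rule linearI) (auto simp: out_map_def vec_eq_iff out_def sum.distrib sum_distrib_left algebra_simps)

lemma linear_in_map: "linear in_map"
  by (rule linearI) (auto simp: in_map_def vec_eq_iff inn_def sum.distrib sum_distrib_left algebra_simps)

text \<open>
  Both maps are unipotent up to sign with respect to the acyclic order, so the equation determines the
  next time slice from the present one and conversely.
\<close>

lemma forward_map_exists:
  "\<exists>F F'. bounded_linear F \<and> bounded_linear F' \<and> (\<forall>x. F' (F x) = x) \<and> (\<forall>x. F (F' x) = x)
     \<and> (\<forall>x y. y = F x \<longleftrightarrow> out_map y = in_map x)"
proof -
  have injo: "inj out_map"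
    unfolding linear_injective_0[OF linear_out_map]
  proof (intro allI impI)
    fix x :: "real ^ 'v" assume "out_map x = 0"
    then have "x $ i = out (($) x) i" for i by (simp add: out_map_def vec_eq_iff)
    then show "x = 0" using sum_upward_closed_zero[of "($) x"] by (simp add: vec_eq_iff)
  qed
  have inji: "inj in_map"
    unfolding linear_injective_0[OF linear_in_map]
  proof (intro allI impI)
    fix x :: "real ^ 'v" assume "in_map x = 0"
    then have "x $ i = inn (($) x) i" for i by (simp add: in_map_def vec_eq_iff)
    then show "x = 0" using sum_downward_closed_zero[of "($) x"] by (simp add: vec_eq_iff)
  qed
  obtain O' where O': "linear O'" "\<And>x. O' (out_map x) = x" "\<And>x. out_map (O' x) = x"
    using linear_injective_isomorphism[OF linear_out_map injo] by blast
  obtain I' where I': "linear I'" "\<And>x. I' (in_map x) = x" "\<And>x. in_map (I' x) = x"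
    using linear_injective_isomorphism[OF linear_in_map inji] by blast
  show ?thesis
  proof (intro exI conjI allI)
    show "bounded_linear (O' \<circ> in_map)" "bounded_linear (I' \<circ> out_map)"
      by (simp_all add: linear_linear linear_compose O' I' linear_in_map linear_out_map)
    fix x y
    show "(I' \<circ> out_map) ((O' \<circ> in_map) x) = x" "(O' \<circ> in_map) ((I' \<circ> out_map) x) = x"
      by (simp_all add: O' I')
    show "y = (O' \<circ> in_map) x \<longleftrightarrow> out_map y = in_map x"
      using O'(2)[of y] O'(3)[of "in_map x"] by auto
  qed
qed

end

context growth_quiver begin

text \<open>
  The first alternative in \<open>alt\<close> holds for quivers without cycles and the second one for those with a cycle.
\<close>

theorem growth_limit:
  assumes conn: "Digraph_Component.connected G"
    and tests: "\<And>s. \<exists>U. test_function s U"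
    and alt: "(\<exists>H :: 'a \<Rightarrow> int. \<forall>e\<in>arcs G. H (head G e) = H (tail G e) + 1) \<or>
       (\<forall>s. hub s \<or> (\<exists>U. test_function s U \<and> (\<exists>r p. hub p \<and> weight s U r p > 0)))"
    and x0: "\<And>i. x 0 i = 0" and gap: "\<And>t i. 0 < gap x (Suc t) i" "\<And>t i. gap x (Suc t) i \<le> E"
  shows "\<exists>c>0. (\<lambda>t. \<chi> i. x t i / \<rho> ^ t) \<longlonglongrightarrow> (\<chi> i. c * v i)"
proof -
  note strict = strict_test_function[OF tests]
  have \<rho>0: "\<rho> > 0" using \<rho>_gt_1 by simp
  obtain F F' where bl: "bounded_linear F" "bounded_linear F'" and inv: "\<And>x. F' (F x) = x" "\<And>x. F (F' x) = x"
    and F_iff: "\<And>x y. y = F x \<longleftrightarrow> out_map y = in_map x"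
    using forward_map_exists by metis
  interpret F: bounded_linear F by (rule bl)
  interpret F': bounded_linear F' by (rule bl)
  have F: "out_map (F x) = in_map x" for x using F_iff by blast
  obtain C where C: "C \<ge> 0" "\<And>x g t i. (\<And>t i. \<bar>gap x t i\<bar> \<le> g) \<Longrightarrow> \<bar>x t i\<bar> \<le> C * g * \<rho> ^ t"
    using growth_bound[OF strict] by metis
  define V :: "real ^ 'a" where "V = (\<chi> i. v i)"
  have FV: "F (c *\<^sub>R V) = (\<rho> * c) *\<^sub>R V" for c
  proof -
    have "out_map ((\<rho> * c) *\<^sub>R V) = in_map (c *\<^sub>R V)"
    proof (rule vec_eq_iff[THEN iffD2], rule allI)
      fix i
      have "out (($) ((\<rho> * c) *\<^sub>R V)) i = \<rho> * c * out v i" "inn (($) (c *\<^sub>R V)) i = c * inn v i"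
        by (simp_all add: out_def inn_def V_def sum_distrib_left)
      moreover have "c * ((1 + \<rho>) * v i) = c * (inn v i + \<rho> * out v i)" by (simp add: eigen)
      ultimately show "out_map ((\<rho> * c) *\<^sub>R V) $ i = in_map (c *\<^sub>R V) $ i"
        by (simp add: out_map_def in_map_def V_def algebra_simps)
    qed
    then show ?thesis using F_iff by metis
  qed
  define P where "P m y = (1 / \<rho> ^ m) *\<^sub>R (F ^^ m) y" for m y
  have FmV: "(F ^^ m) (c *\<^sub>R V) = (\<rho> ^ m * c) *\<^sub>R V" for m c
    by (induction m) (simp_all add: FV mult.assoc)
  have Fm_diff: "(F ^^ m) (y - z) = (F ^^ m) y - (F ^^ m) z" for m y z
    by (induction m) (simp_all add: linear_diff[OF F.linear])
  have Fm_scale: "(F ^^ m) (c *\<^sub>R y) = c *\<^sub>R (F ^^ m) y" for m c y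
    by (induction m) (simp_all add: linear_scale[OF F.linear])
  have PV: "P m (c *\<^sub>R V) = c *\<^sub>R V" for m c
    using \<rho>0 by (simp add: P_def FmV)
  have gap_orbit: "gap (\<lambda>t i. (F ^^ t) y $ i) t i = (if t = 0 then out_map y $ i else 0)" for y t i
  proof (cases t)
    case (Suc t')
    have "out_map ((F ^^ t) y) $ i = in_map ((F ^^ t') y) $ i" by (simp add: Suc F)
    then show ?thesis by (simp add: Suc gap_Suc out_map_def in_map_def)
  qed (simp add: gap_0 out_map_def)
  have norm_le: "norm y \<le> real CARD('a) * b" if "\<And>i. \<bar>y $ i\<bar> \<le> b" for y :: "real ^ 'a" and b
  proof -
    have "norm y \<le> (\<Sum>i\<in>UNIV. \<bar>y $ i\<bar>)" by (rule norm_le_l1_cart)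
    also have "\<dots> \<le> (\<Sum>i\<in>(UNIV :: 'a set). b)" by (rule sum_mono) (rule that)
    finally show ?thesis by simp
  qed
  obtain b where b: "b > 0" "\<And>y. norm (out_map y) \<le> norm y * b"
    using bounded_linear.pos_bounded[of out_map] linear_out_map by (auto simp: linear_linear)
  define K where "K = real CARD('a) * (C * b)"
  have P_le: "norm (P m y) \<le> K * norm y" for m y
  proof -
    have "\<bar>gap (\<lambda>t i. (F ^^ t) y $ i) t i\<bar> \<le> norm y * b" for t i
      using component_le_norm_cart[of "out_map y" i] b(2)[of y] b(1)
      by (auto simp: gap_orbit)
    then have "\<bar>(F ^^ m) y $ i\<bar> \<le> C * (norm y * b) * \<rho> ^ m" for i by (rule C(2))
    then have "\<bar>P m y $ i\<bar> \<le> C * (norm y * b)" for i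
      using \<rho>0 by (simp add: P_def abs_mult field_simps)
    from norm_le[OF this] show ?thesis by (simp add: K_def algebra_simps)
  qed
  define X :: "nat \<Rightarrow> real ^ 'a" where "X t = (\<chi> i. x t i / \<rho> ^ t)" for t
  have E0: "0 \<le> E" using gap[of 0 undefined] by linarith
  define \<delta> where "\<delta> t = real CARD('a) * (C * E / \<rho> ^ t)" for t :: nat
  have \<delta>_0: "\<delta> \<longlonglongrightarrow> 0"
  proof -
    have "(\<lambda>t. real CARD('a) * (C * E) * (1 / \<rho>) ^ t) \<longlonglongrightarrow> 0"
      using \<rho>_gt_1 by (intro tendsto_mult_right_zero LIMSEQ_power_zero) auto
    then show ?thesis by (simp add: \<delta>_def[abs_def] power_divide)
  qed
  have X_P: "norm (X (t + m) - P m (X t)) \<le> \<delta> t" for t m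
  proof -
    define y :: "real ^ 'a" where "y = (\<chi> i. x t i)"
    define d where "d m i = x (t + m) i - (F ^^ m) y $ i" for m i
    have "gap d m i = (if m = 0 then 0 else gap x (t + m) i)" for m i
    proof -
      have "gap d m i = gap (\<lambda>m. x (t + m)) m i - gap (\<lambda>m i. (F ^^ m) y $ i) m i"
        by (cases m) (simp_all add: d_def[abs_def] gap_def inn_diff out_diff)
      moreover have "($) y = x t" by (simp add: y_def fun_eq_iff)
      ultimately show ?thesis
        by (cases m) (simp_all add: gap_orbit gap_def out_map_def y_def)
    qed
    moreover have "\<bar>gap x (t + m) i\<bar> \<le> E" if "m \<noteq> 0" for m i
      using gap[of "t + m - 1" i] that by (simp add: abs_le_iff less_imp_le)
    ultimately have "\<bar>gap d m i\<bar> \<le> E" for m i using E0 by simp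
    then have d: "\<bar>d m i\<bar> \<le> C * E * \<rho> ^ m" for m i by (rule C(2))
    have "\<bar>(X (t + m) - P m (X t)) $ i\<bar> \<le> C * E / \<rho> ^ t" for i
    proof -
      have "X t = (1 / \<rho> ^ t) *\<^sub>R y" by (simp add: X_def y_def vec_eq_iff)
      then have "(X (t + m) - P m (X t)) $ i = d m i / \<rho> ^ (t + m)"
        using \<rho>0 by (simp add: P_def Fm_scale X_def d_def power_add field_simps)
      then have "\<bar>(X (t + m) - P m (X t)) $ i\<bar> = \<bar>d m i\<bar> / \<rho> ^ (t + m)"
        using \<rho>0 by (simp add: abs_divide)
      also have "\<dots> \<le> C * E * \<rho> ^ m / \<rho> ^ (t + m)"
        using \<rho>0 by (intro divide_right_mono d) auto
      finally show ?thesis using \<rho>0 by (simp add: power_add)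
    qed
    from norm_le[OF this] show ?thesis by (simp add: \<delta>_def)
  qed
  have X0: "X 0 = 0" by (simp add: X_def x0 vec_eq_iff)
  have X_bd: "norm (X m) \<le> \<delta> 0" for m
  proof -
    have "P m 0 = 0" using PV[of m 0] by simp
    then show ?thesis using X_P[of 0 m] by (simp add: X0)
  qed
  define \<Psi> where "\<Psi> y = (1 / \<rho>) *\<^sub>R F y" for y
  define \<Psi>' where "\<Psi>' y = \<rho> *\<^sub>R F' y" for y
  have bl\<Psi>: "bounded_linear \<Psi>" "bounded_linear \<Psi>'"
    unfolding \<Psi>_def[abs_def] \<Psi>'_def[abs_def]
    by (intro bounded_linear_compose[OF bounded_linear_scaleR_right] bl)+
  have inv\<Psi>: "\<Psi>' (\<Psi> y) = y" "\<Psi> (\<Psi>' y) = y" for y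
    using \<rho>0 by (simp_all add: \<Psi>_def \<Psi>'_def linear_scale[OF F.linear] linear_scale[OF F'.linear] inv)
  have \<Psi>_rec: "\<rho> * \<Psi> y $ i + y $ i = inn (($) y) i + \<rho> * out (($) (\<Psi> y)) i" for y i
  proof -
    have e: "F y = \<rho> *\<^sub>R \<Psi> y" using \<rho>0 by (simp add: \<Psi>_def)
    have "out_map (F y) $ i = in_map y $ i" by (simp add: F)
    moreover have "out (($) (\<rho> *\<^sub>R \<Psi> y)) i = \<rho> * out (($) (\<Psi> y)) i"
      by (simp add: out_def sum_distrib_left)
    ultimately show ?thesis unfolding e by (simp add: out_map_def in_map_def)
  qed
  \<comment> \<open>Cluster points are therefore permuted by the normalised evolution \<open>\<Psi>\<close>.\<close>
  have step: "(\<lambda>t. X (Suc t) - \<Psi> (X t)) \<longlonglongrightarrow> 0"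
  proof (rule Lim_null_comparison[OF always_eventually \<delta>_0], rule allI)
    fix t
    show "norm (X (Suc t) - \<Psi> (X t)) \<le> \<delta> t"
      using X_P[of t 1] by (simp add: P_def \<Psi>_def)
  qed
  note fwd = cluster_point_forward[OF bl\<Psi>(1) step]
  note bwd = cluster_point_backward[OF bl\<Psi>(2) inv\<Psi>(1) step]
  have bwds: "cluster_point X ((\<Psi>' ^^ m) z)" if "cluster_point X z" for m z
    by (induction m) (simp_all add: that bwd)
  have fwds: "cluster_point X ((\<Psi> ^^ m) z)" if "cluster_point X z" for m z
    by (induction m) (simp_all add: that fwd)
  have cl_bd: "\<bar>z $ i\<bar> \<le> \<delta> 0" if "cluster_point X z" for z i
    using cluster_point_norm_le[OF that X_bd] component_le_norm_cart[of z i] by linarith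
  have "bounded (range X)" using X_bd by (auto simp: bounded_iff)
  then obtain z0 where z0: "cluster_point X z0" using cluster_point_exists by blast
  have "\<exists>c. cluster_point X (c *\<^sub>R V)"
    using alt
  proof
    assume "\<exists>H :: 'a \<Rightarrow> int. \<forall>e\<in>arcs G. H (head G e) = H (tail G e) + 1"
    then obtain H :: "'a \<Rightarrow> int" where H: "\<And>e. e \<in> arcs G \<Longrightarrow> H (head G e) = H (tail G e) + 1" by blast
    \<comment> \<open>The orbit of \<open>z0\<close> through all integer times.\<close>
    define o' where "o' t = (if t \<ge> 0 then (\<Psi> ^^ nat t) z0 else (\<Psi>' ^^ nat (- t)) z0)" for t :: int
    have o'_step: "o' (t + 1) = \<Psi> (o' t)" for t
    proof (cases "t \<ge> 0")
      case True
      then have "nat (t + 1) = Suc (nat t)" by simp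
      then show ?thesis using True by (simp add: o'_def)
    next
      case False
      define n where "n = nat (- t - 1)"
      have t: "t = - int (Suc n)" using False by (simp add: n_def)
      have n: "nat (- t) = Suc n" "nat (- (t + 1)) = n" by (simp_all add: t)
      show ?thesis
      proof (cases "n = 0")
        case True
        then show ?thesis by (simp add: o'_def t inv\<Psi>)
      next
        case nz: False
        then have "\<not> t + 1 \<ge> 0" by (simp add: t)
        then show ?thesis using False n by (simp add: o'_def inv\<Psi>)
      qed
    qed
    have o'_cl: "cluster_point X (o' t)" for t
      using fwds[OF z0] bwds[OF z0] by (simp add: o'_def)
    have "o' (t + 1) $ i = o' t $ i" for t i
    proof (rule graded_orbit_constant[of H "\<lambda>t i. o' t $ i", OF H])
      fix t i
      show "\<bar>o' t $ i\<bar> \<le> \<delta> 0" by (rule cl_bd[OF o'_cl])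
      show "\<rho> * o' (t + 1) $ i + o' t $ i = inn (($) (o' t)) i + \<rho> * out (($) (o' (t + 1))) i"
        unfolding o'_step by (rule \<Psi>_rec)
    qed
    then have "\<Psi> z0 $ i = z0 $ i" for i
      using o'_step[of 0] by (metis o'_def add_0 funpow_0 nat_0 order_refl)
    then have "\<Psi> z0 = z0" by (simp add: vec_eq_iff)
    then have "(1 + \<rho>) * z0 $ i = inn (($) z0) i + \<rho> * out (($) z0) i" for i
      using \<Psi>_rec[of z0 i] by (simp add: algebra_simps)
    then obtain c where "\<forall>i. z0 $ i = c * v i"
      using eigenvector_unique[OF conn, of "($) z0"] by auto
    then have "z0 = c *\<^sub>R V" by (simp add: V_def vec_eq_iff)
    then show ?thesis using z0 by blast
  next
    assume hubs: "\<forall>s. hub s \<or> (\<exists>U. test_function s U \<and> (\<exists>r p. hub p \<and> weight s U r p > 0))"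
    let ?\<Lambda> = "{z. cluster_point X z}"
    have "bounded ?\<Lambda>"
      unfolding bounded_iff using cluster_point_norm_le[of X, OF _ X_bd] by blast
    then have comp: "compact ?\<Lambda>" by (simp add: compact_eq_bounded_closed closed_cluster_points)
    have "\<exists>z\<in>?\<Lambda>. \<forall>y\<in>?\<Lambda>. y $ i / v i \<le> z $ i / v i" for i
      using z0 v_pos[of i]
      by (intro continuous_attains_sup[OF comp]) (auto intro!: continuous_intros simp: less_imp_neq[symmetric])
    then obtain zm where zm: "\<And>i. cluster_point X (zm i)"
      "\<And>i y. cluster_point X y \<Longrightarrow> y $ i / v i \<le> zm i $ i / v i"
      by (metis mem_Collect_eq)
    define c where "c = Max (range (\<lambda>i. zm i $ i / v i))"
    have "c \<in> range (\<lambda>i. zm i $ i / v i)" unfolding c_def by (rule Max_in) auto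
    then obtain i0 where i0: "c = zm i0 $ i0 / v i0" by blast
    have c_ge: "y $ i \<le> c * v i" if "cluster_point X y" for y i
    proof -
      have "y $ i / v i \<le> zm i $ i / v i" by (rule zm(2)[OF that])
      also have "\<dots> \<le> c" unfolding c_def by (rule Max_ge) auto
      finally show ?thesis using v_pos[of i] by (simp add: field_simps)
    qed
    define z where "z = zm i0"
    have z: "cluster_point X z" by (simp add: z_def zm)
    define Y where "Y m i = c * v i - (\<Psi>' ^^ m) z $ i" for m i
    have "\<exists>M. \<forall>j. Y M j = 0"
    proof (rule zero_spreads[OF conn, of Y "(\<Sum>i\<in>UNIV. \<bar>c * v i\<bar>) + \<delta> 0" i0])
      fix m i
      show "0 \<le> Y m i" using c_ge[OF bwds[OF z]] by (simp add: Y_def)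
      have "\<bar>c * v i\<bar> \<le> (\<Sum>i\<in>UNIV. \<bar>c * v i\<bar>)"
        by (rule member_le_sum[where f = "\<lambda>i. \<bar>c * v i\<bar>"]) auto
      then show "Y m i \<le> (\<Sum>i\<in>UNIV. \<bar>c * v i\<bar>) + \<delta> 0"
        using cl_bd[OF bwds[OF z], of m i] by (simp add: Y_def)
      define a where "a = (\<Psi>' ^^ Suc m) z"
      have a: "\<Psi> a = (\<Psi>' ^^ m) z" by (simp add: a_def inv\<Psi>)
      have "Y m = (\<lambda>j. c * v j - \<Psi> a $ j)" "Y (Suc m) = (\<lambda>j. c * v j - a $ j)"
        by (simp_all add: Y_def a a_def fun_eq_iff inv\<Psi>)
      moreover have "c * ((1 + \<rho>) * v i) = c * (inn v i + \<rho> * out v i)" by (simp add: eigen)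
      ultimately show "\<rho> * Y m i + Y (Suc m) i = inn (Y (Suc m)) i + \<rho> * out (Y m) i"
        using \<Psi>_rec[of a i] by (simp add: inn_diff out_diff inn_scale out_scale algebra_simps)
    next
      show "Y 0 i0 = 0" using v_pos[of i0] by (simp add: Y_def z_def i0)
      show "hub i0 \<or> (\<exists>U. test_function i0 U \<and> (\<exists>r p. hub p \<and> weight i0 U r p > 0))"
        using hubs by blast
    qed
    then obtain M where "\<And>j. Y M j = 0" by blast
    then have "(\<Psi>' ^^ M) z = c *\<^sub>R V" by (simp add: Y_def V_def vec_eq_iff)
    then show ?thesis using bwds[OF z, of M] by metis
  qed
  then obtain c where c: "cluster_point X (c *\<^sub>R V)" by blast
  have lim: "X \<longlonglongrightarrow> c *\<^sub>R V"
  proof (rule tendsto_stable_cluster_point[OF c _ X_P \<delta>_0])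
    fix m y
    have "P m y - c *\<^sub>R V = P m (y - c *\<^sub>R V)"
      using PV[of m c] by (simp add: P_def Fm_diff scaleR_diff_right)
    then show "norm (P m y - c *\<^sub>R V) \<le> K * norm (y - c *\<^sub>R V)"
      using P_le by simp
  qed
  have "c > 0"
  proof -
    define g where "g = Min (range (gap x (Suc 0)))"
    have g: "g > 0" "g \<le> gap x (Suc 0) i" for i
      using gap(1)[of 0] by (auto simp: g_def)
    define D where "D = 1 + (\<Sum>i\<in>UNIV. \<bar>v i - out v i\<bar>)"
    have D: "\<bar>v i - out v i\<bar> \<le> D" "D > 0" for i
    proof -
      show "D > 0" unfolding D_def by (simp add: sum_nonneg add_pos_nonneg)
      have "\<bar>v i - out v i\<bar> \<le> (\<Sum>i\<in>UNIV. \<bar>v i - out v i\<bar>)"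
        by (rule member_le_sum[where f = "\<lambda>i. \<bar>v i - out v i\<bar>"]) auto
      then show "\<bar>v i - out v i\<bar> \<le> D" by (simp add: D_def)
    qed
    \<comment> \<open>The source at time 0 dominates the gap of \<open>\<epsilon> \<rho>\<^sup>t v\<close>, so positivity compares \<open>x(t+1)\<close> with it.\<close>
    define \<epsilon> where "\<epsilon> = g / D"
    have \<epsilon>: "\<epsilon> > 0" using g D by (simp add: \<epsilon>_def)
    define d where "d t i = x (Suc t) i - \<epsilon> * (\<rho> ^ t * v i)" for t i
    have "0 \<le> gap d t i" for t i
    proof -
      have "gap d t i = gap (\<lambda>t. x (Suc t)) t i - \<epsilon> * gap (\<lambda>t i. \<rho> ^ t * v i) t i"
        by (cases t) (simp_all add: d_def[abs_def] gap_def inn_diff out_diff inn_scale out_scale algebra_simps)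
      also have "\<dots> \<ge> 0"
      proof (cases t)
        case 0
        have "x 0 = (\<lambda>i. 0)" using x0 by blast
        then have "gap (\<lambda>t. x (Suc t)) 0 i = gap x (Suc 0) i"
          by (simp add: gap_def)
        moreover have "\<epsilon> * (v i - out v i) \<le> \<epsilon> * D"
          using D(1)[of i] \<epsilon> by (intro mult_left_mono) auto
        ultimately show ?thesis
          using g(2)[of i] D(2) by (simp add: 0 gap_0 \<epsilon>_def)
      next
        case (Suc t')
        have "gap (\<lambda>t. x (Suc t)) t i = gap x (Suc t) i" by (simp add: Suc gap_Suc)
        then show ?thesis using gap(1)[of t i] gap_eigen[of t' i] by (simp add: Suc)
      qed
      finally show ?thesis .
    qed
    then have d0: "0 \<le> d t i" for t i by (rule nonneg_if_gap_nonneg[OF strict])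
    fix i :: 'a
    have "(\<lambda>t. X (Suc t) $ i) \<longlonglongrightarrow> (c *\<^sub>R V) $ i"
      by (intro tendsto_vec_nth LIMSEQ_Suc lim)
    moreover have "\<epsilon> * v i / \<rho> \<le> X (Suc t) $ i" for t
      using d0[of t i] \<rho>0 by (simp add: d_def X_def field_simps)
    ultimately have "\<epsilon> * v i / \<rho> \<le> (c *\<^sub>R V) $ i"
      by (intro LIMSEQ_le_const) auto
    then have "\<epsilon> * v i / \<rho> \<le> c * v i" by (simp add: V_def)
    moreover have "\<epsilon> * v i / \<rho> > 0" using \<epsilon> v_pos[of i] \<rho>0 by simp
    ultimately have "c * v i > 0" by linarith
    then show ?thesis using v_pos[of i] by (simp add: zero_less_mult_iff not_less_iff_gr_or_eq)
  qed
  moreover have "c *\<^sub>R V = (\<chi> i. c * v i)" by (simp add: V_def vec_eq_iff)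
  ultimately show ?thesis using lim unfolding X_def[abs_def] by metis
qed

end

section \<open>Diagrams inside a quiver\<close>

text \<open>
  Multiplication by the adjacency matrix of the diagram; a list of edges makes it computable.
\<close>

definition adj :: "(nat \<times> nat) list \<Rightarrow> (nat \<Rightarrow> 'b::comm_monoid_add) \<Rightarrow> nat \<Rightarrow> 'b" where
  "adj es u a = sum_list (map (\<lambda>(p, q). (if p = a then u q else 0) + (if q = a then u p else 0)) es)"

lemma adj_Cons: "adj ((p, q) # es) u a = ((if p = a then u q else 0) + (if q = a then u p else 0)) + adj es u a"
  by (simp add: adj_def)

lemma adj_path_edges:
  "adj (path_edges m) u a = (if Suc a < m then u (Suc a) else 0) + (if 0 < a \<and> a < m then u (a - 1) else 0)"
proof -
  have "adj (path_edges m) u a = (\<Sum>i<m - 1. (if i = a then u (Suc i) else 0) + (if Suc i = a then u i else 0))"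
    unfolding adj_def path_edges_def map_map
    by (simp add: comp_def interv_sum_list_conv_sum_set_nat atLeast0LessThan)
  also have "\<dots> = (\<Sum>i<m - 1. if i = a then u (Suc i) else 0) + (\<Sum>i<m - 1. if Suc i = a then u i else 0)"
    by (rule sum.distrib)
  also have "(\<Sum>i<m - 1. if i = a then u (Suc i) else 0) = (if Suc a < m then u (Suc a) else 0)"
    by auto
  also have "(\<Sum>i<m - 1. if Suc i = a then u i else 0) = (\<Sum>i<m - 1. if i = a - 1 then (if 0 < a then u i else 0) else 0)"
    by (rule sum.cong) auto
  also have "\<dots> = (if 0 < a \<and> a < m then u (a - 1) else 0)"
    by auto
  finally show ?thesis .
qed

lemma adj_real: "adj es (\<lambda>b. real (u b)) a = real (adj es u a)"
  by (induction es) (auto simp: adj_def)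

lemma adj_cong:
  assumes "\<And>p q. (p, q) \<in> set es \<Longrightarrow> u p = u' p \<and> u q = u' q"
  shows "adj es u a = adj es u' a"
  unfolding adj_def by (rule arg_cong[of _ _ sum_list], rule map_cong) (use assms in \<open>auto split: prod.splits\<close>)

text \<open>
  Waves on a diagram, indexed by the number of steps from the source \<open>a0\<close>.  Values are natural numbers so that
  tables of them can be checked by simplification.
\<close>

definition wave_on :: "nat \<Rightarrow> (nat \<times> nat) list \<Rightarrow> nat \<Rightarrow> (nat \<Rightarrow> nat \<Rightarrow> nat) \<Rightarrow> bool" where
  "wave_on n es a0 u \<longleftrightarrow> (\<exists>K. \<forall>k. \<forall>a<n. u k a \<le> K) \<and> (\<forall>a<n. u 0 a = (if a = a0 then 1 else 0)) \<and>
     (\<forall>a<n. u 1 a \<le> adj es (u 0) a) \<and> (\<forall>k. \<forall>a<n. u (Suc (Suc k)) a + u k a \<le> adj es (u (Suc k)) a)"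

text \<open>
  The source can avoid any prescribed first step.
\<close>

definition reflecting :: "nat \<Rightarrow> (nat \<times> nat) list \<Rightarrow> bool" where
  "reflecting n es \<longleftrightarrow> (\<exists>a0<n. \<forall>b<n. \<exists>u. wave_on n es a0 u \<and> u 1 b = 0)"

definition subadditive :: "nat \<Rightarrow> (nat \<times> nat) list \<Rightarrow> bool" where
  "subadditive n es \<longleftrightarrow> (\<exists>\<delta> :: nat \<Rightarrow> real. \<forall>a<n. 0 < \<delta> a \<and> 2 * \<delta> a \<le> adj es \<delta> a)"

text \<open>
  A wave that is eventually periodic is a list of \<open>l\<close> rows, after the last of which it continues with row \<open>r\<close>.
\<close>

primrec table_index :: "nat \<Rightarrow> nat \<Rightarrow> nat \<Rightarrow> nat" where
  "table_index l r 0 = 0"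
| "table_index l r (Suc k) = (if Suc (table_index l r k) = l then r else Suc (table_index l r k))"

definition table_ok :: "nat \<Rightarrow> (nat \<times> nat) list \<Rightarrow> nat \<Rightarrow> nat \<Rightarrow> nat list list \<Rightarrow> bool" where
  "table_ok n es a0 r tab \<longleftrightarrow> (let l = length tab; nxt = (\<lambda>i. if Suc i = l then r else Suc i) in
     r < l \<and> 1 < l \<and> list_all (\<lambda>a. tab ! 0 ! a = (if a = a0 then 1 else 0)) [0..<n] \<and>
     list_all (\<lambda>a. tab ! 1 ! a \<le> adj es (\<lambda>b. tab ! 0 ! b) a) [0..<n] \<and>
     list_all (\<lambda>i. list_all (\<lambda>a. tab ! nxt (nxt i) ! a + tab ! i ! a
        \<le> adj es (\<lambda>b. tab ! nxt i ! b) a) [0..<n]) [0..<l])"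

lemma table_ok_wave:
  assumes "table_ok n es a0 r tab"
  shows "wave_on n es a0 (\<lambda>k a. tab ! table_index (length tab) r k ! a)"
proof -
  define l where "l = length tab"
  define nxt where "nxt i = (if Suc i = l then r else Suc i)" for i
  have ok: "r < l" "1 < l" "\<And>a. a < n \<Longrightarrow> tab ! 0 ! a = (if a = a0 then 1 else 0)"
    "\<And>a. a < n \<Longrightarrow> tab ! 1 ! a \<le> adj es (\<lambda>b. tab ! 0 ! b) a"
    "\<And>i a. i < l \<Longrightarrow> a < n \<Longrightarrow> tab ! nxt (nxt i) ! a + tab ! i ! a \<le> adj es (\<lambda>b. tab ! nxt i ! b) a"
    using assms unfolding table_ok_def Let_def l_def[symmetric] nxt_def[symmetric]
    by (auto simp: list_all_iff)
  have Suc: "table_index l r (Suc k) = nxt (table_index l r k)" for k by (simp add: nxt_def)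
  have lt: "table_index l r k < l" for k
    using ok(1,2) by (induction k) auto
  define K where "K = (\<Sum>i<l. \<Sum>a<n. tab ! i ! a)"
  have "tab ! i ! a \<le> K" if "i < l" "a < n" for i a
  proof -
    have "tab ! i ! a \<le> (\<Sum>a<n. tab ! i ! a)"
      using that by (intro member_le_sum[where f = "\<lambda>a. tab ! i ! a"]) auto
    also have "\<dots> \<le> K"
      unfolding K_def using that by (intro member_le_sum[where f = "\<lambda>i. \<Sum>a<n. tab ! i ! a"]) auto
    finally show ?thesis .
  qed
  then have "\<forall>k. \<forall>a<n. tab ! table_index l r k ! a \<le> K" using lt by blast
  moreover have "table_index l r 1 = 1" using ok(2) by simp
  ultimately show ?thesis
    unfolding wave_on_def l_def[symmetric] Suc using ok lt by (auto simp del: table_index.simps(2) simp: Suc)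
qed

lemma reflectingI:
  assumes "a0 < n" and ok: "list_all (\<lambda>(r, tab). table_ok n es a0 r tab) tabs"
    and avoid: "list_all (\<lambda>b. list_ex (\<lambda>(r, tab). tab ! 1 ! b = 0) tabs) [0..<n]"
  shows "reflecting n es"
  unfolding reflecting_def
proof (intro exI[of _ a0] conjI allI impI assms(1))
  fix b assume "b < n"
  then have "list_ex (\<lambda>(r, tab). tab ! 1 ! b = 0) tabs" using avoid by (simp add: list_all_iff)
  then obtain r tab where t: "table_ok n es a0 r tab" "tab ! 1 ! b = 0"
    using ok by (auto simp: list_all_iff list_ex_iff)
  have "length tab > 1" using t(1) by (simp add: table_ok_def Let_def)
  then have "table_index (length tab) r 1 = 1" by simp
  then show "\<exists>u. wave_on n es a0 u \<and> u 1 b = 0"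
    using table_ok_wave[OF t(1)] t(2) by (intro exI[of _ "\<lambda>k a. tab ! table_index (length tab) r k ! a"]) auto
qed

context vertex_quiver begin

definition joins :: "'e \<Rightarrow> 'v \<Rightarrow> 'v \<Rightarrow> bool" where
  "joins e i j \<longleftrightarrow> e \<in> arcs G \<and> (tail G e = i \<and> head G e = j \<or> tail G e = j \<and> head G e = i)"

lemma joins_sym: "joins e i j \<Longrightarrow> joins e j i"
  by (auto simp: joins_def)

lemma joins_neq: "joins e i j \<Longrightarrow> i \<noteq> j"
  using no_loop[of e] by (auto simp: joins_def)

lemma joins_unique: "joins e i j \<Longrightarrow> joins e i' j' \<Longrightarrow> i = i' \<and> j = j' \<or> i = j' \<and> j = i'"
  by (auto simp: joins_def)

lemma incident_iff_joins: "incident e i \<longleftrightarrow> (\<exists>j. joins e i j)"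
  by (auto simp: incident_def joins_def)

lemma joins_other_end: "incident e i \<Longrightarrow> joins e i (other_end e i)"
  by (auto simp: incident_def joins_def other_end_def)

lemma other_end_joins: "joins e i j \<Longrightarrow> other_end e i = j"
  using no_loop[of e] by (auto simp: joins_def other_end_def)

definition embeds :: "nat \<Rightarrow> (nat \<times> nat) list \<Rightarrow> (nat \<Rightarrow> 'v) \<Rightarrow> (nat \<Rightarrow> 'e) \<Rightarrow> bool" where
  "embeds n es \<phi> \<psi> \<longleftrightarrow> inj_on \<phi> {..<n} \<and> inj_on \<psi> {..<length es} \<and>
     (\<forall>k<length es. fst (es ! k) < n \<and> snd (es ! k) < n \<and> joins (\<psi> k) (\<phi> (fst (es ! k))) (\<phi> (snd (es ! k))))"

lemma embeds_less:
  assumes "embeds n es \<phi> \<psi>" "(p, q) \<in> set es"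
  shows "p < n" "q < n"
proof -
  obtain k where "k < length es" "es ! k = (p, q)" using assms(2) by (metis in_set_conv_nth)
  then show "p < n" "q < n" using assms(1) by (auto simp: embeds_def)
qed

lemma embeds_new_edge:
  assumes "embeds n es \<phi> \<psi>" "joins e (\<phi> p) (\<phi> q)" "p < n" "q < n" "e \<notin> \<psi> ` {..<length es}"
  shows "embeds n ((p, q) # es) \<phi> (case_nat e \<psi>)"
  unfolding embeds_def
proof (intro conjI)
  show "inj_on (case_nat e \<psi>) {..<length ((p, q) # es)}"
  proof (rule inj_onI)
    fix k l assume "k \<in> {..<length ((p, q) # es)}" "l \<in> {..<length ((p, q) # es)}" "case_nat e \<psi> k = case_nat e \<psi> l"
    then show "k = l"
      using assms(1,5) by (cases k; cases l) (auto simp: embeds_def inj_on_def)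
  qed
  show "\<forall>k<length ((p, q) # es). fst (((p, q) # es) ! k) < n \<and> snd (((p, q) # es) ! k) < n \<and>
      joins (case_nat e \<psi> k) (\<phi> (fst (((p, q) # es) ! k))) (\<phi> (snd (((p, q) # es) ! k)))"
    using assms by (auto simp: embeds_def nth_Cons split: nat.split)
qed (use assms(1) in \<open>simp add: embeds_def\<close>)

lemma embeds_new_vertex:
  assumes "embeds n es \<phi> \<psi>" "y \<notin> \<phi> ` {..<n}"
  shows "embeds (Suc n) es (\<phi>(n := y)) \<psi>"
proof -
  have "inj_on (\<phi>(n := y)) {..<Suc n}"
    using assms by (auto simp: embeds_def lessThan_Suc inj_on_def)
  then show ?thesis
    using assms(1) unfolding embeds_def by (force simp: less_Suc_eq)
qed

lemma embeds_image_new_vertex: "(\<phi>(n := y)) ` {..<Suc n} = insert y (\<phi> ` {..<n})"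
  by (auto simp: lessThan_Suc)

definition at_arc :: "('v \<Rightarrow> real) \<Rightarrow> 'e \<Rightarrow> 'v \<Rightarrow> real" where
  "at_arc x e i = (if head G e = i then x (tail G e) else 0) + (if tail G e = i then x (head G e) else 0)"

lemma inn_out_at_arc: "inn x i + out x i = (\<Sum>e\<in>arcs G. at_arc x e i)"
  by (simp add: inn_as_arc_sum out_as_arc_sum at_arc_def sum.distrib)

lemma embeds_adj:
  assumes "embeds n es \<phi> \<psi>" "a < n"
  shows "inn x (\<phi> a) + out x (\<phi> a) = adj es (\<lambda>b. x (\<phi> b)) a + (\<Sum>e\<in>arcs G - \<psi> ` {..<length es}. at_arc x e (\<phi> a))"
proof -
  have inj: "inj_on \<psi> {..<length es}" and sub: "\<psi> ` {..<length es} \<subseteq> arcs G"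
    using assms(1) by (auto simp: embeds_def joins_def)
  have "(\<Sum>e\<in>\<psi> ` {..<length es}. at_arc x e (\<phi> a)) = (\<Sum>k<length es. at_arc x (\<psi> k) (\<phi> a))"
    by (simp add: sum.reindex[OF inj])
  also have "\<dots> = (\<Sum>k<length es. (case es ! k of (p, q) \<Rightarrow> (if p = a then x (\<phi> q) else 0) + (if q = a then x (\<phi> p) else 0)))"
  proof (rule sum.cong)
    fix k assume "k \<in> {..<length es}"
    then have k: "fst (es ! k) < n" "snd (es ! k) < n" "joins (\<psi> k) (\<phi> (fst (es ! k))) (\<phi> (snd (es ! k)))"
      using assms(1) by (auto simp: embeds_def)
    obtain p q where pq: "es ! k = (p, q)" by (cases "es ! k")
    have eq: "\<phi> p = \<phi> a \<longleftrightarrow> p = a" "\<phi> q = \<phi> a \<longleftrightarrow> q = a"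
      using inj_on_eq_iff[of \<phi> "{..<n}"] assms k pq by (auto simp: embeds_def)
    have "tail G (\<psi> k) = \<phi> p \<and> head G (\<psi> k) = \<phi> q \<or> tail G (\<psi> k) = \<phi> q \<and> head G (\<psi> k) = \<phi> p"
      using k(3) by (simp add: joins_def pq)
    then show "at_arc x (\<psi> k) (\<phi> a) = (case es ! k of (p, q) \<Rightarrow> (if p = a then x (\<phi> q) else 0) + (if q = a then x (\<phi> p) else 0))"
      by (elim disjE conjE) (simp_all add: at_arc_def pq eq add.commute)
  qed simp
  also have "\<dots> = adj es (\<lambda>b. x (\<phi> b)) a"
    by (simp add: adj_def sum_list_sum_nth atLeast0LessThan)
  finally have 1: "(\<Sum>e\<in>\<psi> ` {..<length es}. at_arc x e (\<phi> a)) = adj es (\<lambda>b. x (\<phi> b)) a" .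
  have "(\<Sum>e\<in>arcs G. at_arc x e (\<phi> a)) = (\<Sum>e\<in>arcs G - \<psi> ` {..<length es}. at_arc x e (\<phi> a))
      + (\<Sum>e\<in>\<psi> ` {..<length es}. at_arc x e (\<phi> a))"
    by (rule sum.subset_diff[OF sub]) simp
  then show ?thesis
    unfolding inn_out_at_arc 1 by (simp only: add.commute)
qed

lemma embeds_iso:
  assumes conn: "Digraph_Component.connected G" and emb: "embeds n es \<phi> \<psi>" and "n > 0"
    and closed: "\<And>e i. incident e i \<Longrightarrow> i \<in> \<phi> ` {..<n} \<Longrightarrow> e \<in> \<psi> ` {..<length es}"
  shows "same_underlying_graph G (diagram n es)"
proof -
  have ends: "tail G (\<psi> k) \<in> \<phi> ` {..<n} \<and> head G (\<psi> k) \<in> \<phi> ` {..<n}" if "k < length es" for k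
    using emb that by (auto simp: embeds_def joins_def)
  have surj: "\<phi> ` {..<n} = UNIV"
  proof (rule connected_closed_UNIV[OF conn])
    show "\<phi> 0 \<in> \<phi> ` {..<n}" using \<open>n > 0\<close> by auto
    fix e assume e: "e \<in> arcs G"
    have "tail G e \<in> \<phi> ` {..<n} \<and> head G e \<in> \<phi> ` {..<n}"
      if "tail G e \<in> \<phi> ` {..<n} \<or> head G e \<in> \<phi> ` {..<n}"
    proof -
      have "e \<in> \<psi> ` {..<length es}"
        using that closed[of e "tail G e"] closed[of e "head G e"] e by (auto simp: incident_def)
      then show ?thesis using ends by auto
    qed
    then show "tail G e \<in> \<phi> ` {..<n} \<longleftrightarrow> head G e \<in> \<phi> ` {..<n}" by blast
  qed
  have \<phi>: "bij_betw \<phi> {..<n} UNIV"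
    using emb surj by (simp add: embeds_def bij_betw_def)
  have "\<psi> ` {..<length es} = arcs G"
  proof
    show "\<psi> ` {..<length es} \<subseteq> arcs G" using emb by (auto simp: embeds_def joins_def)
    show "arcs G \<subseteq> \<psi> ` {..<length es}"
      using closed surj by (metis UNIV_I incident_def subsetI)
  qed
  then have \<psi>: "bij_betw \<psi> {..<length es} (arcs G)"
    using emb by (simp add: embeds_def bij_betw_def)
  define \<phi>' where "\<phi>' = inv_into {..<n} \<phi>"
  define \<psi>' where "\<psi>' = inv_into {..<length es} \<psi>"
  have inv: "\<phi>' (\<phi> a) = a" if "a < n" for a
    using \<phi> that by (simp add: \<phi>'_def bij_betw_def inv_into_f_f)
  have "bij_betw \<phi>' (verts G) (verts (diagram n es))"
    using bij_betw_inv_into[OF \<phi>] by (simp add: \<phi>'_def verts_UNIV diagram_def)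
  moreover have "bij_betw \<psi>' (arcs G) (arcs (diagram n es))"
    using bij_betw_inv_into[OF \<psi>] by (simp add: \<psi>'_def diagram_def)
  moreover have "{tail (diagram n es) (\<psi>' e), head (diagram n es) (\<psi>' e)} = \<phi>' ` {tail G e, head G e}"
    if "e \<in> arcs G" for e
  proof -
    obtain k where k: "k < length es" "e = \<psi> k" using \<psi> \<open>e \<in> arcs G\<close> by (auto simp: bij_betw_def)
    then have "\<psi>' e = k" using \<psi> by (simp add: \<psi>'_def bij_betw_def inv_into_f_f)
    then show ?thesis
      using emb k inv by (auto simp: embeds_def joins_def diagram_def)
  qed
  ultimately show ?thesis unfolding same_underlying_graph_def by blast
qed

text \<open>
  Extend the subadditive function by zero to \<open>d\<close>.  Since \<open>v\<close> is additive and the adjacency matrix is symmetric, the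
  excess of \<open>d\<close> over additivity is orthogonal to \<open>v\<close>; being nonnegative, it vanishes.  Any arrow that touches the
  diagram without belonging to it would contribute to the excess at its other end.
\<close>

lemma subadditive_embeds_iso:
  assumes conn: "Digraph_Component.connected G" and emb: "embeds n es \<phi> \<psi>" and "n > 0"
    and sub: "subadditive n es" and v: "\<And>i. v i > 0" "\<And>i. 2 * v i = inn v i + out v i"
  shows "same_underlying_graph G (diagram n es)"
proof (rule embeds_iso[OF conn emb \<open>n > 0\<close>])
  obtain \<delta> :: "nat \<Rightarrow> real" where \<delta>: "\<And>a. a < n \<Longrightarrow> 0 < \<delta> a" "\<And>a. a < n \<Longrightarrow> 2 * \<delta> a \<le> adj es \<delta> a"
    using sub by (auto simp: subadditive_def)
  have inj: "inj_on \<phi> {..<n}" using emb by (simp add: embeds_def)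
  define d where "d i = (if i \<in> \<phi> ` {..<n} then \<delta> (inv_into {..<n} \<phi> i) else 0)" for i
  have d\<phi>: "d (\<phi> a) = \<delta> a" if "a < n" for a
    using that inj by (auto simp: d_def inv_into_f_f)
  have d0: "0 \<le> d i" for i
    using \<delta>(1) d\<phi> by (cases "i \<in> \<phi> ` {..<n}") (auto simp: d_def less_imp_le)
  have c0: "0 \<le> at_arc d e i" for e i by (simp add: at_arc_def d0)
  have adj: "adj es (\<lambda>b. d (\<phi> b)) a = adj es \<delta> a" for a
    by (rule adj_cong) (use embeds_less[OF emb] d\<phi> in blast)
  define h where "h i = inn d i + out d i - 2 * d i" for i
  have h: "0 \<le> h i" for i
  proof (cases "i \<in> \<phi> ` {..<n}")
    case True
    then obtain a where a: "a < n" "i = \<phi> a" by auto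
    have "0 \<le> (\<Sum>e\<in>arcs G - \<psi> ` {..<length es}. at_arc d e (\<phi> a))" by (intro sum_nonneg c0)
    then show ?thesis using embeds_adj[OF emb a(1), of d] \<delta>(2)[OF a(1)] a by (simp add: h_def adj d\<phi>)
  next
    case False
    then show ?thesis using inn_nonneg[of d i] out_nonneg[of d i] d0 by (simp add: h_def d_def)
  qed
  have "(\<Sum>i\<in>UNIV. v i * h i) = (\<Sum>i\<in>UNIV. v i * inn d i + out d i * v i - 2 * v i * d i)"
    by (rule sum.cong) (simp_all add: h_def algebra_simps)
  also have "\<dots> = (\<Sum>i\<in>UNIV. v i * inn d i) + (\<Sum>i\<in>UNIV. out d i * v i) - (\<Sum>i\<in>UNIV. 2 * v i * d i)"
    by (simp only: sum.distrib sum_subtractf)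
  also have "\<dots> = (\<Sum>i\<in>UNIV. out v i * d i) + (\<Sum>i\<in>UNIV. d i * inn v i) - (\<Sum>i\<in>UNIV. 2 * v i * d i)"
    using inn_out_adjoint[of v d] inn_out_adjoint[of d v] by simp
  also have "\<dots> = (\<Sum>i\<in>UNIV. out v i * d i + d i * inn v i - 2 * v i * d i)"
    by (simp only: sum.distrib sum_subtractf)
  also have "\<dots> = 0"
  proof (rule sum.neutral, rule ballI)
    fix i
    show "out v i * d i + d i * inn v i - 2 * v i * d i = 0"
      using arg_cong[OF v(2)[of i], of "\<lambda>z. z * d i"] by (simp add: algebra_simps)
  qed
  finally have "(\<Sum>i\<in>UNIV. v i * h i) = 0" .
  moreover have "0 \<le> v i * h i" for i using h[of i] v(1)[of i] by simp
  ultimately have "v i * h i = 0" for i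
    using sum_nonneg_eq_0_iff[of UNIV "\<lambda>i. v i * h i"] by simp
  then have h0: "h i = 0" for i
    using v(1)[of i] by (metis less_irrefl mult_eq_0_iff)
  fix e i assume e: "incident e i" "i \<in> \<phi> ` {..<n}"
  define j where "j = other_end e i"
  have ej: "e \<in> arcs G" "at_arc d e j \<ge> d i"
    using e(1) d0 by (auto simp: j_def incident_def at_arc_def other_end_def)
  have di: "d i > 0" using e(2) \<delta>(1) d\<phi> by auto
  show "e \<in> \<psi> ` {..<length es}"
  proof (rule ccontr)
    assume ne: "e \<notin> \<psi> ` {..<length es}"
    show False
    proof (cases "j \<in> \<phi> ` {..<n}")
      case True
      then obtain b where b: "b < n" "j = \<phi> b" by auto
      have "at_arc d e j \<le> (\<Sum>e\<in>arcs G - \<psi> ` {..<length es}. at_arc d e j)"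
        using ne ej(1) c0 by (intro member_le_sum) auto
      then show False
        using embeds_adj[OF emb b(1), of d] \<delta>(2)[OF b(1)] b h0[of j] ej(2) di by (simp add: h_def adj d\<phi>)
    next
      case False
      have "at_arc d e j \<le> inn d j + out d j"
        unfolding inn_out_at_arc using ej(1) c0 by (intro member_le_sum) auto
      then show False using False h0[of j] ej(2) di by (simp add: h_def d_def)
    qed
  qed
qed

lemma reflecting_hub:
  fixes H :: "'v \<Rightarrow> int"
  assumes H: "\<And>e. e \<in> arcs G \<Longrightarrow> H (head G e) = H (tail G e) + 1"
    and emb: "embeds n es \<phi> \<psi>" and refl: "reflecting n es"
  shows "\<exists>q. hub q"
proof -
  obtain a0 where a0: "a0 < n" "\<And>b. b < n \<Longrightarrow> \<exists>u. wave_on n es a0 u \<and> u 1 b = 0"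
    using refl by (auto simp: reflecting_def)
  have inj: "inj_on \<phi> {..<n}" using emb by (simp add: embeds_def)
  have "\<exists>U. test_function (\<phi> a0) U \<and> (\<forall>e. incident e (\<phi> a0) \<and> (\<forall>b<n. other_end e (\<phi> a0) = \<phi> b \<longrightarrow> u 1 b = 0)
      \<longrightarrow> slack (\<phi> a0) U e)" if u: "wave_on n es a0 u" for u
  proof -
    define w where "w k i = (if k \<ge> 0 \<and> i \<in> \<phi> ` {..<n} then real (u (nat k) (inv_into {..<n} \<phi> i)) else 0)"
      for k :: int and i
    have w\<phi>: "w (int k) (\<phi> a) = real (u k a)" if "a < n" for k a
      using that inj by (auto simp: w_def inv_into_f_f)
    have w_out: "w k i = 0" if "i \<notin> \<phi> ` {..<n}" for k i using that by (simp add: w_def)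
    have w0: "0 \<le> w k i" for k i by (simp add: w_def)
    obtain K where K: "\<And>k a. a < n \<Longrightarrow> u k a \<le> K" using u by (auto simp: wave_on_def)
    have adj: "adj es (\<lambda>b. w (int k) (\<phi> b)) a = real (adj es (u k) a)" for k a
      unfolding adj_real[symmetric] by (rule adj_cong) (use embeds_less[OF emb] w\<phi> in blast)
    have nbrs: "real (adj es (u k) a) \<le> inn (w (int k)) (\<phi> a) + out (w (int k)) (\<phi> a)" if "a < n" for k a
    proof -
      have "0 \<le> (\<Sum>e\<in>arcs G - \<psi> ` {..<length es}. at_arc (w (int k)) e (\<phi> a))"
        by (intro sum_nonneg) (simp add: at_arc_def w0)
      then show ?thesis unfolding embeds_adj[OF emb that] adj by simp
    qed
    have "\<exists>U. test_function (\<phi> a0) U \<and> (\<forall>e. incident e (\<phi> a0) \<and> w 1 (other_end e (\<phi> a0)) = 0 \<longrightarrow> slack (\<phi> a0) U e)"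
    proof (rule wave_test_function[OF H w0])
      show "w 0 = indic (\<phi> a0)"
      proof
        fix i show "w 0 i = indic (\<phi> a0) i"
        proof (cases "i \<in> \<phi> ` {..<n}")
          case True
          then obtain a where a: "a < n" "i = \<phi> a" by auto
          then show ?thesis
            using w\<phi>[of a 0] u a0(1) inj by (auto simp: wave_on_def indic_def inj_on_def)
        next
          case False
          then show ?thesis using a0(1) by (auto simp: w_out indic_def)
        qed
      qed
      fix k i
      show "w k i = 0" if "k < 0" using that by (simp add: w_def)
      show "w k i \<le> real K"
        using K inv_into_into[of i \<phi> "{..<n}"] by (auto simp: w_def)
      show "w (k + 1) i + w (k - 1) i \<le> inn (w k) i + out (w k) i" if "k \<ge> 0"
      proof (cases "i \<in> \<phi> ` {..<n}")
        case True
        then obtain a where a: "a < n" "i = \<phi> a" by auto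
        obtain k' where k: "k = int k'" using \<open>k \<ge> 0\<close> nonneg_int_cases by blast
        show ?thesis
        proof (cases k')
          case 0
          have "w (k + 1) i = real (u 1 a)" using w\<phi>[OF a(1), of 1] a k 0 by simp
          moreover have "w (k - 1) i = 0" by (simp add: w_def k 0)
          moreover have "u 1 a \<le> adj es (u k') a" using u a by (simp add: wave_on_def 0)
          ultimately show ?thesis using nbrs[OF a(1), of k'] a k by simp
        next
          case (Suc l)
          have "w (k + 1) i = real (u (Suc (Suc l)) a)" "w (k - 1) i = real (u l a)"
            using w\<phi>[OF a(1), of "Suc (Suc l)"] w\<phi>[OF a(1), of l] a k Suc by (simp_all add: add.commute)
          moreover have "u (Suc (Suc l)) a + u l a \<le> adj es (u k') a" using u a by (simp add: wave_on_def Suc)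
          ultimately show ?thesis using nbrs[OF a(1), of k'] a k by simp
        qed
      qed (simp add: w_out inn_nonneg out_nonneg w0)
    qed
    then obtain U where U: "test_function (\<phi> a0) U"
      "\<And>e. incident e (\<phi> a0) \<Longrightarrow> w 1 (other_end e (\<phi> a0)) = 0 \<Longrightarrow> slack (\<phi> a0) U e" by blast
    have "w 1 (other_end e (\<phi> a0)) = 0" if "\<forall>b<n. other_end e (\<phi> a0) = \<phi> b \<longrightarrow> u 1 b = 0" for e
      using that w\<phi>[of _ 1] w_out[of "other_end e (\<phi> a0)" 1]
      by (cases "other_end e (\<phi> a0) \<in> \<phi> ` {..<n}") auto
    then show ?thesis using U by blast
  qed
  note test = this
  have "hub (\<phi> a0)"
    unfolding hub_def
  proof (intro allI impI)
    fix e assume e: "incident e (\<phi> a0)"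
    show "\<exists>U. test_function (\<phi> a0) U \<and> slack (\<phi> a0) U e"
    proof (cases "other_end e (\<phi> a0) \<in> \<phi> ` {..<n}")
      case True
      then obtain b where b: "b < n" "other_end e (\<phi> a0) = \<phi> b" by auto
      obtain u where u: "wave_on n es a0 u" "u 1 b = 0" using a0(2)[OF b(1)] by blast
      have "\<forall>b'<n. other_end e (\<phi> a0) = \<phi> b' \<longrightarrow> u 1 b' = 0"
        using b u(2) inj by (auto simp: inj_on_def)
      then show ?thesis using test[OF u(1)] e by blast
    next
      case False
      obtain u where u: "wave_on n es a0 u" using a0 by blast
      have "\<forall>b'<n. other_end e (\<phi> a0) = \<phi> b' \<longrightarrow> u 1 b' = 0" using False by auto
      then show ?thesis using test[OF u] e by blast
    qed
  qed
  then show ?thesis by blast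
qed

end

section \<open>Affine diagrams\<close>

definition affine_piece :: "nat \<Rightarrow> (nat \<times> nat) list \<Rightarrow> bool" where
  "affine_piece n es \<longleftrightarrow> 0 < n \<and> affine_dynkin_ADE (diagram n es) \<and> subadditive n es"

lemma affine_piece_A:
  assumes "m \<ge> 1"
  shows "affine_piece (m + 1) ((m, 0) # path_edges (m + 1))"
proof -
  have "\<forall>a<m + 1. 0 < (1 :: real) \<and> 2 * 1 \<le> adj ((m, 0) # path_edges (m + 1)) (\<lambda>_. 1 :: real) a"
    using assms by (auto simp: adj_Cons adj_path_edges)
  then show ?thesis
    using affine_dynkin_ADE.A[OF assms] unfolding affine_piece_def subadditive_def
    by (intro conjI exI[of _ "\<lambda>_. 1"]) auto
qed

text \<open>
  The additive function is 1 at the four ends and 2 along the spine.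
\<close>

lemma affine_piece_D:
  assumes "n \<ge> 4"
  shows "affine_piece (n + 1) ((1, n - 1) # (n - 3, n) # path_edges (n - 1))"
proof -
  define m where "m = n - 4"
  have n: "n = m + 4" using assms by (simp add: m_def)
  have n': "n - 1 = m + 3" "n - 3 = m + 1" by (simp_all add: n)
  let ?es = "(1, m + 3) # (m + 1, m + 4) # path_edges (m + 3)"
  define \<delta> :: "nat \<Rightarrow> real" where "\<delta> a = (if a = 0 \<or> a \<ge> m + 2 then 1 else 2)" for a
  have "0 < \<delta> a \<and> 2 * \<delta> a \<le> adj ?es \<delta> a" if an: "a < m + 5" for a
  proof -
    consider "a = 0" | "a = m + 2" | "a = m + 3" | "a = m + 4" | "0 < a" "a \<le> m + 1" using an by linarith
    then show ?thesis
    proof cases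
      case 5
      have "2 \<le> (if a = 1 then \<delta> (m + 3) else 0) + \<delta> (a - 1)"
        using 5 by (cases "a = 1") (simp_all add: \<delta>_def)
      moreover have "2 \<le> (if a = m + 1 then \<delta> (m + 4) else 0) + \<delta> (Suc a)"
        using 5 by (cases "a = m + 1") (simp_all add: \<delta>_def)
      moreover have "adj ?es \<delta> a = ((if a = 1 then \<delta> (m + 3) else 0) + \<delta> (a - 1))
          + ((if a = m + 1 then \<delta> (m + 4) else 0) + \<delta> (Suc a))"
        using 5 by (simp add: adj_Cons adj_path_edges)
      ultimately show ?thesis by (simp add: \<delta>_def)
    qed (simp_all add: adj_Cons adj_path_edges \<delta>_def)
  qed
  then have "subadditive (n + 1) ((1, n - 1) # (n - 3, n) # path_edges (n - 1))"
    unfolding subadditive_def n' by (intro exI[of _ \<delta>]) (simp add: n)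
  then show ?thesis
    using affine_dynkin_ADE.D[OF assms] unfolding affine_piece_def by simp
qed

lemma subadditiveI_nat:
  fixes \<delta> :: "nat list"
  assumes "list_all (\<lambda>a. 2 * \<delta> ! a \<le> adj es ((!) \<delta>) a \<and> 0 < \<delta> ! a) [0..<n]"
  shows "subadditive n es"
proof -
  have "0 < real (\<delta> ! a) \<and> 2 * real (\<delta> ! a) \<le> adj es (\<lambda>b. real (\<delta> ! b)) a" if "a < n" for a
  proof -
    have "\<forall>a\<in>set [0..<n]. 2 * \<delta> ! a \<le> adj es ((!) \<delta>) a \<and> 0 < \<delta> ! a"
      using assms unfolding list_all_iff .
    moreover have "a \<in> set [0..<n]" using \<open>a < n\<close> by simp
    ultimately have "2 * \<delta> ! a \<le> adj es ((!) \<delta>) a" and pos: "0 < \<delta> ! a" by blast+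
    then have le: "2 * real (\<delta> ! a) \<le> real (adj es ((!) \<delta>) a)"
      using of_nat_mono[of "2 * \<delta> ! a" "adj es ((!) \<delta>) a", where 'a = real] by simp
    have e: "adj es (\<lambda>b. real (\<delta> ! b)) a = real (adj es ((!) \<delta>) a)" by (rule adj_real)
    show ?thesis unfolding e using le pos by simp
  qed
  then show ?thesis
    unfolding subadditive_def by (intro exI[of _ "\<lambda>a. real (\<delta> ! a)"] allI impI)
qed

lemma affine_piece_E6: "affine_piece 7 ((2, 5) # (5, 6) # path_edges 5)"
  unfolding affine_piece_def
proof (intro conjI)
  show "subadditive 7 ((2, 5) # (5, 6) # path_edges 5)"
    by (rule subadditiveI_nat[of "[1, 2, 3, 2, 1, 2, 1]"]) (simp add: adj_def path_edges_def upt_rec)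
qed (simp_all add: affine_dynkin_ADE.E6)

text \<open>
  For each arm at the branch vertex there is a wave that starts into the two other arms only.  It is
  eventually periodic with values at most 2.  The tables for types E7 and E8 are analogous.
\<close>

lemma reflecting_E6: "reflecting 7 ((2, 5) # (5, 6) # path_edges 5)"
proof (rule reflectingI[of 2])
  let ?tabs = "[
    (1, [[0, 0, 1, 0, 0, 0, 0],
      [0, 1, 0, 1, 0, 0, 0],
      [0, 0, 1, 0, 1, 0, 0],
      [0, 0, 0, 1, 0, 1, 0],
      [0, 0, 1, 0, 0, 0, 1],
      [0, 1, 0, 0, 0, 1, 0],
      [1, 0, 1, 0, 0, 0, 0]]),
    (1, [[0, 0, 1, 0, 0, 0, 0],
      [0, 0, 0, 1, 0, 1, 0],
      [0, 0, 1, 0, 0, 0, 1],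
      [0, 1, 0, 0, 0, 1, 0],
      [1, 0, 1, 0, 0, 0, 0],
      [0, 1, 0, 1, 0, 0, 0],
      [0, 0, 1, 0, 1, 0, 0]]),
    (1, [[0, 0, 1, 0, 0, 0, 0],
      [0, 1, 0, 0, 0, 1, 0],
      [0, 0, 1, 0, 0, 0, 1],
      [0, 0, 0, 1, 0, 1, 0],
      [0, 0, 1, 0, 1, 0, 0],
      [0, 1, 0, 1, 0, 0, 0],
      [1, 0, 1, 0, 0, 0, 0]])]"
  show "list_all (\<lambda>(r, tab). table_ok 7 ((2, 5) # (5, 6) # path_edges 5) 2 r tab) ?tabs"
    by (simp add: table_ok_def adj_def path_edges_def upt_rec)
  show "list_all (\<lambda>b. list_ex (\<lambda>(r, tab). tab ! 1 ! b = 0) ?tabs) [0..<7]"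
    by (simp add: upt_rec)
qed simp

lemma affine_piece_E7: "affine_piece 8 ((3, 7) # path_edges 7)"
  unfolding affine_piece_def
proof (intro conjI)
  show "subadditive 8 ((3, 7) # path_edges 7)"
    by (rule subadditiveI_nat[of "[1, 2, 3, 4, 3, 2, 1, 2]"]) (simp add: adj_def path_edges_def upt_rec)
qed (simp_all add: affine_dynkin_ADE.E7)

lemma reflecting_E7: "reflecting 8 ((3, 7) # path_edges 7)"
proof (rule reflectingI[of 3])
  let ?tabs = "[
    (4, [[0, 0, 0, 1, 0, 0, 0, 0],
      [0, 0, 1, 0, 1, 0, 0, 0],
      [0, 1, 0, 1, 0, 1, 0, 0],
      [1, 0, 1, 0, 1, 0, 1, 1],
      [0, 1, 0, 2, 0, 1, 0, 0],
      [0, 0, 2, 0, 2, 0, 0, 0],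
      [0, 1, 0, 2, 0, 1, 0, 0],
      [1, 0, 1, 0, 1, 0, 1, 2]]),
    (2, [[0, 0, 0, 1, 0, 0, 0, 0],
      [0, 0, 0, 0, 1, 0, 0, 1],
      [0, 0, 0, 1, 0, 1, 0, 0],
      [0, 0, 1, 0, 1, 0, 0, 0],
      [0, 1, 0, 1, 0, 0, 0, 0],
      [1, 0, 1, 0, 0, 0, 0, 1],
      [0, 1, 0, 1, 0, 0, 0, 0],
      [0, 0, 1, 0, 1, 0, 0, 0],
      [0, 0, 0, 1, 0, 1, 0, 0],
      [0, 0, 0, 0, 1, 0, 1, 1]]),
    (2, [[0, 0, 0, 1, 0, 0, 0, 0],
      [0, 0, 1, 0, 0, 0, 0, 1],
      [0, 1, 0, 1, 0, 0, 0, 0],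
      [0, 0, 1, 0, 1, 0, 0, 0],
      [0, 0, 0, 1, 0, 1, 0, 0],
      [0, 0, 0, 0, 1, 0, 1, 1],
      [0, 0, 0, 1, 0, 1, 0, 0],
      [0, 0, 1, 0, 1, 0, 0, 0],
      [0, 1, 0, 1, 0, 0, 0, 0],
      [1, 0, 1, 0, 0, 0, 0, 1]])]"
  show "list_all (\<lambda>(r, tab). table_ok 8 ((3, 7) # path_edges 7) 3 r tab) ?tabs"
    by (simp add: table_ok_def adj_def path_edges_def upt_rec)
  show "list_all (\<lambda>b. list_ex (\<lambda>(r, tab). tab ! 1 ! b = 0) ?tabs) [0..<8]"
    by (simp add: upt_rec)
qed simp

lemma affine_piece_E8: "affine_piece 9 ((2, 8) # path_edges 8)"
  unfolding affine_piece_def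
proof (intro conjI)
  show "subadditive 9 ((2, 8) # path_edges 8)"
    by (rule subadditiveI_nat[of "[2, 4, 6, 5, 4, 3, 2, 1, 3]"]) (simp add: adj_def path_edges_def upt_rec)
qed (simp_all add: affine_dynkin_ADE.E8)

lemma reflecting_E8: "reflecting 9 ((2, 8) # path_edges 8)"
proof (rule reflectingI[of 2])
  let ?tabs = "[
    (5, [[0, 0, 1, 0, 0, 0, 0, 0, 0],
      [0, 1, 0, 1, 0, 0, 0, 0, 0],
      [1, 0, 1, 0, 1, 0, 0, 0, 0],
      [0, 1, 0, 1, 0, 1, 0, 0, 1],
      [0, 0, 2, 0, 1, 0, 1, 0, 0],
      [0, 1, 0, 2, 0, 1, 0, 0, 1],
      [0, 0, 2, 0, 2, 0, 0, 0, 0],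
      [0, 1, 0, 2, 0, 1, 0, 0, 1],
      [1, 0, 2, 0, 1, 0, 1, 0, 0],
      [0, 2, 0, 1, 0, 1, 0, 1, 1],
      [1, 0, 2, 0, 1, 0, 1, 0, 0]]),
    (7, [[0, 0, 1, 0, 0, 0, 0, 0, 0],
      [0, 0, 0, 1, 0, 0, 0, 0, 1],
      [0, 0, 1, 0, 1, 0, 0, 0, 0],
      [0, 1, 0, 1, 0, 1, 0, 0, 0],
      [1, 0, 1, 0, 1, 0, 1, 0, 0],
      [0, 1, 0, 1, 0, 1, 0, 1, 1],
      [0, 0, 2, 0, 1, 0, 1, 0, 0],
      [0, 1, 0, 2, 0, 1, 0, 0, 1],
      [0, 0, 2, 0, 2, 0, 0, 0, 0],
      [0, 1, 0, 2, 0, 1, 0, 0, 1],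
      [1, 0, 2, 0, 1, 0, 1, 0, 0],
      [0, 2, 0, 1, 0, 1, 0, 1, 1],
      [1, 0, 2, 0, 1, 0, 1, 0, 0]]),
    (6, [[0, 0, 1, 0, 0, 0, 0, 0, 0],
      [0, 1, 0, 0, 0, 0, 0, 0, 1],
      [1, 0, 1, 0, 0, 0, 0, 0, 0],
      [0, 1, 0, 1, 0, 0, 0, 0, 0],
      [0, 0, 1, 0, 1, 0, 0, 0, 0],
      [0, 0, 0, 1, 0, 1, 0, 0, 1],
      [0, 0, 1, 0, 1, 0, 1, 0, 0],
      [0, 1, 0, 1, 0, 1, 0, 0, 0],
      [1, 0, 1, 0, 1, 0, 0, 0, 0],
      [0, 1, 0, 1, 0, 0, 0, 0, 1],
      [0, 0, 2, 0, 0, 0, 0, 0, 0],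
      [0, 1, 0, 1, 0, 0, 0, 0, 1],
      [1, 0, 1, 0, 1, 0, 0, 0, 0],
      [0, 1, 0, 1, 0, 1, 0, 0, 0],
      [0, 0, 1, 0, 1, 0, 1, 0, 0],
      [0, 0, 0, 1, 0, 1, 0, 1, 1]])]"
  show "list_all (\<lambda>(r, tab). table_ok 9 ((2, 8) # path_edges 8) 2 r tab) ?tabs"
    by (simp add: table_ok_def adj_def path_edges_def upt_rec)
  show "list_all (\<lambda>b. list_ex (\<lambda>(r, tab). tab ! 1 ! b = 0) ?tabs) [0..<9]"
    by (simp add: upt_rec)
qed simp

text \<open>
  A signal runs along the spine until it splits at a fork; the two ends of the fork together send it back.
  Unrolled, it moves on a circle of length \<open>N = 2 n - 4\<close>, twice the spine with one point for each fork: the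
  spine vertex \<open>a\<close> sits at \<open>a - 1\<close> and at \<open>- a - 1\<close>, the ends of the forks at \<open>- 1\<close> and at \<open>n - 3\<close>.  This
  pattern is additive for all integer times, so it and its time reversal are waves, with disjoint first steps.
\<close>

lemma reflecting_D:
  assumes "n \<ge> 4"
  shows "reflecting (n + 1) ((1, n - 1) # (n - 3, n) # path_edges (n - 1))"
proof -
  define m where "m = n - 4"
  have n: "n = m + 4" using assms by (simp add: m_def)
  have n': "n - 1 = m + 3" "n - 3 = m + 1" by (simp_all add: n)
  let ?es = "(1, m + 3) # (m + 1, m + 4) # path_edges (m + 3)"
  define N where "N = 2 * int m + 4"
  define z :: "int \<Rightarrow> nat" where "z x = (if x mod N = 0 then 1 else 0)" for x
  have z_shift: "z (x + N) = z x" for x by (simp add: z_def)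
  have z_eq_0: "z x = 0" if "x \<noteq> 0" "\<bar>x\<bar> < N" for x
    using that zdvd_not_zless[of "\<bar>x\<bar>" N] by (auto simp: z_def mod_eq_0_iff_dvd)
  have z_0: "z 0 = 1" by (simp add: z_def)
  define D where "D k a = (if a = 0 \<or> a = m + 3 then z (k + 1)
     else if a = m + 2 \<or> a = m + 4 then z (k - int m - 1)
     else z (k + 1 - int a) + z (k + 1 + int a))" for k a
  have D_left: "D k 0 = z (k + 1)" "D k (m + 3) = z (k + 1)"
    and D_right: "D k (m + 2) = z (k - int m - 1)" "D k (m + 4) = z (k - int m - 1)" for k
    by (simp_all add: D_def)
  have D_spine: "D k a = z (k + 1 - int a) + z (k + 1 + int a)" if "0 < a" "a \<le> m + 1" for k a
    using that by (simp add: D_def)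
  have cases: "a = 0 \<or> a = m + 3 \<or> a = m + 2 \<or> a = m + 4 \<or> 0 < a \<and> a \<le> m + 1" if "a < m + 5" for a
    using that by linarith
  have add: "D (k + 1) a + D (k - 1) a = adj ?es (D k) a" if an: "a < m + 5" for k a
  proof -
    have e1: "z (k + int m + 3) = z (k - int m - 1)"
      using z_shift[of "k - int m - 1"] by (simp add: N_def algebra_simps)
    have e2: "z (k + int m + 2) = z (k - int m - 2)"
      using z_shift[of "k - int m - 2"] by (simp add: N_def algebra_simps)
    have adj_ends: "adj ?es (D k) 0 = D k 1" "adj ?es (D k) (m + 3) = D k 1"
      "adj ?es (D k) (m + 2) = D k (m + 1)" "adj ?es (D k) (m + 4) = D k (m + 1)"
      by (simp_all add: adj_Cons adj_path_edges)
    consider "a = 0 \<or> a = m + 3" | "a = m + 2 \<or> a = m + 4" | "0 < a" "a \<le> m + 1"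
      using cases[OF an] by blast
    then show ?thesis
    proof cases
      case 1
      then have "D (k + 1) a + D (k - 1) a = z (k + 2) + z k"
      proof -
        have "k + 1 + 1 = k + 2" "k - 1 + 1 = k" by simp_all
        then show ?thesis using 1 by (auto simp only: D_left)
      qed
      moreover have "D k 1 = z k + z (k + 2)"
      proof -
        have "k + 1 - int 1 = k" "k + 1 + int 1 = k + 2" by simp_all
        then show ?thesis using D_spine[of 1 k] by (simp add: add.commute)
      qed
      moreover have "adj ?es (D k) a = D k 1" using 1 adj_ends(1,2) by blast
      ultimately show ?thesis by linarith
    next
      case 2
      then have "D (k + 1) a + D (k - 1) a = z (k - int m) + z (k - int m - 2)"
      proof -
        have "k + 1 - int m - 1 = k - int m" "k - 1 - int m - 1 = k - int m - 2" by simp_all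
        then show ?thesis using 2 by (auto simp only: D_right)
      qed
      moreover have "D k (m + 1) = z (k - int m) + z (k + int m + 2)"
        using D_spine[of "m + 1" k] by (simp add: algebra_simps)
      moreover have "adj ?es (D k) a = D k (m + 1)" using 2 adj_ends(3,4) by blast
      ultimately show ?thesis using e2 by linarith
    next
      case 3
      have left: "(if a = 1 then D k (m + 3) else 0) + D k (a - 1) = z (k - int a + 2) + z (k + int a)"
      proof (cases "a = 1")
        case True
        then show ?thesis by (simp add: D_left add.commute)
      next
        case False
        then have "0 < a - 1" "a - 1 \<le> m + 1" using 3 by auto
        from D_spine[OF this, of k] show ?thesis using False 3 by (simp add: of_nat_diff algebra_simps)
      qed
      have right: "(if a = m + 1 then D k (m + 4) else 0) + D k (Suc a) = z (k - int a) + z (k + 2 + int a)"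
      proof (cases "a = m + 1")
        case True
        then have "Suc a = m + 2" "int a = int m + 1" by auto
        then show ?thesis using True e1 by (simp only: D_right) (simp add: algebra_simps)
      next
        case False
        then have "0 < Suc a" "Suc a \<le> m + 1" using 3 by auto
        from D_spine[OF this, of k] show ?thesis using False by (simp add: algebra_simps)
      qed
      have "adj ?es (D k) a = ((if a = 1 then D k (m + 3) else 0) + D k (a - 1)) + ((if a = m + 1 then D k (m + 4) else 0) + D k (Suc a))"
        using 3 by (simp add: adj_Cons adj_path_edges)
      also have "\<dots> = D (k + 1) a + D (k - 1) a"
        unfolding left right D_spine[OF 3] by (simp add: algebra_simps)
      finally show ?thesis by simp
    qed
  qed
  have D0: "D 0 a = (if a = 1 then 1 else 0)" if an: "a < m + 5" for a
  proof -
    have "z 1 = 0" "z (- int m - 1) = 0" by (rule z_eq_0; simp add: N_def)+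
    moreover have "z (1 - int a) = (if a = 1 then 1 else 0)" "z (1 + int a) = 0" if "0 < a" "a \<le> m + 1"
      using that z_0 z_eq_0[of "1 - int a"] z_eq_0[of "1 + int a"] by (auto simp: N_def)
    ultimately show ?thesis
      using cases[OF an] D_left[of 0] D_right[of 0] D_spine[of a 0] by auto
  qed
  have wave: "wave_on (m + 5) ?es 1 (\<lambda>k. D (s * int k))" if s: "s = 1 \<or> s = - 1" for s
    unfolding wave_on_def
  proof (intro conjI allI impI)
    show "\<exists>K. \<forall>k. \<forall>a<m + 5. D (s * int k) a \<le> K"
      by (rule exI[of _ 2]) (auto simp: D_def z_def)
    fix a assume a: "a < m + 5"
    show "D (s * int 0) a = (if a = 1 then 1 else 0)" using D0[OF a] by simp
    show "D (s * int 1) a \<le> adj ?es (D (s * int 0)) a"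
      using add[OF a, of 0] s by (elim disjE) simp_all
    fix k
    define j where "j = s * int (Suc k)"
    have j: "s * int (Suc (Suc k)) = j + s" "s * int k = j - s" by (simp_all add: j_def algebra_simps)
    have "D (j + s) a + D (j - s) a = adj ?es (D j) a"
      using add[OF a, of j] s by (elim disjE) (simp_all add: add.commute)
    then show "D (s * int (Suc (Suc k))) a + D (s * int k) a \<le> adj ?es (D (s * int (Suc k))) a"
      unfolding j j_def[symmetric] by simp
  qed
  have disjoint: "D 1 b = 0 \<or> D (- 1) b = 0" if bn: "b < m + 5" for b
  proof -
    have "D 1 b = 0" if "b = 0 \<or> b = m + 3"
    proof -
      have "z (1 + 1) = 0" by (rule z_eq_0) (simp_all add: N_def)
      then show ?thesis using that D_left[of 1] by auto
    qed
    moreover have "D (- 1) b = 0" if "b = m + 2 \<or> b = m + 4"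
    proof -
      have "z (- 1 - int m - 1) = 0" by (rule z_eq_0) (simp_all add: N_def)
      then show ?thesis using that D_right[of "- 1"] by auto
    qed
    moreover have "D (- 1) b = 0" if "0 < b" "b \<le> m + 1"
    proof -
      have "z (- 1 + 1 - int b) = 0" "z (- 1 + 1 + int b) = 0"
        using that by (auto intro!: z_eq_0 simp: N_def)
      then show ?thesis using D_spine[OF that, of "- 1"] by simp
    qed
    ultimately show ?thesis using cases[OF bn] by argo
  qed
  have "reflecting (m + 5) ?es"
    unfolding reflecting_def
  proof (intro exI[of _ 1] conjI allI impI)
    fix b assume b: "b < m + 5"
    have "D (1 * int 1) b = 0 \<or> D ((- 1) * int 1) b = 0" using disjoint[OF b] by simp
    then show "\<exists>u. wave_on (m + 5) ?es 1 u \<and> u 1 b = 0"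
      using wave[of 1] wave[of "- 1"] by blast
  qed simp
  moreover have "n + 1 = m + 5" by (simp add: n)
  ultimately show ?thesis unfolding n' n[symmetric] by (simp only:)
qed

context vertex_quiver begin

section \<open>Paths, cycles and gradings\<close>

definition simple_path :: "(nat \<Rightarrow> 'v) \<Rightarrow> (nat \<Rightarrow> 'e) \<Rightarrow> nat \<Rightarrow> bool" where
  "simple_path x a m \<longleftrightarrow> inj_on x {..m} \<and> (\<forall>k<m. joins (a k) (x k) (x (Suc k)))"

definition closes_cycle :: "(nat \<Rightarrow> 'v) \<Rightarrow> (nat \<Rightarrow> 'e) \<Rightarrow> nat \<Rightarrow> 'e \<Rightarrow> bool" where
  "closes_cycle x a m b \<longleftrightarrow> simple_path x a m \<and> m \<ge> 1 \<and> joins b (x m) (x 0) \<and> b \<notin> a ` {..<m}"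

definition has_cycle :: bool where
  "has_cycle \<longleftrightarrow> (\<exists>x a m b. closes_cycle x a m b)"

lemma simple_path_inj: "simple_path x a m \<Longrightarrow> i \<le> m \<Longrightarrow> j \<le> m \<Longrightarrow> x i = x j \<longleftrightarrow> i = j"
  by (auto simp: simple_path_def inj_on_def)

lemma simple_path_shift:
  assumes "simple_path x a m" "i + l \<le> m"
  shows "simple_path (\<lambda>k. x (i + k)) (\<lambda>k. a (i + k)) l"
  unfolding simple_path_def
proof (intro conjI allI impI)
  show "inj_on (\<lambda>k. x (i + k)) {..l}"
    using simple_path_inj[OF assms(1)] assms(2) by (intro inj_onI) fastforce
  fix k assume "k < l"
  then show "joins (a (i + k)) (x (i + k)) (x (i + Suc k))"
    using assms by (simp add: simple_path_def)
qed

lemma simple_path_rev: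
  assumes "simple_path x a m"
  shows "simple_path (\<lambda>k. x (m - k)) (\<lambda>k. a (m - 1 - k)) m"
  unfolding simple_path_def
proof (intro conjI allI impI)
  show "inj_on (\<lambda>k. x (m - k)) {..m}"
    using simple_path_inj[OF assms] by (intro inj_onI) (metis atMost_iff diff_diff_cancel diff_le_self)
  fix k assume "k < m"
  then have "joins (a (m - 1 - k)) (x (m - 1 - k)) (x (Suc (m - 1 - k)))"
    using assms by (simp add: simple_path_def)
  moreover have "Suc (m - 1 - k) = m - k" "m - 1 - k = m - Suc k" using \<open>k < m\<close> by auto
  ultimately show "joins (a (m - 1 - k)) (x (m - k)) (x (m - Suc k))" by (metis joins_sym)
qed

lemma simple_path_Cons:
  assumes "simple_path x a m" "joins e y (x 0)" "y \<notin> x ` {..m}"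
  shows "simple_path (case_nat y x) (case_nat e a) (Suc m)"
  unfolding simple_path_def
proof (intro conjI allI impI)
  show "inj_on (case_nat y x) {..Suc m}"
    using assms(3) simple_path_inj[OF assms(1)] by (intro inj_onI) (auto split: nat.splits)
  fix k assume "k < Suc m"
  then show "joins (case_nat e a k) (case_nat y x k) (case_nat y x (Suc k))"
    using assms(1,2) by (cases k) (auto simp: simple_path_def)
qed

lemma simple_path_length: "simple_path x a m \<Longrightarrow> m < CARD('v)"
  using card_inj_on_le[of x "{..m}" UNIV] by (auto simp: simple_path_def)

lemma simple_path_arcs_inj: 
  assumes "simple_path x a m"
  shows "inj_on a {..<m}"
proof (rule inj_onI)
  fix k l assume kl: "k \<in> {..<m}" "l \<in> {..<m}" "a k = a l"
  then have "joins (a k) (x k) (x (Suc k))" "joins (a k) (x l) (x (Suc l))"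
    using assms by (auto simp: simple_path_def)
  then have "x k = x l \<and> x (Suc k) = x (Suc l) \<or> x k = x (Suc l) \<and> x (Suc k) = x l"
    by (rule joins_unique)
  then have "k = l \<or> k = Suc l \<and> Suc k = l"
    using simple_path_inj[OF assms] kl(1,2) by auto
  then show "k = l" by auto
qed

lemma embeds_path:
  assumes "simple_path x a m"
  shows "embeds (m + 1) (path_edges (m + 1)) x a"
  using assms simple_path_arcs_inj[OF assms]
  by (auto simp: embeds_def path_edges_def simple_path_def lessThan_Suc_atMost)

text \<open>
  Take a largest set of vertices that is connected within itself and can be graded.  A further vertex next to it is
  joined to it by one arrow only, since two would close a cycle, so the grading extends.
\<close>

lemma grading_if_no_cycle:
  assumes conn: "Digraph_Component.connected G" and nc: "\<not> has_cycle"
  shows "\<exists>H :: 'v \<Rightarrow> int. \<forall>e\<in>arcs G. H (head G e) = H (tail G e) + 1"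
proof -
  define ok where "ok S H \<longleftrightarrow> S \<noteq> {} \<and> (\<forall>e\<in>arcs G. tail G e \<in> S \<longrightarrow> head G e \<in> S \<longrightarrow> H (head G e) = H (tail G e) + 1) \<and>
     (\<forall>i\<in>S. \<forall>j\<in>S. \<exists>x a m. simple_path x a m \<and> x ` {..m} \<subseteq> S \<and> x 0 = i \<and> x m = j)"
    for S and H :: "'v \<Rightarrow> int"
  have "ok {undefined} (\<lambda>_. 0)"
    unfolding ok_def
  proof (intro conjI ballI impI)
    fix e assume "e \<in> arcs G" "tail G e \<in> {undefined}" "head G e \<in> {undefined}"
    then show "0 = (0 :: int) + 1" using no_loop[of e] by simp
  next
    fix i j :: 'v assume "i \<in> {undefined}" "j \<in> {undefined}"
    then show "\<exists>x a m. simple_path x a m \<and> x ` {..m} \<subseteq> {undefined} \<and> x 0 = i \<and> x m = j"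
      by (intro exI[of _ "\<lambda>_. undefined"] exI[of _ 0]) (simp add: simple_path_def)
  qed simp
  then have "\<exists>S. (\<exists>H. ok S H) \<and> (\<forall>S'. (\<exists>H. ok S' H) \<longrightarrow> card S' \<le> card S)"
    by (intro ex_has_greatest_nat[of "\<lambda>S. \<exists>H. ok S H" "{undefined}" card "Suc CARD('v)"])
      (auto simp: less_Suc_eq_le intro: card_mono)
  then obtain S H where SH: "ok S H" and max: "\<And>S' H'. ok S' H' \<Longrightarrow> card S' \<le> card S" by metis
  have S_ne: "S \<noteq> {}"
    and S_arc: "\<And>e. e \<in> arcs G \<Longrightarrow> tail G e \<in> S \<Longrightarrow> head G e \<in> S \<Longrightarrow> H (head G e) = H (tail G e) + 1"
    and S_path: "\<And>i j. i \<in> S \<Longrightarrow> j \<in> S \<Longrightarrow> \<exists>x a m. simple_path x a m \<and> x ` {..m} \<subseteq> S \<and> x 0 = i \<and> x m = j"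
    using SH unfolding ok_def by simp_all
  have "S = UNIV"
  proof (rule ccontr)
    assume "S \<noteq> UNIV"
    obtain i0 where "i0 \<in> S" using S_ne by blast
    have "\<exists>e\<in>arcs G. (tail G e \<in> S) \<noteq> (head G e \<in> S)"
      using connected_closed_UNIV[OF conn \<open>i0 \<in> S\<close>] \<open>S \<noteq> UNIV\<close> by blast
    then obtain e z a where e: "joins e z a" "z \<notin> S" "a \<in> S"
      by (auto simp: joins_def)
    have uniq: "e' = e" if e': "joins e' z b" "b \<in> S" for e' b
    proof (rule ccontr)
      assume "e' \<noteq> e"
      obtain x p m where x: "simple_path x p m" "x ` {..m} \<subseteq> S" "x 0 = a" "x m = b"
        using S_path[OF e(3) e'(2)] by blast
      have "simple_path (case_nat z x) (case_nat e p) (Suc m)"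
        using simple_path_Cons[OF x(1), of e z] e x by auto
      moreover have "joins e' (case_nat z x (Suc m)) (case_nat z x 0)"
        using e' x by (simp add: joins_sym)
      moreover have "e' \<notin> case_nat e p ` {..<Suc m}"
      proof
        assume "e' \<in> case_nat e p ` {..<Suc m}"
        then obtain k where k: "k < Suc m" "e' = case_nat e p k" by auto
        then obtain k' where k': "k = Suc k'" "k' < m" "e' = p k'"
          using \<open>e' \<noteq> e\<close> by (cases k) auto
        then have "joins e' (x k') (x (Suc k'))" using x(1) by (simp add: simple_path_def)
        then have "z \<in> x ` {..m}"
          using joins_unique[OF e'(1)] k'(2) by fastforce
        then show False using x(2) e(2) by blast
      qed
      ultimately have "closes_cycle (case_nat z x) (case_nat e p) (Suc m) e'"
        by (simp add: closes_cycle_def)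
      then show False using nc by (auto simp: has_cycle_def)
    qed
    define H' where "H' = H(z := if tail G e = z then H a - 1 else H a + 1)"
    have "ok (insert z S) H'"
      unfolding ok_def
    proof (intro conjI ballI impI)
      fix e' assume e': "e' \<in> arcs G" "tail G e' \<in> insert z S" "head G e' \<in> insert z S"
      show "H' (head G e') = H' (tail G e') + 1"
      proof (cases "tail G e' = z \<or> head G e' = z")
        case True
        then have "\<exists>b. joins e' z b \<and> b \<in> S"
          using e' no_loop[of e'] by (auto simp: joins_def)
        then have "e' = e" using uniq by blast
        then show ?thesis
          using e(1) joins_neq[OF e(1)] by (auto simp: H'_def joins_def)
      next
        case False
        then have "tail G e' \<in> S" "head G e' \<in> S" "tail G e' \<noteq> z" "head G e' \<noteq> z" using e' by auto
        then show ?thesis using S_arc[OF e'(1)] by (simp add: H'_def)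
      qed
    next
      have to_z: "\<exists>x p m. simple_path x p m \<and> x ` {..m} \<subseteq> insert z S \<and> x 0 = z \<and> x m = j" if j: "j \<in> S" for j
      proof -
        obtain x p m where x: "simple_path x p m" "x ` {..m} \<subseteq> S" "x 0 = a" "x m = j"
          using S_path[OF e(3) j] by blast
        have "simple_path (case_nat z x) (case_nat e p) (Suc m)"
          using simple_path_Cons[OF x(1), of e z] e x by auto
        moreover have "case_nat z x ` {..Suc m} \<subseteq> insert z S"
        proof
          fix i assume "i \<in> case_nat z x ` {..Suc m}"
          then obtain k where "k \<le> Suc m" "i = case_nat z x k" by auto
          then show "i \<in> insert z S" using x(2) by (cases k) auto
        qed
        ultimately show ?thesis using x(4) by (intro exI[of _ "case_nat z x"] exI[of _ "case_nat e p"] exI[of _ "Suc m"]) auto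
      qed
      have from_z: "\<exists>x p m. simple_path x p m \<and> x ` {..m} \<subseteq> insert z S \<and> x 0 = j \<and> x m = z" if j: "j \<in> S" for j
      proof -
        obtain x p m where x: "simple_path x p m" "x ` {..m} \<subseteq> insert z S" "x 0 = z" "x m = j"
          using to_z[OF j] by blast
        have "(\<lambda>k. x (m - k)) ` {..m} \<subseteq> x ` {..m}" by (intro image_subsetI imageI) simp
        with x(2) have "(\<lambda>k. x (m - k)) ` {..m} \<subseteq> insert z S" by simp
        then show ?thesis using simple_path_rev[OF x(1)] x(3,4)
          by (intro exI[of _ "\<lambda>k. x (m - k)"] exI[of _ "\<lambda>k. p (m - 1 - k)"] exI[of _ m]) auto
      qed
      have zz: "\<exists>x p m. simple_path x p m \<and> x ` {..m} \<subseteq> insert z S \<and> x 0 = z \<and> x m = z"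
        by (rule exI[of _ "\<lambda>_. z"]) (auto simp: simple_path_def intro!: exI[of _ 0])
      fix i j assume ij: "i \<in> insert z S" "j \<in> insert z S"
      show "\<exists>x p m. simple_path x p m \<and> x ` {..m} \<subseteq> insert z S \<and> x 0 = i \<and> x m = j"
      proof (cases "i = z \<or> j = z")
        case True
        then show ?thesis using to_z from_z zz ij by blast
      next
        case False
        then have "i \<in> S" "j \<in> S" using ij by auto
        then obtain x p m where "simple_path x p m" "x ` {..m} \<subseteq> S" "x 0 = i" "x m = j"
          using S_path by blast
        then show ?thesis by blast
      qed
    qed auto
    then have "card (insert z S) \<le> card S" by (rule max)
    then show False using e(2) by simp
  qed
  then have "\<forall>e\<in>arcs G. H (head G e) = H (tail G e) + 1" using S_arc by blast
  then show ?thesis by blast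
qed

text \<open>
  Around a cycle a signal can run forever in both directions, so every vertex of the cycle is a hub.  If the
  signal enters the cycle from outside and turns right, the neighbour on the left retains positive weight.
\<close>

lemma cycle_hubs:
  assumes conn: "Digraph_Component.connected G" and cyc: "closes_cycle x a m b"
  shows "(\<exists>U. test_function s U) \<and> (hub s \<or> (\<exists>U. test_function s U \<and> (\<exists>r p. hub p \<and> weight s U r p > 0)))"
proof -
  have path: "simple_path x a m" and m: "m \<ge> 1" and b: "joins b (x m) (x 0)" "b \<notin> a ` {..<m}"
    using cyc by (auto simp: closes_cycle_def)
  define N where "N = int m + 1"
  \<comment> \<open>The cycle unrolled to a walk indexed by the integers.\<close>
  define X where "X k = x (nat (k mod N))" for k :: int
  define A where "A k = (if k mod N = int m then b else a (nat (k mod N)))" for k :: int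
  have N: "N > 1" using m by (simp add: N_def)
  have modN: "0 \<le> k mod N" "k mod N \<le> int m" for k
    using N pos_mod_sign[of N k] pos_mod_bound[of N k] by (auto simp: N_def)
  have mod_Suc: "(k + 1) mod N = (if k mod N = int m then 0 else k mod N + 1)" for k
  proof -
    have "(k + 1) mod N = (k mod N + 1) mod N" by (simp add: mod_add_left_eq)
    also have "\<dots> = (if k mod N = int m then 0 else k mod N + 1)"
      using modN[of k] by (auto simp: N_def)
    finally show ?thesis .
  qed
  have join: "joins (A k) (X k) (X (k + 1))" for k
  proof (cases "k mod N = int m")
    case True
    then show ?thesis using b by (simp add: A_def X_def mod_Suc)
  next
    case False
    then have "nat (k mod N) < m" using modN[of k] by auto
    moreover have "nat (k mod N + 1) = Suc (nat (k mod N))" using modN[of k] by simp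
    ultimately show ?thesis
      using path False by (simp add: A_def X_def mod_Suc simple_path_def)
  qed
  have A_neq: "A (k + 1) \<noteq> A k" for k
  proof -
    have inj: "inj_on a {..<m}" by (rule simple_path_arcs_inj[OF path])
    have lt: "nat (k mod N) < m" if "k mod N \<noteq> int m" for k using that modN[of k] by auto
    show ?thesis
    proof (cases "k mod N = int m")
      case True
      then have "A k = b" "A (k + 1) = a 0" using m by (auto simp: A_def mod_Suc)
      moreover have "a 0 \<in> a ` {..<m}" using m by (intro imageI) simp
      ultimately show ?thesis using b(2) by metis
    next
      case k: False
      show ?thesis
      proof (cases "(k + 1) mod N = int m")
        case True
        then show ?thesis using k b(2) lt[OF k] by (auto simp: A_def)
      next
        case False
        then have "A (k + 1) = a (Suc (nat (k mod N)))" "A k = a (nat (k mod N))"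
          "Suc (nat (k mod N)) < m"
          using k lt[OF False] modN[of k] by (auto simp: A_def mod_Suc nat_add_distrib)
        then show ?thesis
          using inj_onD[OF inj, of "Suc (nat (k mod N))" "nat (k mod N)"] lt[OF k] by auto
      qed
    qed
  qed
  have right: "\<exists>U. test_function (X k) U \<and> (\<forall>e. incident e (X k) \<and> e \<noteq> A k \<longrightarrow> slack (X k) U e)" for k
  proof -
    have "\<exists>U. test_function (X (k + int 0)) U \<and> (\<forall>e. incident e (X (k + int 0)) \<and> e \<noteq> A (k + int 0) \<longrightarrow> slack (X (k + int 0)) U e)"
    proof (rule walk_test_function[of "\<lambda>l. A (k + int l)" "\<lambda>l. X (k + int l)"])
      fix l
      show "incident (A (k + int l)) (X (k + int l))" using join incident_iff_joins by blast
      show "X (k + int (Suc l)) = other_end (A (k + int l)) (X (k + int l))"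
        using other_end_joins[OF join[of "k + int l"]] by (simp add: algebra_simps)
      show "A (k + int (Suc l)) \<noteq> A (k + int l)" using A_neq[of "k + int l"] by (simp add: algebra_simps)
    qed
    then show ?thesis by simp
  qed
  have left: "\<exists>U. test_function (X k) U \<and> (\<forall>e. incident e (X k) \<and> e \<noteq> A (k - 1) \<longrightarrow> slack (X k) U e)" for k
  proof -
    have "\<exists>U. test_function (X (k - int 0)) U \<and> (\<forall>e. incident e (X (k - int 0)) \<and> e \<noteq> A (k - 1 - int 0) \<longrightarrow> slack (X (k - int 0)) U e)"
    proof (rule walk_test_function[of "\<lambda>l. A (k - 1 - int l)" "\<lambda>l. X (k - int l)"])
      fix l
      have j: "joins (A (k - 1 - int l)) (X (k - int l)) (X (k - int (Suc l)))"
        using joins_sym[OF join[of "k - 1 - int l"]] by (simp add: algebra_simps)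
      then show "incident (A (k - 1 - int l)) (X (k - int l))" using incident_iff_joins by blast
      show "X (k - int (Suc l)) = other_end (A (k - 1 - int l)) (X (k - int l))"
        using other_end_joins[OF j] by simp
      show "A (k - 1 - int (Suc l)) \<noteq> A (k - 1 - int l)" using A_neq[of "k - 1 - int (Suc l)"] by (simp add: algebra_simps)
    qed
    then show ?thesis by simp
  qed
  have Xhub: "hub (X k)" for k
    unfolding hub_def using right[of k] left[of k] A_neq[of "k - 1"] by (metis diff_add_cancel)
  let ?L = "range X"
  show ?thesis
  proof (cases "s \<in> ?L")
    case True
    then obtain k where "s = X k" by blast
    then show ?thesis using right[of k] Xhub[of k] by blast
  next
    case False
    have "\<exists>U. test_function s U \<and> (\<lambda>w. \<exists>r p. p \<in> ?L \<and> w r p > 0) (\<lambda>r. weight s U r)"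
    proof (rule test_function_along_stems[OF conn _ False])
      fix q e assume qe: "q \<in> ?L" "incident e q" "other_end e q \<notin> ?L"
      then obtain k where k: "q = X k" by blast
      obtain U where U: "test_function q U" "\<And>e. incident e q \<Longrightarrow> e \<noteq> A k \<Longrightarrow> slack q U e"
        using right[of k] k by blast
      have "e \<noteq> A k" using qe(3) other_end_joins[OF join[of k]] k by auto
      then have "slack q U e" using U(2) qe by blast
      moreover have j: "joins (A (k - 1)) (X k) (X (k - 1))"
        using joins_sym[OF join[of "k - 1"]] by simp
      moreover have "slack q U (A (k - 1))"
        using U(2)[of "A (k - 1)"] j A_neq[of "k - 1"] k incident_iff_joins by auto
      then have "weight q U (if tail G (A (k - 1)) = q then 0 else 1) (X (k - 1)) > 0"
        using other_end_joins[OF j] k unfolding slack_def by simp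
      ultimately show "\<exists>U. test_function q U \<and> slack q U e \<and> (\<exists>r p. p \<in> ?L \<and> weight q U r p > 0)"
        using U(1) by blast
    next
      fix s and w w' :: "nat \<Rightarrow> 'v \<Rightarrow> real"
      assume "s \<notin> ?L" "\<exists>r p. p \<in> ?L \<and> 0 < w r p" "\<forall>r p. p \<noteq> s \<and> 0 < w r p \<longrightarrow> (\<exists>r'. 0 < w' r' p)"
      then show "\<exists>r p. p \<in> ?L \<and> 0 < w' r p" by metis
    qed auto
    then show ?thesis using Xhub by blast
  qed
qed

lemma hub_test_functions:
  assumes conn: "Digraph_Component.connected G" and "hub q" and e: "incident e q"
  shows "\<exists>U. test_function s U"
proof (cases "s = q")
  case True
  then show ?thesis using assms by (auto simp: hub_def)
next
  case False
  have "\<exists>U. test_function s U \<and> (\<lambda>w. True) (\<lambda>r. weight s U r)"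
    by (rule test_function_along_stems[OF conn, of "{q}"]) (use False assms in \<open>auto simp: hub_def\<close>)
  then show ?thesis by blast
qed

end

section \<open>Finding an affine subdiagram\<close>

lemma length_path_edges [simp]: "length (path_edges m) = m - 1"
  by (simp add: path_edges_def)

context vertex_quiver begin

lemma embeds_path_plus_vertex:
  assumes "simple_path x a m" "y \<notin> x ` {..m}" "joins e (x i) y" "i \<le> m"
  shows "embeds (m + 2) ((i, m + 1) # path_edges (m + 1)) (x(m + 1 := y)) (case_nat e a)"
proof -
  have x: "x ` {..<m + 1} = x ` {..m}" by (simp add: lessThan_Suc_atMost)
  have 1: "embeds (m + 2) (path_edges (m + 1)) (x(m + 1 := y)) a"
    using embeds_new_vertex[OF embeds_path[OF assms(1)], of y] assms(2) x by simp
  have "e \<notin> a ` {..<m}"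
  proof
    assume "e \<in> a ` {..<m}"
    then obtain k where "k < m" "e = a k" by auto
    then have "joins e (x k) (x (Suc k))" using assms(1) by (simp add: simple_path_def)
    then have "y \<in> x ` {..m}" using joins_unique[OF assms(3)] \<open>k < m\<close> by fastforce
    then show False using assms(2) by simp
  qed
  then show ?thesis
    using embeds_new_edge[OF 1, of e i "m + 1"] assms(3,4) by simp
qed

lemma chord_is_path_arc:
  assumes nc: "\<not> has_cycle" and path: "simple_path x a m" and "i < j" "j \<le> m" and e: "joins e (x i) (x j)"
  shows "e = a i \<and> j = Suc i"
proof -
  have p: "simple_path (\<lambda>k. x (i + k)) (\<lambda>k. a (i + k)) (j - i)"
    using simple_path_shift[OF path, of i "j - i"] assms by simp
  have "e \<in> (\<lambda>k. a (i + k)) ` {..<j - i}"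
  proof (rule ccontr)
    assume "\<not> ?thesis"
    then have "closes_cycle (\<lambda>k. x (i + k)) (\<lambda>k. a (i + k)) (j - i) e"
      using p assms by (auto simp: closes_cycle_def intro: joins_sym)
    then show False using nc by (auto simp: has_cycle_def)
  qed
  then obtain k where k: "k < j - i" "e = a (i + k)" by auto
  then have "joins e (x (i + k)) (x (Suc (i + k)))" using path assms(4) by (simp add: simple_path_def)
  from joins_unique[OF this e] have "i + k = i \<and> Suc (i + k) = j \<or> i + k = j \<and> Suc (i + k) = i"
    using simple_path_inj[OF path] assms k by auto
  then show ?thesis using k by auto
qed

lemma unique_attachment:
  assumes nc: "\<not> has_cycle" and path: "simple_path x a m" and "i \<le> j" "j \<le> m" and y: "y \<notin> x ` {..m}"
    and e: "joins e (x i) y" and e': "joins e' (x j) y"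
  shows "i = j \<and> e = e'"
proof -
  define x' where "x' = case_nat y (\<lambda>k. x (i + k))"
  define a' where "a' = case_nat e (\<lambda>k. a (i + k))"
  have p: "simple_path x' a' (Suc (j - i))"
    unfolding x'_def a'_def
  proof (rule simple_path_Cons)
    show "simple_path (\<lambda>k. x (i + k)) (\<lambda>k. a (i + k)) (j - i)"
      using simple_path_shift[OF path, of i "j - i"] assms by simp
    show "joins e y (x (i + 0))" using e by (simp add: joins_sym)
    show "y \<notin> (\<lambda>k. x (i + k)) ` {..j - i}" using y assms(3,4) by auto
  qed
  have "e' \<in> a' ` {..<Suc (j - i)}"
  proof (rule ccontr)
    assume "\<not> ?thesis"
    then have "closes_cycle x' a' (Suc (j - i)) e'"
      using p e' assms(3) by (auto simp: closes_cycle_def x'_def)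
    then show False using nc by (auto simp: has_cycle_def)
  qed
  then obtain k where k: "k < Suc (j - i)" "e' = a' k" by auto
  show ?thesis
  proof (cases k)
    case 0
    then have "e' = e" using k by (simp add: a'_def)
    moreover have "x i = x j" using joins_unique[OF e] e' \<open>e' = e\<close> joins_neq[OF e] by metis
    ultimately show ?thesis using simple_path_inj[OF path] assms(3,4) by auto
  next
    case (Suc l)
    then have l: "e' = a (i + l)" "i + l < m" using k assms(3,4) by (auto simp: a'_def)
    then have "joins e' (x (i + l)) (x (Suc (i + l)))" using path by (simp add: simple_path_def)
    then have "y \<in> x ` {..m}" using joins_unique[OF e'] l(2) by fastforce
    then show ?thesis using y by simp
  qed
qed

lemma longest_path_exists:
  "\<exists>x a m. simple_path x a m \<and> (\<forall>x' a' m'. simple_path x' a' m' \<longrightarrow> m' \<le> m)"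
proof -
  have "simple_path (\<lambda>_. undefined) (\<lambda>_. undefined) 0" by (simp add: simple_path_def)
  then have "\<exists>m. (\<exists>x a. simple_path x a m) \<and> (\<forall>m'. (\<exists>x a. simple_path x a m') \<longrightarrow> m' \<le> m)"
    using ex_has_greatest_nat[of "\<lambda>m. \<exists>x a. simple_path x a m" 0 "\<lambda>m. m" "CARD('v)"] simple_path_length
    by (metis less_imp_le)
  then show ?thesis by blast
qed

text \<open>
  Consider a longest simple path.  Its end points have no neighbours off the path.  If no vertex of the path has any,
  the graph is of type A.  Two attached arrows, at one vertex or at two, give an affine diagram of
  type D.  With a single attached arrow ending in \<open>y\<close>: if \<open>y\<close> has a further neighbour, both arms of the path have
  length at least 2, as the path is longest, and the affine diagram E6 appears; otherwise the graph is a star with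
  an arm of length 1, and is of type D or E or contains the affine diagram E7 or E8.
\<close>

theorem affine_subdiagram:
  assumes conn: "Digraph_Component.connected G" and nc: "\<not> has_cycle"
    and not_dynkin: "\<not> (\<exists>H. dynkin_ADE H \<and> same_underlying_graph G H)"
  shows "\<exists>n es \<phi> \<psi>. embeds n es \<phi> \<psi> \<and> affine_piece n es \<and> reflecting n es"
proof -
  obtain x a m where path: "simple_path x a m" and longest: "\<And>x' a' m'. simple_path x' a' m' \<Longrightarrow> m' \<le> m"
    using longest_path_exists by blast
  note inj = simple_path_inj[OF path]
  let ?S = "x ` {..m}"
  have interior: "0 < i \<and> i < m" if "i \<le> m" "joins e (x i) y" "y \<notin> ?S" for i e y
  proof -
    have "i \<noteq> 0"
    proof
      assume "i = 0"
      then have "simple_path (case_nat y x) (case_nat e a) (Suc m)"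
        using simple_path_Cons[OF path, of e y] that joins_sym by auto
      then show False using longest by fastforce
    qed
    moreover have "i \<noteq> m"
    proof
      assume "i = m"
      have "(\<lambda>k. x (m - k)) ` {..m} \<subseteq> ?S" by (intro image_subsetI imageI) simp
      then have "simple_path (case_nat y (\<lambda>k. x (m - k))) (case_nat e (\<lambda>k. a (m - 1 - k))) (Suc m)"
        using simple_path_Cons[OF simple_path_rev[OF path], of e y] that joins_sym \<open>i = m\<close> by auto
      then show False using longest by fastforce
    qed
    ultimately show ?thesis using that(1) by simp
  qed
  have path_arc: "e \<in> a ` {..<m}" if ij: "i \<le> m" "j \<le> m" "joins e (x i) (x j)" for e i j
  proof -
    have "i \<noteq> j" using joins_neq[OF ij(3)] by auto
    then consider "i < j" | "j < i" by linarith
    then show ?thesis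
    proof cases
      case 1
      then show ?thesis using chord_is_path_arc[OF nc path 1 ij(2,3)] ij by auto
    next
      case 2
      then show ?thesis using chord_is_path_arc[OF nc path 2 ij(1) joins_sym[OF ij(3)]] ij by auto
    qed
  qed
  have attach: "i = j \<and> e = e'" if "i \<le> m" "j \<le> m" "y \<notin> ?S" "joins e (x i) y" "joins e' (x j) y" for i j e e' y
  proof (cases "i \<le> j")
    case True
    then show ?thesis using unique_attachment[OF nc path _ that(2,3,4,5)] by simp
  next
    case False
    then show ?thesis using unique_attachment[OF nc path _ that(1,3,5,4)] by simp
  qed
  have img: "x ` {..<m + 1} = ?S" by (simp add: lessThan_Suc_atMost)
  have "\<exists>i e y. i \<le> m \<and> joins e (x i) y \<and> y \<notin> ?S"
  proof (rule ccontr)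
    assume none: "\<not> ?thesis"
    have "same_underlying_graph G (diagram (m + 1) (path_edges (m + 1)))"
    proof (rule embeds_iso[OF conn embeds_path[OF path]])
      fix e i assume e: "incident e i" "i \<in> x ` {..<m + 1}"
      then obtain k where k: "k \<le> m" "i = x k" by (auto simp: less_Suc_eq_le)
      have j: "joins e (x k) (other_end e i)" using joins_other_end[OF e(1)] k by simp
      then have "other_end e i \<in> ?S" using none k by blast
      then obtain l where "l \<le> m" "other_end e i = x l" by auto
      then show "e \<in> a ` {..<length (path_edges (m + 1))}" using path_arc[of k l e] j k by simp
    qed simp
    then show False using not_dynkin dynkin_ADE.A[of "m + 1"] by auto
  qed
  then obtain i e y where i: "i \<le> m" and e: "joins e (x i) y" and y: "y \<notin> ?S" by blast
  have im: "0 < i" "i < m" using interior[OF i e y] by auto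
  show ?thesis
  proof (cases "\<exists>j e' y'. j \<le> m \<and> joins e' (x j) y' \<and> y' \<notin> ?S \<and> e' \<noteq> e")
    case True
    then obtain j e' y' where j: "j \<le> m" and e': "joins e' (x j) y'" and y': "y' \<notin> ?S" and ne: "e' \<noteq> e" by blast
    have jm: "0 < j" "j < m" using interior[OF j e' y'] by auto
    \<comment> \<open>The stretch of the path between the two attachments, with one more path vertex on either side, is the spine with one end of each fork.\<close>
    have fork: "\<exists>n es \<phi> \<psi>. embeds n es \<phi> \<psi> \<and> affine_piece n es \<and> reflecting n es"
      if "0 < i" "i \<le> j" "j < m" "joins e (x i) y" "joins e' (x j) y'" "y \<notin> ?S" "y' \<notin> ?S" "e' \<noteq> e"
      for i j e e' y y'
    proof -
      have yy: "y \<noteq> y'" using attach[of i j y e e'] that by auto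
      define n where "n = j - i + 4"
      define x' where "x' k = x (i - 1 + k)" for k
      define a' where "a' k = a (i - 1 + k)" for k
      have n: "n \<ge> 4" "n - 1 = n - 2 + 1" "n - 3 \<le> n - 2" by (auto simp: n_def)
      have p: "simple_path x' a' (n - 2)"
        unfolding x'_def a'_def using simple_path_shift[OF path, of "i - 1" "n - 2"] that by (simp add: n_def)
      have sub: "x' ` {..n - 2} \<subseteq> ?S" using that(1-3) by (auto simp: x'_def n_def)
      have x'1: "x' 1 = x i" and x'j: "x' (n - 3) = x j" using that(1-3) by (auto simp: x'_def n_def)
      have s: "n - 2 + 2 = n" "n - 2 + 1 = n - 1" using n by auto
      show ?thesis
      proof -
        have arcs: "embeds (n - 1) (path_edges (n - 1)) x' a'" using embeds_path[OF p] by (simp only: s)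
        have im: "x' ` {..<n - 1} = x' ` {..n - 2}" using n(1) by (intro arg_cong[of _ _ "image x'"]) auto
        have l: "length (path_edges (n - 1)) = n - 2" by (simp add: path_edges_def)
        have "y \<notin> x' ` {..<n - 1}" using im sub that by auto
        from embeds_new_vertex[OF arcs this]
        have A1: "embeds n (path_edges (n - 1)) (x'(n - 1 := y)) a'" using n(1) by simp
        have img1: "(x'(n - 1 := y)) ` {..<n} = insert y (x' ` {..n - 2})"
          using embeds_image_new_vertex[of x' "n - 1" y] im n(1) by simp
        have "y' \<notin> (x'(n - 1 := y)) ` {..<n}" using img1 yy sub that by auto
        from embeds_new_vertex[OF A1 this]
        have A2: "embeds (n + 1) (path_edges (n - 1)) (x'(n - 1 := y, n := y')) a'" by simp
        have not_path: "f \<notin> a' ` {..<n - 2}" if "joins f z w" "w \<notin> ?S" for f z w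
        proof
          assume "f \<in> a' ` {..<n - 2}"
          then obtain k where k: "k < n - 2" "f = a' k" by auto
          then have "joins f (x' k) (x' (Suc k))" using p by (simp add: simple_path_def)
          then have "w \<in> x' ` {..n - 2}" using joins_unique[OF that(1)] k(1) by fastforce
          then show False using sub that(2) by auto
        qed
        have A3: "embeds (n + 1) ((n - 3, n) # path_edges (n - 1)) (x'(n - 1 := y, n := y')) (case_nat e' a')"
        proof (rule embeds_new_edge[OF A2])
          show "joins e' ((x'(n - 1 := y, n := y')) (n - 3)) ((x'(n - 1 := y, n := y')) n)"
          proof -
            have "n - 3 \<noteq> n - 1" "n - 3 \<noteq> n" using n(1) by linarith+
            then show ?thesis using that(5) x'j by simp
          qed
          show "e' \<notin> a' ` {..<length (path_edges (n - 1))}" using not_path[OF that(5,7)] l by simp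
        qed (use n in auto)
        have "embeds (n + 1) ((1, n - 1) # (n - 3, n) # path_edges (n - 1)) (x'(n - 1 := y, n := y')) (case_nat e (case_nat e' a'))"
        proof (rule embeds_new_edge[OF A3])
          show "joins e ((x'(n - 1 := y, n := y')) 1) ((x'(n - 1 := y, n := y')) (n - 1))"
          proof -
            have "1 \<noteq> n - 1" "1 \<noteq> n" "n - 1 \<noteq> n" using n(1) by linarith+
            then show ?thesis using that(4) x'1 by simp
          qed
          show "e \<notin> case_nat e' a' ` {..<length ((n - 3, n) # path_edges (n - 1))}"
          proof
            assume "e \<in> case_nat e' a' ` {..<length ((n - 3, n) # path_edges (n - 1))}"
            then obtain k where k: "k < Suc (n - 2)" "e = case_nat e' a' k" using l by auto
            then show False using not_path[OF that(4,6)] that(8) by (cases k) auto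
          qed
        qed (use n in auto)
        then show ?thesis using affine_piece_D[OF n(1)] reflecting_D[OF n(1)] by blast
      qed
    qed
    show ?thesis
    proof (cases "i \<le> j")
      case True
      then show ?thesis using fork[OF im(1) True jm(2) e e' y y' ne] by blast
    next
      case False
      then show ?thesis using fork[OF jm(1) _ im(2) e' e y' y ne[symmetric]] by auto
    qed
  next
    case False
    then have only: "e' = e \<and> j = i" if "j \<le> m" "joins e' (x j) y'" "y' \<notin> ?S" for j e' y'
      using that e joins_unique joins_neq inj i y by (metis image_eqI atMost_iff)
    \<comment> \<open>Stated for any path with these properties, so that it applies to the reversed path as well: the arm towards \<open>x 0\<close> is the shorter one.\<close>
    have arms: "\<exists>n es \<phi> \<psi>. embeds n es \<phi> \<psi> \<and> affine_piece n es \<and> reflecting n es"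
      if path: "simple_path x a m" and im: "0 < i" "i \<le> m - i" and e: "joins e (x i) y" and y: "y \<notin> x ` {..m}"
        and only: "\<And>j e' y'. j \<le> m \<Longrightarrow> joins e' (x j) y' \<Longrightarrow> y' \<notin> x ` {..m} \<Longrightarrow> e' = e"
        and path_arc: "\<And>e i j. i \<le> m \<Longrightarrow> j \<le> m \<Longrightarrow> joins e (x i) (x j) \<Longrightarrow> e \<in> a ` {..<m}"
      for x a i
    proof -
      have i: "i \<le> m" using im by linarith
      note sh = simple_path_shift[OF path]
      show ?thesis
      proof (cases "\<exists>e2. incident e2 y \<and> e2 \<noteq> e")
        case True
        then obtain e2 where e2: "incident e2 y" "e2 \<noteq> e" by blast
        define z where "z = other_end e2 y"
        have j2: "joins e2 y z" using joins_other_end[OF e2(1)] by (simp add: z_def)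
        have z: "z \<notin> x ` {..m}"
        proof
          assume "z \<in> x ` {..m}"
          then obtain k where k: "k \<le> m" "z = x k" by auto
          have "joins e2 (x k) y" using joins_sym[OF j2] k by simp
          then show False using only[OF k(1) _ y] e2(2) by blast
        qed
        have zy: "z \<noteq> y" using joins_neq[OF j2] by auto
        have "i \<noteq> 1"
        proof
          assume "i = 1"
          have "simple_path (\<lambda>k. x (1 + k)) (\<lambda>k. a (1 + k)) (m - 1)" using sh[of 1 "m - 1"] im by simp
          then have sp: "simple_path (case_nat y (\<lambda>k. x (1 + k))) (case_nat e (\<lambda>k. a (1 + k))) (Suc (m - 1))"
          proof (rule simple_path_Cons)
            show "joins e y (x (1 + 0))" using joins_sym[OF e] \<open>i = 1\<close> by simp
            show "y \<notin> (\<lambda>k. x (1 + k)) ` {..m - 1}"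
            proof
              assume "y \<in> (\<lambda>k. x (1 + k)) ` {..m - 1}"
              then obtain k where "k \<le> m - 1" "y = x (1 + k)" by auto
              then show False using y im by auto
            qed
          qed
          have "simple_path (case_nat z (case_nat y (\<lambda>k. x (1 + k))))
              (case_nat e2 (case_nat e (\<lambda>k. a (1 + k)))) (Suc (Suc (m - 1)))"
          proof (rule simple_path_Cons[OF sp])
            show "joins e2 z (case_nat y (\<lambda>k. x (1 + k)) 0)" using joins_sym[OF j2] by simp
            show "z \<notin> case_nat y (\<lambda>k. x (1 + k)) ` {..Suc (m - 1)}"
            proof
              assume "z \<in> case_nat y (\<lambda>k. x (1 + k)) ` {..Suc (m - 1)}"
              then obtain k where k: "k \<le> Suc (m - 1)" "z = case_nat y (\<lambda>k. x (1 + k)) k" by auto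
              show False
              proof (cases k)
                case (Suc l)
                then have "z = x (1 + l)" "1 + l \<le> m" using k im by auto
                then show False using z by auto
              qed (use k zy in simp)
            qed
          qed
          then show False using longest im by fastforce
        qed
        then have i2: "2 \<le> i" "i + 2 \<le> m" using im by auto
        define x' where "x' k = x (i - 2 + k)" for k
        define a' where "a' k = a (i - 2 + k)" for k
        have p: "simple_path x' a' 4" unfolding x'_def a'_def using sh[of "i - 2" 4] i2 by simp
        have sub: "x' ` {..4} \<subseteq> x ` {..m}" using i2 by (auto simp: x'_def)
        have "i - 2 + 2 = i" using i2 by simp
        then have x'2: "x' 2 = x i" unfolding x'_def by (rule arg_cong)
        have not_path: "f \<notin> a' ` {..<4}" if "joins f u w" "w \<notin> x ` {..m}" for f u w
        proof
          assume "f \<in> a' ` {..<4}"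
          then obtain k where k: "k < 4" "f = a' k" by auto
          then have "joins f (x' k) (x' (Suc k))" using p by (simp add: simple_path_def)
          then have "w \<in> x' ` {..4}" using joins_unique[OF that(1)] k(1) by fastforce
          then show False using sub that(2) by auto
        qed
        have A0: "embeds 5 (path_edges 5) x' a'" using embeds_path[OF p] by simp
        have im5: "x' ` {..<5} = x' ` {..4}" by (intro arg_cong[of _ _ "image x'"]) auto
        have l: "length (path_edges 5) = 4" by (simp add: path_edges_def)
        have A1: "embeds 6 (path_edges 5) (x'(5 := y)) a'"
          using embeds_new_vertex[OF A0, of y] im5 sub y by auto
        have img1: "(x'(5 := y)) ` {..<6} = insert y (x' ` {..4})"
          using embeds_image_new_vertex[of x' 5 y] im5 by simp
        have A2: "embeds 7 (path_edges 5) (x'(5 := y, 6 := z)) a'"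
          using embeds_new_vertex[OF A1, of z] img1 sub z zy by auto
        have A3: "embeds 7 ((5, 6) # path_edges 5) (x'(5 := y, 6 := z)) (case_nat e2 a')"
          by (rule embeds_new_edge[OF A2]) (use j2 not_path[OF j2 z] l in auto)
        have "e \<notin> case_nat e2 a' ` {..<length ((5, 6) # path_edges 5)}"
        proof
          assume "e \<in> case_nat e2 a' ` {..<length ((5, 6) # path_edges 5)}"
          then obtain k where "k < Suc 4" "e = case_nat e2 a' k" using l by auto
          then show False using not_path[OF e y] e2(2) by (cases k) auto
        qed
        then have "embeds 7 ((2, 5) # (5, 6) # path_edges 5) (x'(5 := y, 6 := z)) (case_nat e (case_nat e2 a'))"
          using e x'2 by (intro embeds_new_edge[OF A3]) auto
        then show ?thesis using affine_piece_E6 reflecting_E6 by blast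
      next
        case False
        then have leaf: "e2 = e" if "incident e2 y" for e2 using that by blast
        have closed: "same_underlying_graph G (diagram (m + 2) ((i', m + 1) # path_edges (m + 1)))"
          if p': "simple_path x' a' m" and S': "x' ` {..m} = x ` {..m}" and A': "a' ` {..<m} = a ` {..<m}"
            and i': "i' \<le> m" "x' i' = x i" for x' a' i'
        proof (rule embeds_iso[OF conn embeds_path_plus_vertex[OF p']])
          show "y \<notin> x' ` {..m}" "joins e (x' i') y" "i' \<le> m" using y e i' S' by auto
          fix f w assume f: "incident f w" "w \<in> (x'(m + 1 := y)) ` {..<m + 2}"
          have "w \<in> insert y (x ` {..m})" using f(2) S' by (auto simp: less_Suc_eq_le split: if_splits)
          moreover have "f \<in> insert e (a ` {..<m})" if "w \<in> x ` {..m}"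
          proof -
            obtain k where k: "k \<le> m" "w = x k" using \<open>w \<in> x ` {..m}\<close> by auto
            have j: "joins f (x k) (other_end f w)" using joins_other_end[OF f(1)] k by simp
            show ?thesis
            proof (cases "other_end f w \<in> x ` {..m}")
              case True
              then obtain l where "l \<le> m" "other_end f w = x l" by auto
              then show ?thesis using path_arc[of k l f] j k by auto
            next
              case False
              then show ?thesis using only[OF k(1) j] by simp
            qed
          qed
          ultimately have "f \<in> insert e (a' ` {..<m})" using leaf f(1) A' by auto
          moreover have "case_nat e a' ` {..<Suc m} = insert e (a' ` {..<m})"
            unfolding lessThan_Suc_eq_insert_0 by (auto simp: image_image)
          ultimately show "f \<in> case_nat e a' ` {..<length ((i', m + 1) # path_edges (m + 1))}"
            by simp
        qed simp
        consider "i = 1" | "i = 2" "m - i \<le> 4" | "i = 2" "m - i \<ge> 5" | "i \<ge> 3" using im by linarith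
        then show ?thesis
        proof cases
          case 1
          have "(\<lambda>k. x (m - k)) ` {..m} = x ` {..m}"
          proof -
            have "x k \<in> (\<lambda>k. x (m - k)) ` {..m}" if "k \<le> m" for k
              using that by (intro image_eqI[of _ _ "m - k"]) auto
            then show ?thesis by auto
          qed
          moreover have "(\<lambda>k. a (m - 1 - k)) ` {..<m} = a ` {..<m}"
          proof -
            have "a k \<in> (\<lambda>k. a (m - 1 - k)) ` {..<m}" if "k < m" for k
              using that by (intro image_eqI[of _ _ "m - 1 - k"]) auto
            then show ?thesis using im by auto
          qed
          ultimately have "same_underlying_graph G (diagram (m + 2) ((m - 1, m + 1) # path_edges (m + 1)))"
            using closed[OF simple_path_rev[OF path], of "m - 1"] im 1 by simp
          moreover have "dynkin_ADE (diagram (m + 2) ((m - 1, m + 1) # path_edges (m + 1)))"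
            using dynkin_ADE.D[of "m + 2"] im by simp
          ultimately show ?thesis using not_dynkin by blast
        next
          case 2
          have "same_underlying_graph G (diagram (m + 2) ((2, m + 1) # path_edges (m + 1)))"
            using closed[OF path refl refl, of 2] im 2 by simp
          moreover have "dynkin_ADE (diagram (m + 2) ((2, m + 1) # path_edges (m + 1)))"
          proof -
            have "m + 2 = 6 \<or> m + 2 = 7 \<or> m + 2 = 8" using im 2 by linarith
            then show ?thesis using dynkin_ADE.E[of "m + 2"] by auto
          qed
          ultimately show ?thesis using not_dynkin by blast
        next
          case 3
          have "simple_path x a 7" using sh[of 0 7] 3 by simp
          moreover have "y \<notin> x ` {..7}" using y 3 by auto
          ultimately have "embeds 9 ((2, 8) # path_edges 8) (x(8 := y)) (case_nat e a)"
            using embeds_path_plus_vertex[of x a 7 y e 2] e 3(1) by simp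
          then show ?thesis using affine_piece_E8 reflecting_E8 by blast
        next
          case 4
          have p: "simple_path (\<lambda>k. x (i - 3 + k)) (\<lambda>k. a (i - 3 + k)) 6" using sh[of "i - 3" 6] 4 im by simp
          have ny: "y \<notin> (\<lambda>k. x (i - 3 + k)) ` {..6}" using y 4 im by auto
          have "embeds 8 ((3, 7) # path_edges 7) ((\<lambda>k. x (i - 3 + k))(7 := y)) (case_nat e (\<lambda>k. a (i - 3 + k)))"
          proof -
            have "i - 3 + 3 = i" using 4 by simp
            then have "joins e (x (i - 3 + 3)) y" using e by (simp only:)
            then show ?thesis using embeds_path_plus_vertex[OF p ny, of e 3] by simp
          qed
          then show ?thesis using affine_piece_E7 reflecting_E7 by blast
        qed
      qed
    qed
    show ?thesis
    proof (cases "i \<le> m - i")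
      case True
      show ?thesis
        by (rule arms[OF path im(1) True e y]) (use only path_arc in blast)+
    next
      case False
      have S: "(\<lambda>k. x (m - k)) ` {..m} = ?S"
      proof -
        have "x k \<in> (\<lambda>k. x (m - k)) ` {..m}" if "k \<le> m" for k
          using that by (intro image_eqI[of _ _ "m - k"]) auto
        then show ?thesis by auto
      qed
      have A: "(\<lambda>k. a (m - 1 - k)) ` {..<m} = a ` {..<m}"
      proof -
        have "a k \<in> (\<lambda>k. a (m - 1 - k)) ` {..<m}" if "k < m" for k
          using that by (intro image_eqI[of _ _ "m - 1 - k"]) auto
        then show ?thesis using im by auto
      qed
      show ?thesis
      proof (rule arms[OF simple_path_rev[OF path], of "m - i"])
        show "0 < m - i" "m - i \<le> m - (m - i)" using False im by auto
        show "joins e (x (m - (m - i))) y" using e im by simp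
        show "y \<notin> (\<lambda>k. x (m - k)) ` {..m}" unfolding S by (rule y)
        fix j e' y' assume "j \<le> m" "joins e' (x (m - j)) y'" "y' \<notin> (\<lambda>k. x (m - k)) ` {..m}"
        then show "e' = e" unfolding S using only[of "m - j" e' y'] by auto
      next
        fix f k l assume "k \<le> m" "l \<le> m" "joins f (x (m - k)) (x (m - l))"
        then show "f \<in> (\<lambda>k. a (m - 1 - k)) ` {..<m}" unfolding A using path_arc[of "m - k" "m - l" f] by auto
      qed
    qed
  qed
qed

end

section \<open>The Coxeter matrix\<close>

text \<open>
  The eigenvalues are the roots of the characteristic polynomial, which is nonzero because the eigenvalues are bounded.
\<close>

lemma finite_eigenvalues:
  fixes A :: "complex ^ 'n ^ 'n"
  shows "finite {\<mu>. \<exists>x. x \<noteq> 0 \<and> A *v x = \<mu> *s x}"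
proof -
  define S where "S = (\<Sum>i\<in>UNIV. \<Sum>j\<in>UNIV. cmod (A $ i $ j))"
  define B where "B \<mu> = (\<chi> i j. A $ i $ j - (if i = j then \<mu> else 0))" for \<mu>
  have B: "B \<mu> *v x = A *v x - \<mu> *s x" for \<mu> x
  proof (rule vec_eq_iff[THEN iffD2], rule allI)
    fix i
    have "(\<Sum>j\<in>UNIV. (A $ i $ j - (if i = j then \<mu> else 0)) * x $ j)
        = (\<Sum>j\<in>UNIV. A $ i $ j * x $ j - (if i = j then \<mu> * x $ j else 0))"
      by (rule sum.cong) (auto simp: algebra_simps)
    then show "(B \<mu> *v x) $ i = (A *v x - \<mu> *s x) $ i"
      by (simp add: B_def matrix_vector_mult_def sum_subtractf)
  qed
  have eig_iff: "(\<exists>x. x \<noteq> 0 \<and> A *v x = \<mu> *s x) \<longleftrightarrow> det (B \<mu>) = 0" for \<mu>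
  proof -
    have "det (B \<mu>) \<noteq> 0 \<longleftrightarrow> (\<exists>C. C ** B \<mu> = mat 1)"
      using invertible_det_nz[of "B \<mu>"] invertible_left_inverse[of "B \<mu>"] by simp
    also have "\<dots> \<longleftrightarrow> (\<forall>x. A *v x - \<mu> *s x = 0 \<longrightarrow> x = 0)"
      unfolding matrix_left_invertible_ker B ..
    finally show ?thesis by auto
  qed
  define p where "p = det (\<chi> i j. [:A $ i $ j:] - (if i = j then [:0, 1:] else 0))"
  have p: "poly p \<mu> = det (B \<mu>)" for \<mu>
  proof -
    have e: "poly ([:A $ i $ j:] - (if i = j then [:0, 1:] else 0)) \<mu> = B \<mu> $ i $ j" for i j
      by (simp add: B_def)
    show ?thesis
      unfolding p_def det_def by (simp add: poly_sum poly_prod e del: poly_diff)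
  qed
  have bound: "cmod \<mu> \<le> S" if "x \<noteq> 0" "A *v x = \<mu> *s x" for \<mu> x
  proof -
    define m where "m = Max (range (\<lambda>i. cmod (x $ i)))"
    have "m \<in> range (\<lambda>i. cmod (x $ i))" unfolding m_def by (rule Max_in) auto
    then obtain i where i: "m = cmod (x $ i)" by blast
    have le: "cmod (x $ j) \<le> m" for j unfolding m_def by (rule Max_ge) auto
    have "m \<noteq> 0"
    proof
      assume "m = 0"
      then have "x = 0" using le by (simp add: vec_eq_iff)
      then show False using that(1) by simp
    qed
    then have m: "m > 0" using i by simp
    have "cmod \<mu> * m = cmod ((\<mu> *s x) $ i)" by (simp add: i norm_mult)
    also have "\<dots> = cmod (\<Sum>j\<in>UNIV. A $ i $ j * x $ j)"
      unfolding that(2)[symmetric] by (simp add: matrix_vector_mult_def)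
    also have "\<dots> \<le> (\<Sum>j\<in>UNIV. cmod (A $ i $ j) * m)"
      by (rule order_trans[OF norm_sum], rule sum_mono) (simp add: norm_mult mult_left_mono le)
    also have "\<dots> = (\<Sum>j\<in>UNIV. cmod (A $ i $ j)) * m" by (simp add: sum_distrib_right)
    also have "\<dots> \<le> S * m"
      unfolding S_def using m
      by (intro mult_right_mono member_le_sum[where f = "\<lambda>i. \<Sum>j\<in>UNIV. cmod (A $ i $ j)"]) (auto intro: sum_nonneg)
    finally show ?thesis using m by simp
  qed
  have "0 \<le> S" by (simp add: S_def sum_nonneg)
  then have "\<not> cmod (of_real (S + 1)) \<le> S" by simp
  then have "poly p (of_real (S + 1)) \<noteq> 0" unfolding p using eig_iff bound by metis
  then have "p \<noteq> 0" by auto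
  then have "finite {\<mu>. poly p \<mu> = 0}" by (rule poly_roots_finite)
  then show ?thesis unfolding p eig_iff .
qed

lemma spectral_radius_ge_real_eigenvalue:
  fixes M :: "real ^ 'n ^ 'n"
  assumes "M *v v = r *\<^sub>R v" "v \<noteq> 0"
  shows "\<bar>r\<bar> \<le> spectral_radius M"
proof -
  define x :: "complex ^ 'n" where "x = (\<chi> i. complex_of_real (v $ i))"
  have "x \<noteq> 0" using assms(2) by (simp add: x_def vec_eq_iff)
  moreover have "map_matrix complex_of_real M *v x = complex_of_real r *s x"
  proof (rule vec_eq_iff[THEN iffD2], rule allI)
    fix i
    have "(M *v v) $ i = r * v $ i" using assms(1) by simp
    then have "complex_of_real (\<Sum>j\<in>UNIV. M $ i $ j * v $ j) = complex_of_real (r * v $ i)"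
      by (simp add: matrix_vector_mult_def)
    then show "(map_matrix complex_of_real M *v x) $ i = (complex_of_real r *s x) $ i"
      by (simp add: matrix_vector_mult_def x_def map_matrix_def)
  qed
  ultimately have "cmod (complex_of_real r) \<in> cmod ` {\<mu>. \<exists>x :: complex ^ 'n. x \<noteq> 0 \<and> map_matrix complex_of_real M *v x = \<mu> *s x}"
    by blast
  then have "cmod (complex_of_real r) \<le> spectral_radius M"
    unfolding spectral_radius_def by (intro Max_ge finite_imageI finite_eigenvalues)
  then show ?thesis by simp
qed

lemma matrix_inv_eqI:
  fixes A B :: "'b::field ^ 'n ^ 'n"
  assumes "A ** B = mat 1"
  shows "matrix_inv A = B"
proof -
  have "B ** A = mat 1" using assms matrix_left_right_inverse by blast
  then have "\<exists>A'. A ** A' = mat 1 \<and> A' ** A = mat 1" using assms by blast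
  from someI_ex[OF this] have "matrix_inv A ** A = mat 1" unfolding matrix_inv_def by blast
  then have "matrix_inv A ** (A ** B) = B" by (simp add: matrix_mul_assoc)
  then show ?thesis by (simp add: assms)
qed

lemma minus_matrix_mult:
  fixes A :: "'b::ring_1 ^ 'n ^ 'm"
  shows "(- A) ** B = - (A ** B)" "A ** (- C) = - (A ** C)" "(- A) *v x = - (A *v x)" "A *v (- y) = - (A *v y)"
  by (simp_all add: matrix_matrix_mult_def matrix_vector_mult_def vec_eq_iff sum_negf)

context vertex_quiver begin

text \<open>
  The matrix of the Euler form; it is inverse to the transposed Cartan matrix since every nontrivial path has a first arrow.
\<close>

definition euler_matrix :: "real ^ 'v ^ 'v" where
  "euler_matrix = (\<chi> i j. (if i = j then 1 else 0) - real (card {e \<in> arcs G. tail G e = i \<and> head G e = j}))"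

lemma euler_matrix_mult: "euler_matrix *v x = (\<chi> i. x $ i - out (($) x) i)"
proof (rule vec_eq_iff[THEN iffD2], rule allI)
  fix i
  have c: "real (card {e \<in> arcs G. tail G e = i \<and> head G e = j}) * y
      = (\<Sum>e\<in>out_arcs G i. if head G e = j then y else 0)" for j y
  proof -
    have "(\<Sum>e\<in>out_arcs G i. if head G e = j then y else 0) = (\<Sum>e\<in>{e \<in> out_arcs G i. head G e = j}. y)"
      by (rule sum.inter_filter[symmetric]) (simp add: out_arcs_def)
    also have "{e \<in> out_arcs G i. head G e = j} = {e \<in> arcs G. tail G e = i \<and> head G e = j}" by auto
    finally show ?thesis by simp
  qed
  have "(euler_matrix *v x) $ i = (\<Sum>j\<in>UNIV. (if i = j then x $ j else 0) - (\<Sum>e\<in>out_arcs G i. if head G e = j then x $ j else 0))"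
    unfolding matrix_vector_mult_def euler_matrix_def
    by (simp add: left_diff_distrib c if_distrib[of "\<lambda>z. z * _"] cong: if_cong)
  also have "\<dots> = x $ i - (\<Sum>e\<in>out_arcs G i. x $ head G e)"
    by (simp add: sum_subtractf) (subst sum.swap, simp)
  finally show "(euler_matrix *v x) $ i = (\<chi> i. x $ i - out (($) x) i) $ i" by (simp add: out_def)
qed

lemma euler_matrix_transpose_mult: "transpose euler_matrix *v x = (\<chi> i. x $ i - inn (($) x) i)"
proof (rule vec_eq_iff[THEN iffD2], rule allI)
  fix i
  have c: "real (card {e \<in> arcs G. tail G e = j \<and> head G e = i}) * y
      = (\<Sum>e\<in>in_arcs G i. if tail G e = j then y else 0)" for j y
  proof -
    have "(\<Sum>e\<in>in_arcs G i. if tail G e = j then y else 0) = (\<Sum>e\<in>{e \<in> in_arcs G i. tail G e = j}. y)"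
      by (rule sum.inter_filter[symmetric]) (simp add: in_arcs_def)
    also have "{e \<in> in_arcs G i. tail G e = j} = {e \<in> arcs G. tail G e = j \<and> head G e = i}" by auto
    finally show ?thesis by simp
  qed
  have "(transpose euler_matrix *v x) $ i = (\<Sum>j\<in>UNIV. (if j = i then x $ j else 0) - (\<Sum>e\<in>in_arcs G i. if tail G e = j then x $ j else 0))"
    unfolding matrix_vector_mult_def euler_matrix_def transpose_def
    by (simp add: left_diff_distrib c if_distrib[of "\<lambda>z. z * _"] cong: if_cong)
  also have "\<dots> = x $ i - (\<Sum>e\<in>in_arcs G i. x $ tail G e)"
    by (simp add: sum_subtractf) (subst sum.swap, simp)
  finally show "(transpose euler_matrix *v x) $ i = (\<chi> i. x $ i - inn (($) x) i) $ i" by (simp add: inn_def)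
qed

lemma walks_first_arc:
  "{p. awalk j p i} = (if i = j then {[]} else {}) \<union> (\<Union>e\<in>out_arcs G j. (#) e ` {p. awalk (head G e) p i})"
proof (rule set_eqI)
  fix p show "p \<in> {p. awalk j p i} \<longleftrightarrow> p \<in> (if i = j then {[]} else {}) \<union> (\<Union>e\<in>out_arcs G j. (#) e ` {p. awalk (head G e) p i})"
    by (cases p) (auto simp: awalk_simps verts_UNIV)
qed

lemma finite_walks: "finite {p. awalk j p i}"
proof (induction "depth j" arbitrary: j rule: less_induct)
  case less
  have "finite (\<Union>e\<in>out_arcs G j. (#) e ` {p. awalk (head G e) p i})"
    using less depth_decreases by (intro finite_UN_I finite_imageI) (auto simp: finite_out_arcs)
  then show ?case by (subst walks_first_arc) auto
qed

lemma card_walks: "real (card {p. awalk j p i}) = (if i = j then 1 else 0) + out (\<lambda>k. real (card {p. awalk k p i})) j"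
proof -
  have f: "finite (out_arcs G j)" by (simp add: finite_out_arcs)
  have "card {p. awalk j p i} = card (if i = j then {[] :: 'e list} else {}) + card (\<Union>e\<in>out_arcs G j. (#) e ` {p. awalk (head G e) p i})"
    by (subst walks_first_arc, rule card_Un_disjoint) (auto intro!: finite_walks simp: f)
  also have "card (\<Union>e\<in>out_arcs G j. (#) e ` {p. awalk (head G e) p i}) = (\<Sum>e\<in>out_arcs G j. card ((#) e ` {p. awalk (head G e) p i}))"
    by (rule card_UN_disjoint) (auto intro!: finite_walks simp: f)
  also have "\<dots> = (\<Sum>e\<in>out_arcs G j. card {p. awalk (head G e) p i})"
    by (intro sum.cong card_image) auto
  finally show ?thesis by (simp add: out_def)
qed

lemma euler_cartan: "euler_matrix ** transpose (cartan_matrix G) = mat 1"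
proof -
  have "(euler_matrix ** transpose (cartan_matrix G)) $ j $ i = mat 1 $ j $ i" for i j
  proof -
    define x :: "real ^ 'v" where "x = (\<chi> k. real (card {p. awalk k p i}))"
    have "(euler_matrix ** transpose (cartan_matrix G)) $ j $ i = (euler_matrix *v x) $ j"
      by (simp add: matrix_matrix_mult_def matrix_vector_mult_def transpose_def cartan_matrix_def x_def)
    also have "\<dots> = x $ j - out (($) x) j" by (simp add: euler_matrix_mult)
    also have "\<dots> = (if i = j then 1 else 0)"
    proof -
      have "($) x = (\<lambda>k. real (card {p. awalk k p i}))" by (simp add: x_def fun_eq_iff)
      then show ?thesis using card_walks[of j i] by (simp add: x_def)
    qed
    finally show ?thesis by (simp add: mat_def)
  qed
  then show ?thesis by (simp add: vec_eq_iff)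
qed

lemma coxeter_inverse: "matrix_inv (coxeter_matrix G) = - (cartan_matrix G ** euler_matrix)"
proof -
  let ?C = "cartan_matrix G" and ?E = euler_matrix
  have 1: "?E ** transpose ?C = mat 1" "transpose ?C ** ?E = mat 1"
    using euler_cartan matrix_left_right_inverse by blast+
  have "transpose (?E ** transpose ?C) = transpose (mat 1)" "transpose (transpose ?C ** ?E) = transpose (mat 1)"
    using 1 by simp_all
  then have 2: "?C ** transpose ?E = mat 1" "transpose ?E ** ?C = mat 1"
    by (simp_all add: matrix_transpose_mul transpose_mat)
  have "coxeter_matrix G ** (- (?C ** ?E)) = transpose ?C ** (transpose ?E ** ?C) ** ?E"
    unfolding coxeter_matrix_def matrix_inv_eqI[OF 2(1)]
    by (simp add: matrix_mul_assoc minus_matrix_mult)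
  also have "\<dots> = mat 1" by (simp add: 1 2)
  finally show ?thesis by (rule matrix_inv_eqI)
qed

lemma eigenvector_equation:
  assumes "matrix_inv (coxeter_matrix G) *v v = r *\<^sub>R v"
  shows "- (v $ i - out (($) v) i) = r * (v $ i - inn (($) v) i)"
proof -
  let ?C = "cartan_matrix G" and ?E = euler_matrix
  have "transpose (?E ** transpose ?C) = transpose (mat 1)" using euler_cartan by simp
  then have "?C ** transpose ?E = mat 1" by (simp add: matrix_transpose_mul transpose_mat)
  then have 2: "transpose ?E ** ?C = mat 1" using matrix_left_right_inverse by blast
  have "transpose ?E *v (- (?C ** ?E) *v v) = transpose ?E *v (r *\<^sub>R v)"
    using assms by (simp add: coxeter_inverse)
  also have "transpose ?E *v (- (?C ** ?E) *v v) = - ((transpose ?E ** ?C) *v (?E *v v))"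
    by (simp add: matrix_vector_mul_assoc matrix_mul_assoc minus_matrix_mult)
  finally have "- (?E *v v) = r *\<^sub>R (transpose ?E *v v)"
    by (simp add: 2 matrix_vector_mult_scaleR)
  then have "(- (?E *v v)) $ i = (r *\<^sub>R (transpose ?E *v v)) $ i" by (rule arg_cong)
  then show ?thesis
    unfolding euler_matrix_mult euler_matrix_transpose_mult by simp
qed

end

section \<open>The asymptotic behaviour of the frieze\<close>

theorem proposition4p7:
  fixes G :: "('v::finite, 'e) pre_digraph"
    and f :: "'v \<Rightarrow> nat \<Rightarrow> real"
    and \<rho> :: real
    and v :: "real ^ 'v"
    and L :: "nat \<Rightarrow> real ^ 'v"
  assumes "verts G = UNIV"
    and "wild_quiver G"
    and "frieze_recursion G f"
    and "\<rho> = spectral_radius (matrix_inv (coxeter_matrix G))"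
    and "\<forall>i. v $ i > 0"
    and "norm v = 1"
    and "matrix_inv (coxeter_matrix G) *v v = inverse \<rho> *\<^sub>R v"
    and "\<forall>t. L t = (\<chi> i. ln (f i t))"
  shows "\<exists>\<eta>>0. (\<lambda>t. (1 / \<rho> ^ t) *\<^sub>R L t) \<longlonglongrightarrow> \<eta> *\<^sub>R v"
proof -
  have wild: "fin_digraph G" "Digraph_Component.connected G" "acyclic_quiver G"
    "\<And>H. dynkin_ADE H \<or> affine_dynkin_ADE H \<Longrightarrow> \<not> same_underlying_graph G H"
    using assms(2) by (auto simp: wild_quiver_def)
  interpret fin_digraph G by (rule wild(1))
  interpret vertex_quiver G
    by unfold_locales (rule assms(1), rule wild(3))
  note conn = wild(2)
  have v_pos: "v $ i > 0" for i using assms(5) by blast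
  have v0: "v \<noteq> 0" using assms(6) by auto
  have eq: "- (v $ i - out (($) v) i) = inverse \<rho> * (v $ i - inn (($) v) i)" for i
    by (rule eigenvector_equation[OF assms(7)])
  have "\<rho> \<noteq> 0"
  proof
    assume "\<rho> = 0"
    then have "v $ i = out (($) v) i" for i using eq[of i] by simp
    then have "v $ i = 0" for i by (rule sum_upward_closed_zero)
    then show False using v_pos by (metis less_irrefl)
  qed
  have ge: "\<bar>inverse \<rho>\<bar> \<le> \<rho>"
    using spectral_radius_ge_real_eigenvalue[OF assms(7) v0] unfolding assms(4)[symmetric] .
  then have "\<rho> > 0" using \<open>\<rho> \<noteq> 0\<close> by linarith
  then have "1 \<le> \<rho> * \<rho>" using ge by (simp add: field_simps)
  have \<rho>1: "\<rho> \<ge> 1"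
  proof (rule ccontr)
    assume "\<not> ?thesis"
    then have "\<rho> * \<rho> < 1 * 1" using \<open>\<rho> > 0\<close> by (intro mult_strict_mono) auto
    then show False using \<open>1 \<le> \<rho> * \<rho>\<close> by simp
  qed
  have eigen: "(1 + \<rho>) * v $ i = inn (($) v) i + \<rho> * out (($) v) i" for i
    using eq[of i] \<open>\<rho> > 0\<close> by (simp add: field_simps)
  have not_affine: False if "embeds n es \<phi> \<psi>" "affine_piece n es" "\<rho> = 1" for n es \<phi> \<psi>
  proof -
    have "2 * v $ i = inn (($) v) i + out (($) v) i" for i using eigen[of i] that(3) by simp
    then have "same_underlying_graph G (diagram n es)"
      using that(2) by (intro subadditive_embeds_iso[OF conn that(1), of "($) v"] v_pos) (auto simp: affine_piece_def)
    then show False using wild(4) that(2) by (auto simp: affine_piece_def)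
  qed
  define graded where "graded \<longleftrightarrow> (\<exists>H :: 'v \<Rightarrow> int. \<forall>e\<in>arcs G. H (head G e) = H (tail G e) + 1)"
  define near_hub where "near_hub \<longleftrightarrow> (\<forall>s. hub s \<or> (\<exists>U. test_function s U \<and> (\<exists>r p. hub p \<and> weight s U r p > 0)))"
  have "\<rho> \<noteq> 1 \<and> (\<forall>s. \<exists>U. test_function s U) \<and> (graded \<or> near_hub)"
  proof (cases has_cycle)
    case True
    then obtain x a m b where c: "closes_cycle x a m b" by (auto simp: has_cycle_def)
    then have path: "simple_path x a m" and m: "m \<ge> 1" and b: "joins b (x m) (x 0)" "b \<notin> a ` {..<m}"
      by (auto simp: closes_cycle_def)
    have "embeds (m + 1) ((m, 0) # path_edges (m + 1)) x (case_nat b a)"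
      by (rule embeds_new_edge[OF embeds_path[OF path]]) (use b in \<open>auto simp: path_edges_def\<close>)
    then have "\<rho> \<noteq> 1" using not_affine affine_piece_A[OF m] by blast
    then show ?thesis using cycle_hubs[OF conn c] unfolding near_hub_def by blast
  next
    case False
    obtain n es \<phi> \<psi> where emb: "embeds n es \<phi> \<psi>" "affine_piece n es" "reflecting n es"
      using affine_subdiagram[OF conn False] wild(4) by blast
    obtain H :: "'v \<Rightarrow> int" where H: "\<And>e. e \<in> arcs G \<Longrightarrow> H (head G e) = H (tail G e) + 1"
      using grading_if_no_cycle[OF conn False] by blast
    obtain q where q: "hub q" using reflecting_hub[OF H emb(1,3)] by blast
    have "\<exists>e. incident e q"
    proof (rule ccontr)
      assume none: "\<not> ?thesis"
      have "inn (($) v) q = 0" "out (($) v) q = 0"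
        unfolding inn_def out_def using none by (auto intro!: sum.neutral simp: incident_def)
      then show False using eigen[of q] v_pos[of q] \<open>\<rho> > 0\<close> by simp
    qed
    then have "\<exists>U. test_function s U" for s using hub_test_functions[OF conn q] by blast
    then show ?thesis using not_affine[OF emb(1,2)] H unfolding graded_def by blast
  qed
  then have \<rho>_gt_1: "\<rho> > 1" and tests: "\<And>s. \<exists>U. test_function s U" and alt: "graded \<or> near_hub"
    using \<rho>1 by auto
  interpret growth_quiver G \<rho> "($) v"
  proof unfold_locales
    show "\<rho> > 1" by (rule \<rho>_gt_1)
    show "v $ i > 0" for i by (rule v_pos)
    show "(1 + \<rho>) * v $ i = inn (($) v) i + \<rho> * out (($) v) i" for i by (rule eigen)
  qed
  have f0: "f i 0 = 1" and fS: "f i (Suc t) = (1 + (\<Prod>e\<in>in_arcs G i. f (tail G e) t) * (\<Prod>e\<in>out_arcs G i. f (head G e) (Suc t))) / f i t" for i t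
    using assms(3) unfolding frieze_recursion_def by blast+
  have f_pos: "f i t > 0" for i t
  proof (induction t arbitrary: i)
    case (Suc t)
    show ?case
    proof (induction "depth i" arbitrary: i rule: less_induct)
      case less
      have "0 \<le> (\<Prod>e\<in>in_arcs G i. f (tail G e) t)" using Suc by (intro prod_nonneg) (auto intro: less_imp_le)
      moreover have "0 \<le> (\<Prod>e\<in>out_arcs G i. f (head G e) (Suc t))"
        using less depth_decreases by (intro prod_nonneg) (auto intro: less_imp_le)
      ultimately have "0 < 1 + (\<Prod>e\<in>in_arcs G i. f (tail G e) t) * (\<Prod>e\<in>out_arcs G i. f (head G e) (Suc t))"
        by (simp add: add_pos_nonneg)
      then have "0 < (1 + (\<Prod>e\<in>in_arcs G i. f (tail G e) t) * (\<Prod>e\<in>out_arcs G i. f (head G e) (Suc t))) / f i t"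
        using Suc[of i] by (rule divide_pos_pos)
      then show ?case by (simp only: fS[of i t])
    qed
  qed (simp add: f0)
  define x where "x t i = ln (f i t)" for t i
  define \<pi> where "\<pi> t i = (\<Prod>e\<in>in_arcs G i. f (tail G e) t) * (\<Prod>e\<in>out_arcs G i. f (head G e) (Suc t))" for t i
  have \<pi>_pos: "\<pi> t i > 0" for t i unfolding \<pi>_def using f_pos by (simp add: prod_pos)
  have ln_\<pi>: "ln (\<pi> t i) = inn (x t) i + out (x (Suc t)) i" for t i
  proof -
    have ne: "f j t \<noteq> 0" for j t using f_pos[of j t] by simp
    have "ln (\<pi> t i) = ln (\<Prod>e\<in>in_arcs G i. f (tail G e) t) + ln (\<Prod>e\<in>out_arcs G i. f (head G e) (Suc t))"
      unfolding \<pi>_def using f_pos by (intro ln_mult_pos) (auto intro!: prod_pos)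
    then show ?thesis
      by (simp add: ln_prod finite_in_arcs finite_out_arcs ne inn_def out_def x_def)
  qed
  have gap: "gap x (Suc t) i = ln ((1 + \<pi> t i) / \<pi> t i)" for t i
  proof -
    have "f i (Suc t) * f i t = 1 + \<pi> t i"
      unfolding fS[of i t] using f_pos[of i t] by (simp add: \<pi>_def)
    then have "ln (1 + \<pi> t i) = x (Suc t) i + x t i"
      using ln_mult_pos[OF f_pos[of i "Suc t"] f_pos[of i t]] by (simp add: x_def)
    moreover have "ln ((1 + \<pi> t i) / \<pi> t i) = ln (1 + \<pi> t i) - ln (\<pi> t i)"
      using \<pi>_pos[of t i] by (intro ln_divide_pos) auto
    ultimately show ?thesis by (simp add: gap_Suc ln_\<pi>)
  qed
  have gap_pos: "0 < gap x (Suc t) i" for t i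
    unfolding gap using \<pi>_pos[of t i] by (intro ln_gt_zero) (simp add: field_simps)
  have x0: "x 0 i = 0" for i by (simp add: x_def f0)
  have "0 \<le> gap x t i" for t i
  proof (cases t)
    case 0
    have "x 0 = (\<lambda>_. 0)" by (simp add: fun_eq_iff x0)
    then show ?thesis by (simp add: 0 gap_0)
  qed (use gap_pos in \<open>simp add: less_imp_le\<close>)
  then have x_ge: "0 \<le> x t i" for t i
    by (rule nonneg_if_gap_nonneg[OF strict_test_function[OF tests]])
  have f_ge: "1 \<le> f i t" for i t
    using x_ge[of t i] f_pos[of i t] by (simp add: x_def)
  have gap_le: "gap x (Suc t) i \<le> ln 2" for t i
  proof -
    have "1 \<le> (\<Prod>e\<in>in_arcs G i. f (tail G e) t)" "1 \<le> (\<Prod>e\<in>out_arcs G i. f (head G e) (Suc t))"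
      by (intro prod_ge_1 f_ge)+
    then have "1 * 1 \<le> \<pi> t i"
      unfolding \<pi>_def by (intro mult_mono) linarith+
    then have "(1 + \<pi> t i) / \<pi> t i \<le> 2" by (simp add: field_simps)
    then show ?thesis unfolding gap using \<pi>_pos[of t i] by (intro ln_mono) (auto intro: divide_pos_pos add_pos_pos)
  qed
  obtain c where c: "c > 0" "(\<lambda>t. \<chi> i. x t i / \<rho> ^ t) \<longlonglongrightarrow> (\<chi> i. c * v $ i)"
    using growth_limit[of x "ln 2", OF conn tests alt[unfolded graded_def near_hub_def] x0 gap_pos gap_le] by auto
  moreover have "(\<chi> i. c * v $ i) = c *\<^sub>R v" by (simp add: vec_eq_iff)
  moreover have "(1 / \<rho> ^ t) *\<^sub>R L t = (\<chi> i. x t i / \<rho> ^ t)" for t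
    using assms(8) by (simp add: vec_eq_iff x_def)
  ultimately show ?thesis by auto
qed

end
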